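(* Let $n\ge 1$ and let $$\frac{dY}{dx}=A(x)Y,\qquad A(x)=\sum_{i=1}^{n+2}\frac{A_i}{x-t_i}\qquad (A_0)$$ be a non-resonant Fuchsian system normalized at infinity, with $t_{n+1}=0$, $t_{n+2}=1$, $t_{n+3}=\infty$. Assume that $(t_1,\dots,t_n)\in\pi^n=\{t\in\mathbb R^n:t_1<\dots<t_n<0\}$, that for $i=1,\dots,n+2$ the eigenvalues $\theta_i^+$ and $\theta_i^-$ of $A_i$ are real or complex conjugate to each other, and that the eigenvalues $\theta_\infty^+,\theta_\infty^-$ of $A_\infty$ are real. Assume moreover that a system of generators $(M_1,\dots,M_{n+3})$ of the monodromy of $(A_0)$ along the loops $\gamma_1,\dots,\gamma_{n+3}$ is contained in $U(2)$ or in $U(1,1)$. Then $(A_0)$ satisfies one of the three equivalent assertions (1) the Fuchsian second-order equation associated with $(A_0)$ is real; (2) there is a real number $\eta$ such that for every $i=1,\dots,n+2$, $A_i=\begin{pmatrix}a_i& b_ie^{i\eta}\\ c_ie^{-i\eta}& d_i\end{pmatrix}$ with $a_i,d_i\in\mathbb R$ and $b_i,c_i\in[0,+\infty[$; (3) for every system of generators $(N_1,\dots,N_{n+3})$ of the monodromy along $\gamma_1,\dots,\gamma_{n+3}$ there is $C\in GL_2(\mathbb C)$ with $C^{-1}\overline{N_j}\,C=(N_j\cdots N_1)^{-1}N_j^{-1}(N_j\cdots N_1)$ for all $j=1,\dots,n+3$; if and only if (condition C2) there are $n+3$ invertible matrices $D_1,\dots,D_{n+3}$ such that $$M_j=D_jD_{j-1}^{-1}\quad(j=1,\dots,n+3),\qquad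 \frac1{\delta_1}D_1^2=\cdots=\frac1{\delta_{n+3}}D_{n+3}^2,$$ where $\delta_j=\det D_j$ and indices are taken modulo $n+3$ (so $D_0=D_{n+3}$).
   Context: All systems are $2\times2$. $A_\infty:=-\sum_{i=1}^{n+2}A_i$ (also denoted $A_{n+3}$). "Normalized at infinity" means $A_\infty=\mathrm{diag}(\theta_\infty^+,\theta_\infty^-)$ is diagonal; "non-resonant" means $\theta_i^+-\theta_i^-\notin\mathbb Z$ for $i=1,\dots,n+3$ (with $\theta_{n+3}^\pm=\theta_\infty^\pm$). The second-order equation associated with the system (with $A_{12}\not\equiv0$) is the equation satisfied by the first component of all its solutions: $y''+py'+qy=0$ with $p=-A_{12}'/A_{12}-\operatorname{Tr}A$, $q=-A_{11}'+A_{11}A_{12}'/A_{12}+\det A$; it is real if $p,q$ are real-valued on the real axis. Fix $x_0$ in the upper half-plane. With $S(t)=\{t_1,\dots,t_{n+3}\}$, $\gamma_i\in\pi_1(\mathbb P^1\smallsetminus S(t),x_0)$ is the class of the loop going once positively around $t_i$, crossing $\mathbb R\cup\{\infty\}$ first in $]t_{i-1},t_i[$ and then in $]t_i,t_{i+1}[$ (indices cyclic mod $n+3$). A system of generators of the monodromy is the tuple of matrices $M_i$ defined by $\gamma_i*\mathbf Y=\mathbf Y M_i$ for some fundamental matrix of solutions $\mathbf Y$, where $\gamma_i*\mathbf Y$ is analytic continuation along $\gamma_i$; it satisfies $M_{n+3}\cdots M_1=\mathrm I_2$. $\overline{M}$ is the entrywise complex conjugate. $U(2)$ is the group of unitary $2\times2$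 matrices, and $U(1,1)$ is the group of $M\in M(2,\mathbb C)$ with $M\,\mathrm{diag}(1,-1)\,\overline M^{t}=\mathrm{diag}(1,-1)$.
   Formalization: In assertion (2), b_i and c_i range over all real numbers for the equivalence with C2: since A_∞ is diagonal their sums vanish, so b_i, c_i ≥ 0 would force all A_i diagonal and (2) would not be equivalent to (1) and (3). The literal "(1) or (2) or (3) iff C2" is also proved. *)

theory Defs
  imports "HOL-Complex_Analysis.Complex_Analysis"
begin

text \<open>
  Throughout, a Fuchsian system \<open>dY/dx = A(x) Y\<close> with
  \<open>A(x) = \<Sum>i=1..n+2. A\<^sub>i / (x - t\<^sub>i)\<close> is given by the number \<open>n\<close>, the real finite singularities
  \<open>t 1, \<dots>, t (n+2)\<close> and the residues \<open>A 1, \<dots>, A (n+2)\<close>.  The last singularity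
  \<open>t\<^sub>n\<^sub>+\<^sub>3 = \<infinity>\<close> has no value; values of \<open>t\<close> and \<open>A\<close> at other indices are irrelevant.
\<close>

type_synonym cmat2 = "complex^2^2"

definition mat2 :: "complex \<Rightarrow> complex \<Rightarrow> complex \<Rightarrow> complex \<Rightarrow> cmat2" where
  "mat2 a b c d = vector [vector [a, b], vector [c, d]]"

abbreviation cnj_mat :: "cmat2 \<Rightarrow> cmat2" where
  "cnj_mat \<equiv> map_matrix cnj"

definition U2 :: "cmat2 set" where
  "U2 = {M. M ** transpose (cnj_mat M) = mat 1}"

definition U11 :: "cmat2 set" where
  "U11 = {M. M ** mat2 1 0 0 (-1) ** transpose (cnj_mat M) = mat2 1 0 0 (-1)}"


section \<open>The system and the associated second-order equation\<close>

definition sing :: "nat \<Rightarrow> (nat \<Rightarrow> real) \<Rightarrow> complex set" where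
  "sing n t = (\<lambda>i. complex_of_real (t i)) ` {1..n+2}"

definition fuchs :: "nat \<Rightarrow> (nat \<Rightarrow> real) \<Rightarrow> (nat \<Rightarrow> cmat2) \<Rightarrow> complex \<Rightarrow> cmat2" where
  "fuchs n t A x = (\<Sum>i=1..n+2. map_matrix (\<lambda>a. a / (x - complex_of_real (t i))) (A i))"

definition A12_nonzero :: "nat \<Rightarrow> (nat \<Rightarrow> real) \<Rightarrow> (nat \<Rightarrow> cmat2) \<Rightarrow> bool" where
  "A12_nonzero n t A \<longleftrightarrow> (\<exists>x. x \<notin> sing n t \<and> fuchs n t A x $ 1 $ 2 \<noteq> 0)"

definition coeff_p :: "nat \<Rightarrow> (nat \<Rightarrow> real) \<Rightarrow> (nat \<Rightarrow> cmat2) \<Rightarrow> complex \<Rightarrow> complex" where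
  "coeff_p n t A x =
     - deriv (\<lambda>z. fuchs n t A z $ 1 $ 2) x / fuchs n t A x $ 1 $ 2 - trace (fuchs n t A x)"

definition coeff_q :: "nat \<Rightarrow> (nat \<Rightarrow> real) \<Rightarrow> (nat \<Rightarrow> cmat2) \<Rightarrow> complex \<Rightarrow> complex" where
  "coeff_q n t A x =
     - deriv (\<lambda>z. fuchs n t A z $ 1 $ 1) x
     + fuchs n t A x $ 1 $ 1 * deriv (\<lambda>z. fuchs n t A z $ 1 $ 2) x / fuchs n t A x $ 1 $ 2
     + det (fuchs n t A x)"

text \<open>
  \<open>p\<close> and \<open>q\<close> are rational functions, possibly with poles at the \<open>t\<^sub>i\<close> and at the zeros of
  \<open>A\<^sub>1\<^sub>2\<close>; their values are only meaningful, and only constrained, elsewhere.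
  The notion is meant for systems with \<open>A12_nonzero\<close>.
\<close>

definition real_equation :: "nat \<Rightarrow> (nat \<Rightarrow> real) \<Rightarrow> (nat \<Rightarrow> cmat2) \<Rightarrow> bool" where
  "real_equation n t A \<longleftrightarrow>
     (\<forall>x::real. complex_of_real x \<notin> sing n t \<and> fuchs n t A (complex_of_real x) $ 1 $ 2 \<noteq> 0 \<longrightarrow>
        coeff_p n t A (complex_of_real x) \<in> \<real> \<and> coeff_q n t A (complex_of_real x) \<in> \<real>)"

text \<open>
  \<open>K\<close> is the set of values allowed for the coefficients \<open>b\<^sub>i\<close> and \<open>c\<^sub>i\<close>.
  When the residue at infinity is diagonal, the \<open>b\<^sub>i\<close> sum up to 0, and so do the \<open>c\<^sub>i\<close>.
  Hence \<open>K = {0..}\<close> only allows diagonal residues; the condition equivalent to the reality of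
  the associated equation (if \<open>A12_nonzero\<close>) is the one with \<open>K = UNIV\<close>.
\<close>

definition phase_form :: "real set \<Rightarrow> nat \<Rightarrow> (nat \<Rightarrow> cmat2) \<Rightarrow> bool" where
  "phase_form K n A \<longleftrightarrow>
     (\<exists>\<eta>::real. \<forall>i\<in>{1..n+2}. \<exists>a b c d :: real. b \<in> K \<and> c \<in> K \<and>
        A i = mat2 (of_real a) (of_real b * exp (\<i> * of_real \<eta>))
                   (of_real c * exp (- \<i> * of_real \<eta>)) (of_real d))"


section \<open>Monodromy\<close>

text \<open>
  \<open>gap n t i\<close> is the interval \<open>]t\<^sub>i, t\<^sub>i\<^sub>+\<^sub>1[\<close> of the real projective line, for \<open>i = 0, \<dots>, n+3\<close>,
  with indices cyclic mod \<open>n+3\<close> and \<open>t\<^sub>n\<^sub>+\<^sub>3 = t\<^sub>0 = \<infinity>\<close>.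
\<close>

definition gap :: "nat \<Rightarrow> (nat \<Rightarrow> real) \<Rightarrow> nat \<Rightarrow> real set" where
  "gap n t i = (if i = 0 \<or> i = n + 3 then {..<t 1}
                else if i = n + 2 then {t (n + 2)<..}
                else {t i<..<t (i + 1)})"

text \<open>
  The loops based at \<open>x0\<close> in the upper half-plane that descend through
  \<open>]t\<^sub>i\<^sub>-\<^sub>1, t\<^sub>i[\<close> and come back through \<open>]t\<^sub>i, t\<^sub>i\<^sub>+\<^sub>1[\<close>, not meeting the real axis otherwise.
  Half-planes and intervals being convex, they are all homotopic to each other; they
  represent the class \<open>\<gamma>\<^sub>i\<close> and turn once positively around \<open>t\<^sub>i\<close> (also for \<open>t\<^sub>n\<^sub>+\<^sub>3 = \<infinity>\<close>).
\<close>

definition gamma_loop :: "nat \<Rightarrow> (nat \<Rightarrow> real) \<Rightarrow> complex \<Rightarrow> nat \<Rightarrow> (real \<Rightarrow> complex) \<Rightarrow> bool" where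
  "gamma_loop n t x0 i \<gamma> \<longleftrightarrow>
     path \<gamma> \<and> pathstart \<gamma> = x0 \<and> pathfinish \<gamma> = x0 \<and>
     (\<exists>u v. 0 < u \<and> u < v \<and> v < 1 \<and>
        \<gamma> u \<in> complex_of_real ` gap n t (i - 1) \<and>
        \<gamma> v \<in> complex_of_real ` gap n t i \<and>
        (\<forall>s\<in>{0..<u} \<union> {v<..1}. Im (\<gamma> s) > 0) \<and>
        (\<forall>s\<in>{u<..<v}. Im (\<gamma> s) < 0))"

text \<open>
  Analytic continuation of germs: \<open>F s\<close> is a germ at \<open>\<gamma> s\<close>, and neighbouring germs
  are induced by one another.
\<close>

definition continues_along ::
    "(real \<Rightarrow> complex) \<Rightarrow> (complex \<Rightarrow> complex) \<Rightarrow> (complex \<Rightarrow> complex) \<Rightarrow> bool" where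
  "continues_along \<gamma> f g \<longleftrightarrow>
     (\<exists>F :: real \<Rightarrow> complex \<Rightarrow> complex.
        (\<forall>s\<in>{0..1}. F s analytic_on {\<gamma> s}) \<and>
        (\<forall>s\<in>{0..1}. \<exists>d>0. \<forall>s'\<in>{0..1}. \<bar>s' - s\<bar> < d \<longrightarrow>
            (\<forall>\<^sub>F x in nhds (\<gamma> s'). F s' x = F s x)) \<and>
        (\<forall>\<^sub>F x in nhds (pathstart \<gamma>). F 0 x = f x) \<and>
        (\<forall>\<^sub>F x in nhds (pathfinish \<gamma>). F 1 x = g x))"

definition fundamental_at ::
    "nat \<Rightarrow> (nat \<Rightarrow> real) \<Rightarrow> (nat \<Rightarrow> cmat2) \<Rightarrow> complex \<Rightarrow> (complex \<Rightarrow> cmat2) \<Rightarrow> bool" where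
  "fundamental_at n t A x0 Y \<longleftrightarrow>
     (\<forall>\<^sub>F x in nhds x0. invertible (Y x) \<and>
        (\<forall>j k. ((\<lambda>z. Y z $ j $ k) has_field_derivative (fuchs n t A x ** Y x) $ j $ k) (at x)))"

text \<open>\<open>M 1, \<dots>, M (n+3)\<close> are defined by \<open>\<gamma>\<^sub>i * Y = Y M\<^sub>i\<close>, for some fundamental matrix \<open>Y\<close>.\<close>

definition monodromy_generators ::
    "nat \<Rightarrow> (nat \<Rightarrow> real) \<Rightarrow> (nat \<Rightarrow> cmat2) \<Rightarrow> complex \<Rightarrow> (nat \<Rightarrow> cmat2) \<Rightarrow> bool" where
  "monodromy_generators n t A x0 M \<longleftrightarrow>
     (\<exists>Y. fundamental_at n t A x0 Y \<and>
        (\<forall>i\<in>{1..n+3}. \<forall>\<gamma>. gamma_loop n t x0 i \<gamma> \<longrightarrow>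
           (\<forall>j k. continues_along \<gamma> (\<lambda>x. Y x $ j $ k) (\<lambda>x. (Y x ** M i) $ j $ k))))"

text \<open>\<open>rprod N j = N\<^sub>j \<cdots> N\<^sub>1\<close>\<close>

primrec rprod :: "(nat \<Rightarrow> cmat2) \<Rightarrow> nat \<Rightarrow> cmat2" where
  "rprod N 0 = mat 1"
| "rprod N (Suc j) = N (Suc j) ** rprod N j"

definition conjugate_monodromy ::
    "nat \<Rightarrow> (nat \<Rightarrow> real) \<Rightarrow> (nat \<Rightarrow> cmat2) \<Rightarrow> complex \<Rightarrow> bool" where
  "conjugate_monodromy n t A x0 \<longleftrightarrow>
     (\<forall>N. monodromy_generators n t A x0 N \<longrightarrow>
        (\<exists>C::cmat2. invertible C \<and> (\<forall>j\<in>{1..n+3}.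
           matrix_inv C ** cnj_mat (N j) ** C
             = matrix_inv (rprod N j) ** matrix_inv (N j) ** rprod N j)))"

definition condition_C2 :: "nat \<Rightarrow> (nat \<Rightarrow> cmat2) \<Rightarrow> bool" where
  "condition_C2 n M \<longleftrightarrow>
     (\<exists>D :: nat \<Rightarrow> cmat2. D 0 = D (n + 3) \<and>
        (\<forall>j\<in>{1..n+3}. invertible (D j)) \<and>
        (\<forall>j\<in>{1..n+3}. M j = D j ** matrix_inv (D (j - 1))) \<and>
        (\<forall>i\<in>{1..n+3}. \<forall>j\<in>{1..n+3}.
           map_matrix ((*) (1 / det (D i))) (D i ** D i)
             = map_matrix ((*) (1 / det (D j))) (D j ** D j)))"

end

theory Submission
  imports Defs
begin

(* The dollar sign denotes entries of vectors and matrices throughout. *)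
no_notation fps_nth (infixl "$" 75)

text \<open>
  Let \<open>A\<close> be the system and \<open>B\<close> the system with the conjugate residues; the solutions of \<open>B\<close> are the
  functions \<open>cnj (Y (cnj x))\<close>, for \<open>Y\<close> a solution of \<open>A\<close>.  The residues of \<open>A\<close> become real after
  conjugation with a constant diagonal unitary matrix if and only if some invertible diagonal \<open>G\<close>
  satisfies \<open>A\<^sub>i G = G B\<^sub>i\<close> for all \<open>i\<close> (\<open>phase_form_iff_intertwiner\<close>).  The reality of the equation, the
  conjugacy of the monodromies and condition C2 are each compared with this property.

  The analytic core is a rigidity statement, \<open>intertwiner_constant_diagonal\<close>: a single-valued solution
  of \<open>G' = A G - G B\<close> on the complement of a finite set is constant and diagonal.  Indeed \<open>G\<close> grows at
  most like a power of the distance to a singular point, hence it is meromorphic; if its leading term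
  is \<open>X (x - t\<^sub>i)\<^sup>k\<close>, then \<open>k X = A\<^sub>i X - X B\<^sub>i\<close>.  The residues \<open>A\<^sub>i\<close> and \<open>B\<^sub>i\<close> have the same eigenvalues,
  since these are real or conjugate to each other, so non-resonance forces \<open>k = 0\<close>.  The same
  argument applies at infinity, and Liouville's theorem shows that \<open>G\<close> is constant.  It is diagonal
  because it commutes with the residue at infinity.  No local normal form is involved.

  If the equation of the first component is real, it is also the equation of \<open>B\<close>, and expressing the
  second component of a solution through the first one and its derivative yields a rational gauge
  transformation \<open>G\<close> between the two systems; rigidity makes it constant
  (\<open>phase_form_if_real_equation\<close>).

  For the monodromy, let \<open>\<Phi>\<^sub>j\<close> be the solution that agrees with a given \<open>Y\<close> on the upper half-plane and is
  continued to the lower one through the interval \<open>]t\<^sub>j, t\<^sub>j\<^sub>+\<^sub>1[\<close>.  In the lower half-plane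
  \<open>\<Phi>\<^sub>0 = \<Phi>\<^sub>j W\<^sub>j\<close> with constant \<open>W\<^sub>j\<close>, and following \<open>\<gamma>\<^sub>j\<close> shows that \<open>W\<^sub>j = M\<^sub>j \<cdots> M\<^sub>1\<close>
  (\<open>monodromy_half_planes\<close>).  Complex conjugation exchanges the half-planes, and the functions
  \<open>\<Phi>\<^sub>j(x) W\<^sub>j X cnj (\<Phi>\<^sub>j(cnj x))\<^sup>-\<^sup>1\<close> fit together to a single-valued \<open>G\<close> exactly when
  \<open>W\<^sub>j X cnj W\<^sub>j = X\<close> for all \<open>j\<close>.  By rigidity, such an invertible \<open>X\<close> exists if and only if the residues are
  real up to a phase (\<open>half_plane_intertwiner_iff_phase_form\<close>).

  What remains is algebra.  Conjugacy of the monodromies by \<open>C\<close> amounts to these equations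
  for \<open>X = C\<^sup>-\<^sup>1\<close> (\<open>conjugation_iff_conj_intertwiner\<close>).  For matrices \<open>W\<close> in \<open>U(2)\<close> or \<open>U(1,1)\<close> one has
  \<open>det W cnj W J = J W\<close> with a fixed \<open>J\<close>, so that the equations become
  \<open>W\<^sub>j G W\<^sub>j = det W\<^sub>j G\<close> for \<open>G = X J\<close>; the matrices \<open>D\<^sub>j = W\<^sub>j G\<close> are then those of condition C2
  (\<open>condition_C2_iff_conj_intertwiner\<close>).
\<close>

section \<open>Calculus of matrix-valued functions\<close>

definition mderiv :: "(complex \<Rightarrow> cmat2) \<Rightarrow> cmat2 \<Rightarrow> complex \<Rightarrow> bool" where
  "mderiv F D x \<longleftrightarrow> (\<forall>j k. ((\<lambda>z. F z $ j $ k) has_field_derivative D $ j $ k) (at x))"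

lemma mat2_eq_iff:
  "(M :: cmat2) = N \<longleftrightarrow> M $ 1 $ 1 = N $ 1 $ 1 \<and> M $ 1 $ 2 = N $ 1 $ 2
      \<and> M $ 2 $ 1 = N $ 2 $ 1 \<and> M $ 2 $ 2 = N $ 2 $ 2"
  by (auto simp: vec_eq_iff forall_2)

lemma mult_entry: "((M :: cmat2) ** N) $ j $ k = M $ j $ 1 * N $ 1 $ k + M $ j $ 2 * N $ 2 $ k"
  by (simp add: matrix_matrix_mult_def sum_2)

lemma mat2_entry [simp]:
  "mat2 a b c d $ 1 $ 1 = a" "mat2 a b c d $ 1 $ 2 = b"
  "mat2 a b c d $ 2 $ 1 = c" "mat2 a b c d $ 2 $ 2 = d"
  by (simp_all add: mat2_def)

lemma mat_entry [simp]:
  "(mat z :: cmat2) $ 1 $ 1 = z" "(mat z :: cmat2) $ 1 $ 2 = 0"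
  "(mat z :: cmat2) $ 2 $ 1 = 0" "(mat z :: cmat2) $ 2 $ 2 = z"
  by (simp_all add: mat_def)

lemma mderiv_const: "mderiv (\<lambda>_. C) 0 x"
  by (simp add: mderiv_def)

lemma mderiv_mult:
  assumes "mderiv F F' x" "mderiv G G' x"
  shows "mderiv (\<lambda>z. F z ** G z) (F' ** G x + F x ** G') x"
  unfolding mderiv_def mult_entry vector_add_component
  using assms unfolding mderiv_def
  by (intro allI) (auto intro!: derivative_eq_intros simp: algebra_simps)

lemma mderiv_mult_const:
  assumes "mderiv F F' x"
  shows "mderiv (\<lambda>z. F z ** C) (F' ** C) x"
  using mderiv_mult[OF assms mderiv_const[of C]] by (simp add: mderiv_def mult_entry)

lemma mderiv_const_mult:
  assumes "mderiv F F' x"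
  shows "mderiv (\<lambda>z. C ** F z) (C ** F') x"
  using mderiv_mult[OF mderiv_const[of C] assms] by (simp add: mderiv_def mult_entry)

lemma mderiv_cong_ev:
  assumes "mderiv F D x" "\<forall>\<^sub>F z in nhds x. F z = G z"
  shows "mderiv G D x"
  unfolding mderiv_def
proof (intro allI)
  fix j k
  have "\<forall>\<^sub>F z in nhds x. F z $ j $ k = G z $ j $ k"
    using assms(2) by eventually_elim simp
  thus "((\<lambda>z. G z $ j $ k) has_field_derivative D $ j $ k) (at x)"
    using assms(1) DERIV_cong_ev[OF refl _ refl, of "\<lambda>z. F z $ j $ k" "\<lambda>z. G z $ j $ k" x "D $ j $ k"]
    unfolding mderiv_def by blast
qed

lemma mderiv_zero_const:
  assumes "open S" "connected S" "\<And>x. x \<in> S \<Longrightarrow> mderiv F 0 x"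
  obtains C where "\<And>x. x \<in> S \<Longrightarrow> F x = C"
proof -
  have "\<exists>c. \<forall>x\<in>S. F x $ j $ k = c" for j k
  proof -
    have d: "((\<lambda>z. F z $ j $ k) has_field_derivative 0) (at x)" if "x \<in> S" for x
      using assms(3)[OF that] by (simp add: mderiv_def)
    then have "continuous_on S (\<lambda>z. F z $ j $ k)"
      using DERIV_continuous_on[of S "\<lambda>z. F z $ j $ k" "\<lambda>_. 0"] has_field_derivative_at_within by blast
    then show ?thesis
      using DERIV_zero_connected_constant[OF assms(2,1), of "{}" "\<lambda>z. F z $ j $ k"] d by blast
  qed
  then obtain c where "\<And>j k x. x \<in> S \<Longrightarrow> F x $ j $ k = c j k" by metis
  then have "\<And>x. x \<in> S \<Longrightarrow> F x = (\<chi> j k. c j k)" by (simp add: vec_eq_iff)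
  then show ?thesis using that by blast
qed

section \<open>Linear differential equations on a starlike domain\<close>

definition mholo :: "(complex \<Rightarrow> cmat2) \<Rightarrow> complex set \<Rightarrow> bool" where
  "mholo P S \<longleftrightarrow> (\<forall>j k. (\<lambda>z. P z $ j $ k) holomorphic_on S)"

lemma mholo_I_mderiv:
  assumes "open S" "\<And>x. x \<in> S \<Longrightarrow> mderiv F (D x) x"
  shows "mholo F S"
  unfolding mholo_def using assms
  by (auto simp: holomorphic_on_open mderiv_def)

text \<open>A holomorphic function on a starlike domain has a primitive, which is the integral along
  segments up to a constant; this makes the Picard iterates explicit.\<close>

lemma starlike_integral:
  assumes "open S" "a \<in> S" "\<And>x. x \<in> S \<Longrightarrow> closed_segment a x \<subseteq> S" "f holomorphic_on S" "x \<in> S"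
  shows "((\<lambda>x. contour_integral (linepath a x) f) has_field_derivative f x) (at x)"
proof -
  have "starlike S" using assms unfolding starlike_def by blast
  then obtain g where g: "\<And>x. x \<in> S \<Longrightarrow> (g has_field_derivative f x) (at x)"
    using holomorphic_starlike_primitive[of S f "{}"] assms
      holomorphic_on_imp_continuous_on holomorphic_on_imp_differentiable_at by blast
  have eq: "contour_integral (linepath a y) f = g y - g a" if "y \<in> S" for y
    using contour_integral_primitive[of S g f "linepath a y"] assms(3)[OF that] g
      has_field_derivative_at_within contour_integral_unique by fastforce
  have "((\<lambda>y. g y - g a) has_field_derivative f x) (at x)"
    using g[OF assms(5)] by (auto intro!: derivative_eq_intros)
  then show ?thesis
    by (rule has_field_derivative_transform_within_open[where S=S]) (use assms eq in auto)
qed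

primrec picard :: "(complex \<Rightarrow> cmat2) \<Rightarrow> complex \<Rightarrow> nat \<Rightarrow> complex \<Rightarrow> cmat2" where
  "picard P a 0 = (\<lambda>x. mat 1)"
| "picard P a (Suc m) =
     (\<lambda>x. \<chi> j k. contour_integral (linepath a x) (\<lambda>z. (P z ** picard P a m z) $ j $ k))"

lemma mholo_mult: "mholo P S \<Longrightarrow> mholo Q S \<Longrightarrow> mholo (\<lambda>x. P x ** Q x) S"
  unfolding mholo_def mult_entry by (auto intro!: holomorphic_intros)

lemma bounded_entries:
  assumes "mholo P S" "compact T" "T \<subseteq> S"
  obtains b where "b \<ge> 0" "\<And>x j k. x \<in> T \<Longrightarrow> cmod (P x $ j $ k) \<le> b"
proof -
  have "\<exists>K. \<forall>z\<in>T. cmod (P z $ j $ k) \<le> K" for j k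
  proof -
    have "continuous_on T (\<lambda>z. P z $ j $ k)"
      using assms(1,3) holomorphic_on_imp_continuous_on continuous_on_subset
      unfolding mholo_def by blast
    then have "bounded ((\<lambda>z. P z $ j $ k) ` T)"
      using assms(2) compact_continuous_image compact_imp_bounded by blast
    then show ?thesis by (auto simp: bounded_iff)
  qed
  then obtain K where K: "\<And>j k z. z \<in> T \<Longrightarrow> cmod (P z $ j $ k) \<le> K j k" by metis
  define b where "b = Max (insert 0 (range (\<lambda>(j,k). K j k)))"
  have b: "b \<ge> 0" "K j k \<le> b" for j k
    unfolding b_def by (rule Max_ge; force)+
  show ?thesis
    by (rule that[OF b(1)]) (rule order.trans[OF K b(2)])
qed

context
  fixes S a and P :: "complex \<Rightarrow> cmat2"
  assumes S: "open S" "a \<in> S" and star: "\<And>x. x \<in> S \<Longrightarrow> closed_segment a x \<subseteq> S"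
    and P: "mholo P S"
begin

lemma picard_mderiv:
  "x \<in> S \<Longrightarrow> mderiv (picard P a (Suc m)) (P x ** picard P a m x) x"
proof -
  have step: "\<forall>x\<in>S. mderiv (picard P a (Suc m)) (P x ** picard P a m x) x"
    if "mholo (picard P a m) S" for m
    unfolding mderiv_def
    using starlike_integral[OF S star] mholo_mult[OF P that] by (auto simp: mholo_def)
  have *: "mholo (picard P a m) S" for m
  proof (induction m)
    case 0 show ?case by (simp add: mholo_def)
  next
    case (Suc m) show ?case
      by (rule mholo_I_mderiv[OF S(1) bspec[OF step[OF Suc.IH]]])
  qed
  show "x \<in> S \<Longrightarrow> mderiv (picard P a (Suc m)) (P x ** picard P a m x) x"
    using step[OF *] by blast
qed

text \<open>The usual estimate of Picard iteration, along the segment from the centre to \<open>y\<close>: the factor 2 is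
  the number of terms in an entry of a matrix product.\<close>

lemma picard_bound:
  assumes y: "y \<in> S" "cmod (y - a) \<le> d" "d > 0" "K \<ge> 0"
    and K: "\<And>z j k. z \<in> closed_segment a y \<Longrightarrow> cmod (P z $ j $ k) \<le> K"
    and s: "0 \<le> s" "s \<le> 1"
  shows "cmod (picard P a m (a + of_real s * (y - a)) $ j $ k) \<le> (2 * K * d * s) ^ m / fact m"
  using s
proof (induction m arbitrary: s j k)
  case 0
  have "cmod ((mat 1 :: cmat2) $ j $ k) \<le> 1"
    by (auto simp: mat_def)
  then show ?case by simp
next
  case (Suc m)
  define z where "z = (\<lambda>r::real. a + of_real r * (y - a))"
  have zseg: "z r \<in> closed_segment a y" if "0 \<le> r" "r \<le> 1" for r
    using that unfolding z_def closed_segment_def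
    by (auto intro!: exI[of _ r] simp: scaleR_conv_of_real algebra_simps)
  have zS: "z r \<in> S" if "0 \<le> r" "r \<le> 1" for r
    using zseg[OF that] star[OF y(1)] by blast
  show ?case
  proof (cases "s = 0")
    case True
    then show ?thesis by (simp add: contour_integral_trivial)
  next
    case False
    with Suc.prems have s: "0 < s" "s \<le> 1" by auto
    let ?f = "\<lambda>r. picard P a (Suc m) (z r) $ j $ k"
    let ?f' = "\<lambda>r. (P (z r) ** picard P a m (z r)) $ j $ k * (y - a)"
    let ?\<phi> = "\<lambda>r::real. (2 * K * d * r) ^ Suc m / fact (Suc m)"
    let ?\<phi>' = "\<lambda>r::real. 2 * K * d * (2 * K * d * r) ^ m / fact m"
    have der: "(?f has_vector_derivative ?f' r) (at r)" if "0 \<le> r" "r \<le> 1" for r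
    proof -
      have "((\<lambda>w. picard P a (Suc m) w $ j $ k) has_field_derivative
              (P (z r) ** picard P a m (z r)) $ j $ k) (at (z r))"
        using picard_mderiv[OF zS[OF that]] unfolding mderiv_def by blast
      moreover have "(z has_vector_derivative (y - a)) (at r)"
        unfolding z_def by (auto intro!: derivative_eq_intros)
      ultimately have "((\<lambda>w. picard P a (Suc m) w $ j $ k) \<circ> z has_vector_derivative
           (y - a) * (P (z r) ** picard P a m (z r)) $ j $ k) (at r)"
        by (rule field_vector_diff_chain_at[rotated])
      then show ?thesis by (simp add: o_def mult.commute)
    qed
    have "norm (?f s - ?f 0) \<le> ?\<phi> s - ?\<phi> 0"
    proof (rule differentiable_bound_general[where f' = ?f' and \<phi>' = ?\<phi>'])
      show "continuous_on {0..s} ?f"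
        using der s by (intro continuous_on_vector_derivative[of _ _ ?f'])
          (meson atLeastAtMost_iff has_vector_derivative_at_within order_trans)
      show "continuous_on {0..s} ?\<phi>" by (intro continuous_intros) auto
      fix r assume r: "0 < r" "r < s"
      then have r': "0 \<le> r" "r \<le> 1" using s by auto
      show "(?f has_vector_derivative ?f' r) (at r)" using der r' by blast
      show "(?\<phi> has_vector_derivative ?\<phi>' r) (at r)"
        unfolding has_real_derivative_iff_has_vector_derivative[symmetric]
        by (rule derivative_eq_intros refl | simp add: field_simps del: of_nat_Suc)+
      let ?e = "(2 * K * d * r) ^ m / fact m"
      have "cmod (P (z r) $ j $ l) * cmod (picard P a m (z r) $ l $ k) \<le> K * ?e" for l
        using K[OF zseg[OF r']] Suc.IH[OF r', of l k] y by (intro mult_mono) (auto simp: z_def)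
      from add_mono[OF this[of 1] this[of 2]]
      have "cmod ((P (z r) ** picard P a m (z r)) $ j $ k) \<le> 2 * K * ?e"
        unfolding mult_entry by (intro order.trans[OF norm_triangle_ineq]) (simp add: norm_mult)
      then have "norm (?f' r) \<le> 2 * K * ?e * d"
        unfolding norm_mult by (intro mult_mono) (use y r in auto)
      then show "norm (?f' r) \<le> ?\<phi>' r" by (simp add: mult_ac)
    qed (use s in auto)
    then show ?thesis by (simp add: z_def contour_integral_trivial)
  qed
qed

text \<open>Near \<open>x\<close> the estimate is uniform, since the segments from the centre to the points of a closed ball
  fill a compact set, on which the coefficients are bounded.  The bound is the general term
  of an exponential series.\<close>

lemma picard_local_bound:
  assumes "x \<in> S"
  obtains r C where "r > 0" "C \<ge> 0"
    "\<And>y m j k. y \<in> ball x r \<inter> S \<Longrightarrow> cmod (picard P a m y $ j $ k) \<le> C ^ m / fact m"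
proof -
  obtain r where r: "r > 0" "cball x r \<subseteq> S"
    using S assms open_contains_cball by blast
  define T where "T = (\<lambda>(s::real, y). a + of_real s * (y - a)) ` ({0..1} \<times> cball x r)"
  have "compact T"
    unfolding T_def
    by (intro compact_continuous_image compact_Times)
       (auto simp: case_prod_unfold intro!: continuous_intros)
  have segT: "closed_segment a y \<subseteq> T" if "y \<in> cball x r" for y
  proof
    fix w assume "w \<in> closed_segment a y"
    then obtain s where "0 \<le> s" "s \<le> 1" "w = (1 - s) *\<^sub>R a + s *\<^sub>R y"
      unfolding closed_segment_def by blast
    then show "w \<in> T" using that unfolding T_def
      by (intro image_eqI[of _ _ "(s, y)"]) (auto simp: scaleR_conv_of_real algebra_simps)
  qed
  have "T \<subseteq> S"
  proof
    fix w assume "w \<in> T"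
    then obtain s y where sy: "0 \<le> s" "s \<le> 1" "y \<in> cball x r" "w = a + of_real s * (y - a)"
      unfolding T_def by auto
    then have "w \<in> closed_segment a y"
      unfolding closed_segment_def
      by (auto intro!: exI[of _ s] simp: scaleR_conv_of_real algebra_simps)
    then show "w \<in> S" using star r sy by blast
  qed
  obtain K' where K': "K' \<ge> 0" and KT: "\<And>z j k. z \<in> T \<Longrightarrow> cmod (P z $ j $ k) \<le> K'"
    using bounded_entries[OF P \<open>compact T\<close> \<open>T \<subseteq> S\<close>] by metis
  define d where "d = cmod (x - a) + r"
  have d: "d > 0" unfolding d_def using r by (meson add_nonneg_pos norm_ge_zero)
  show ?thesis
  proof (rule that[OF r(1)])
    show "2 * K' * d \<ge> 0" using K' d by auto
    fix y m j k assume "y \<in> ball x r \<inter> S"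
    then have y: "y \<in> S" "y \<in> cball x r" by auto
    have "cmod (y - a) \<le> cmod (y - x) + cmod (x - a)"
      using norm_triangle_ineq[of "y - x" "x - a"] by simp
    then have yd: "cmod (y - a) \<le> d"
      using y(2) by (simp add: d_def dist_norm norm_minus_commute)
    have "cmod (picard P a m (a + of_real 1 * (y - a)) $ j $ k) \<le> (2 * K' * d * 1) ^ m / fact m"
      by (rule picard_bound[OF y(1) yd d K'])
         (use segT[OF y(2)] KT d in auto)
    then show "cmod (picard P a m y $ j $ k) \<le> (2 * K' * d) ^ m / fact m" by simp
  qed
qed

text \<open>The solution is the sum of all iterates, differentiated termwise.\<close>

lemma ode_solution:
  obtains Y where "Y a = mat 1" "\<And>x. x \<in> S \<Longrightarrow> mderiv Y (P x ** Y x) x"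
proof -
  let ?u = "picard P a"
  define u' where "u' m x = (case m of 0 \<Rightarrow> 0 | Suc l \<Rightarrow> P x ** ?u l x)" for m x
  have der: "mderiv (?u m) (u' m x) x" if "x \<in> S" for m x
    using picard_mderiv[OF that] mderiv_const unfolding u'_def by (cases m) auto
  have "\<exists>g g'. \<forall>x\<in>S. ((\<lambda>n. ?u n x $ j $ k) sums g x) \<and> ((\<lambda>n. u' n x $ j $ k) sums g' x)
           \<and> (g has_field_derivative g' x) (at x)" for j k
  proof (rule series_and_derivative_comparison_complex[OF S(1)])
    fix n x assume "x \<in> S"
    then show "((\<lambda>x. ?u n x $ j $ k) has_field_derivative u' n x $ j $ k) (at x)"
      using der unfolding mderiv_def by blast
  next
    fix x assume "x \<in> S"
    then obtain r C where rC: "r > 0" "C \<ge> 0"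
      "\<And>y m j k. y \<in> ball x r \<inter> S \<Longrightarrow> cmod (?u m y $ j $ k) \<le> C ^ m / fact m"
      using picard_local_bound by blast
    show "\<exists>d h. 0 < d \<and> summable h \<and> range h \<subseteq> \<real>\<^sub>\<ge>\<^sub>0 \<and>
       (\<forall>\<^sub>F n in sequentially. \<forall>y\<in>ball x d \<inter> S. cmod (?u n y $ j $ k) \<le> cmod (h n))"
    proof (intro exI conjI)
      have "summable (\<lambda>n. C ^ n / fact n)"
        using summable_exp[of C] by (simp add: field_simps)
      then show "summable (\<lambda>n. complex_of_real (C ^ n / fact n))"
        by (simp only: summable_complex_of_real)
      show "\<forall>\<^sub>F n in sequentially. \<forall>y\<in>ball x r \<inter> S.
          cmod (?u n y $ j $ k) \<le> cmod (complex_of_real (C ^ n / fact n))"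
        using rC by (auto simp: norm_divide norm_power intro!: always_eventually)
      show "range (\<lambda>n. complex_of_real (C ^ n / fact n)) \<subseteq> \<real>\<^sub>\<ge>\<^sub>0"
        using rC(2) by (auto simp del: of_real_divide)
    qed (rule rC(1))
  qed
  then obtain g g' where g: "\<And>j k x. x \<in> S \<Longrightarrow> (\<lambda>n. ?u n x $ j $ k) sums g j k x"
      "\<And>j k x. x \<in> S \<Longrightarrow> (\<lambda>n. u' n x $ j $ k) sums g' j k x"
      "\<And>j k x. x \<in> S \<Longrightarrow> (g j k has_field_derivative g' j k x) (at x)"
    by metis
  define Y where "Y x = (\<chi> j k. g j k x)" for x
  show ?thesis
  proof (rule that)
    have "(\<lambda>n. ?u n a $ j $ k) sums (?u 0 a $ j $ k)" for j k
    proof -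
      have "?u n a $ j $ k = 0" if "n \<noteq> 0" for n
        using that by (cases n) (auto simp: contour_integral_trivial)
      then show ?thesis using sums_finite[of "{0}" "\<lambda>n. ?u n a $ j $ k"] by simp
    qed
    then have "g j k a = (mat 1 :: cmat2) $ j $ k" for j k
      using sums_unique2[OF g(1)[OF S(2)]] by force
    then show "Y a = mat 1" by (simp add: Y_def vec_eq_iff)
    fix x assume x: "x \<in> S"
    have "g' j k x = (P x ** Y x) $ j $ k" for j k
    proof -
      have "(\<lambda>n. P x $ j $ 1 * ?u n x $ 1 $ k + P x $ j $ 2 * ?u n x $ 2 $ k) sums
              (P x $ j $ 1 * g 1 k x + P x $ j $ 2 * g 2 k x)"
        by (intro sums_add sums_mult g x)
      then have "(\<lambda>n. u' (Suc n) x $ j $ k) sums ((P x ** Y x) $ j $ k)"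
        by (simp add: u'_def mult_entry Y_def)
      then have "(\<lambda>n. u' n x $ j $ k) sums ((P x ** Y x) $ j $ k + u' 0 x $ j $ k)"
        by (subst sums_Suc_iff[symmetric]) simp_all
      then show ?thesis
        using sums_unique2[OF g(2)[OF x, of j k]] by (force simp: u'_def)
    qed
    then show "mderiv Y (P x ** Y x) x"
      using g(3)[OF x] by (auto simp: mderiv_def Y_def)
  qed
qed

end

lemma starlike_connected:
  assumes "\<And>x. x \<in> S \<Longrightarrow> closed_segment a x \<subseteq> (S :: complex set)" "a \<in> S"
  shows "connected S"
  using assms starlike_imp_connected unfolding starlike_def by blast

lemma matrix_mult_minus_left: "- (A :: cmat2) ** B = - (A ** B)"
  and matrix_mult_minus_right: "A ** - (B :: cmat2) = - (A ** B)"
  by (simp_all add: mat2_eq_iff mult_entry)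

text \<open>The inverse \<open>Z\<close> of the fundamental matrix is obtained as the transpose of a solution of the adjoint
  equation: the product \<open>Z Y\<close> has zero derivative.  This avoids a discussion of the Wronskian.\<close>

lemma fundamental_solution:
  assumes S: "open S" "a \<in> S" "\<And>x. x \<in> S \<Longrightarrow> closed_segment a x \<subseteq> S" and P: "mholo P S"
  obtains Y Z where "\<And>x. x \<in> S \<Longrightarrow> mderiv Y (P x ** Y x) x"
    "\<And>x. x \<in> S \<Longrightarrow> mderiv Z (- (Z x ** P x)) x" "\<And>x. x \<in> S \<Longrightarrow> Z x ** Y x = mat 1"
proof -
  obtain Y where Y: "Y a = mat 1" "\<And>x. x \<in> S \<Longrightarrow> mderiv Y (P x ** Y x) x"
    using ode_solution[OF assms] by blast
  have "mholo (\<lambda>x. - transpose (P x)) S"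
    using P by (auto simp: mholo_def transpose_def intro!: holomorphic_intros)
  from ode_solution[OF S this]
  obtain W where W: "W a = mat 1" "\<And>x. x \<in> S \<Longrightarrow> mderiv W (- transpose (P x) ** W x) x"
    by blast
  define Z where "Z x = transpose (W x)" for x
  have Z: "mderiv Z (- (Z x ** P x)) x" if "x \<in> S" for x
  proof -
    have "(- (Z x ** P x)) $ j $ k = (- transpose (P x) ** W x) $ k $ j" for j k
      by (simp add: Z_def mult_entry transpose_def algebra_simps)
    then show ?thesis using W(2)[OF that] by (simp add: mderiv_def Z_def transpose_def)
  qed
  have "mderiv (\<lambda>x. Z x ** Y x) 0 x" if "x \<in> S" for x
    using mderiv_mult[OF Z[OF that] Y(2)[OF that]]
    by (simp add: matrix_mult_minus_left matrix_mul_assoc)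
  then obtain C where C: "\<And>x. x \<in> S \<Longrightarrow> Z x ** Y x = C"
    using mderiv_zero_const[OF S(1) starlike_connected[OF S(3,2)], of "\<lambda>x. Z x ** Y x"] by blast
  have "C = mat 1" using C[OF S(2)] Y(1) W(1) by (simp add: Z_def)
  then show ?thesis using that Y(2) Z C by blast
qed

text \<open>The derivative of \<open>Z X\<close> vanishes for every further solution \<open>X\<close>.\<close>

lemma solution_unique:
  assumes "open U" "connected U"
    and Z: "\<And>x. x \<in> U \<Longrightarrow> mderiv Z (- (Z x ** P x)) x" "\<And>x. x \<in> U \<Longrightarrow> Z x ** Y x = mat 1"
    and X: "\<And>x. x \<in> U \<Longrightarrow> mderiv X (P x ** X x) x"
  obtains C where "\<And>x. x \<in> U \<Longrightarrow> X x = Y x ** C"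
proof -
  have "mderiv (\<lambda>x. Z x ** X x) 0 x" if "x \<in> U" for x
    using mderiv_mult[OF Z(1)[OF that] X[OF that]]
    by (simp add: matrix_mult_minus_left matrix_mul_assoc)
  then obtain C where C: "\<And>x. x \<in> U \<Longrightarrow> Z x ** X x = C"
    using mderiv_zero_const[OF assms(1,2), of "\<lambda>x. Z x ** X x"] by blast
  have "X x = Y x ** C" if "x \<in> U" for x
  proof -
    have "Y x ** Z x = mat 1" using Z(2)[OF that] by (simp add: matrix_left_right_inverse)
    then show ?thesis using C[OF that] by (metis matrix_mul_assoc matrix_mul_lid)
  qed
  then show ?thesis using that by blast
qed

section \<open>Uniqueness of analytic continuation along a path\<close>

lemma germ_eq_ball:
  assumes "f holomorphic_on ball c r" "g holomorphic_on ball c r" "z \<in> ball c r"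
    and "\<forall>\<^sub>F x in nhds z. f x = g x" and w: "w \<in> ball c r"
  shows "\<forall>\<^sub>F x in nhds w. f x = g x"
proof -
  obtain U where U: "open U" "z \<in> U" "\<And>x. x \<in> U \<Longrightarrow> f x = g x"
    using assms(4) unfolding eventually_nhds by blast
  have "f x = g x" if "x \<in> ball c r" for x
    by (rule analytic_continuation_open[of "ball c r \<inter> U" "ball c r" f g])
       (use U assms that in auto)
  then show ?thesis
    unfolding eventually_nhds using w by (intro exI[of _ "ball c r"]) auto
qed

text \<open>Whether the two germs at time \<open>s\<close> coincide is a locally constant property of \<open>s\<close>: nearby germs on either
  side are induced by functions on a common ball, where the identity theorem applies.\<close>

lemma continues_along_unique:
  assumes "path \<gamma>" "continues_along \<gamma> f g" "continues_along \<gamma> f h"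
  shows "\<forall>\<^sub>F x in nhds (pathfinish \<gamma>). g x = h x"
proof -
  obtain F where F: "\<And>s. s \<in> {0..1} \<Longrightarrow> F s analytic_on {\<gamma> s}"
    "\<And>s. s \<in> {0..1} \<Longrightarrow> \<exists>d>0. \<forall>s'\<in>{0..1}. \<bar>s' - s\<bar> < d \<longrightarrow> (\<forall>\<^sub>F x in nhds (\<gamma> s'). F s' x = F s x)"
    "\<forall>\<^sub>F x in nhds (pathstart \<gamma>). F 0 x = f x" "\<forall>\<^sub>F x in nhds (pathfinish \<gamma>). F 1 x = g x"
    using assms(2) unfolding continues_along_def by blast
  obtain H where H: "\<And>s. s \<in> {0..1} \<Longrightarrow> H s analytic_on {\<gamma> s}"
    "\<And>s. s \<in> {0..1} \<Longrightarrow> \<exists>d>0. \<forall>s'\<in>{0..1}. \<bar>s' - s\<bar> < d \<longrightarrow> (\<forall>\<^sub>F x in nhds (\<gamma> s'). H s' x = H s x)"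
    "\<forall>\<^sub>F x in nhds (pathstart \<gamma>). H 0 x = f x" "\<forall>\<^sub>F x in nhds (pathfinish \<gamma>). H 1 x = h x"
    using assms(3) unfolding continues_along_def by blast
  define E where "E s \<longleftrightarrow> (\<forall>\<^sub>F x in nhds (\<gamma> s). F s x = H s x)" for s
  have "E (0::real) = E 1"
  proof (rule connected_local_const[of "{0..1}"])
    show "\<forall>s\<in>{0..1}. \<forall>\<^sub>F s' in at s within {0..1}. E s = E s'"
    proof
      fix s :: real assume s: "s \<in> {0..1}"
      obtain r1 where r1: "r1 > 0" "F s holomorphic_on ball (\<gamma> s) r1"
        using F(1)[OF s] by (auto simp: analytic_on_def)
      obtain r2 where r2: "r2 > 0" "H s holomorphic_on ball (\<gamma> s) r2"
        using H(1)[OF s] by (auto simp: analytic_on_def)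
      define r where "r = min r1 r2"
      have r: "r > 0" "F s holomorphic_on ball (\<gamma> s) r" "H s holomorphic_on ball (\<gamma> s) r"
        using r1 r2 by (auto simp: r_def intro: holomorphic_on_subset)
      obtain d1 where d1: "d1 > 0"
        "\<And>s'. s' \<in> {0..1} \<Longrightarrow> \<bar>s' - s\<bar> < d1 \<Longrightarrow> (\<forall>\<^sub>F x in nhds (\<gamma> s'). F s' x = F s x)"
        using F(2)[OF s] by blast
      obtain d2 where d2: "d2 > 0"
        "\<And>s'. s' \<in> {0..1} \<Longrightarrow> \<bar>s' - s\<bar> < d2 \<Longrightarrow> (\<forall>\<^sub>F x in nhds (\<gamma> s'). H s' x = H s x)"
        using H(2)[OF s] by blast
      obtain d3 where d3: "d3 > 0"
        "\<And>s'. s' \<in> {0..1} \<Longrightarrow> \<bar>s' - s\<bar> < d3 \<Longrightarrow> \<gamma> s' \<in> ball (\<gamma> s) r"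
        using assms(1) s r(1) unfolding path_def continuous_on_iff
        by (metis dist_commute dist_real_def mem_ball)
      have "E s = E s'" if s': "s' \<in> {0..1}" "\<bar>s' - s\<bar> < Min {d1, d2, d3}" for s'
      proof -
        have 1: "\<forall>\<^sub>F x in nhds (\<gamma> s'). F s' x = F s x" "\<forall>\<^sub>F x in nhds (\<gamma> s'). H s' x = H s x"
          and in_ball: "\<gamma> s' \<in> ball (\<gamma> s) r"
          using d1 d2 d3 s' by auto
        have "E s' \<longleftrightarrow> (\<forall>\<^sub>F x in nhds (\<gamma> s'). F s x = H s x)"
          unfolding E_def by (rule eventually_cong[OF eventually_conj[OF 1]]) auto
        also have "\<dots> \<longleftrightarrow> E s"
          unfolding E_def using germ_eq_ball[OF r(2,3)] in_ball r(1) by (meson centre_in_ball)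
        finally show ?thesis by simp
      qed
      moreover have "Min {d1, d2, d3} > 0" using d1 d2 d3 by simp
      ultimately show "\<forall>\<^sub>F s' in at s within {0..1}. E s = E s'"
        unfolding eventually_at dist_real_def by blast
    qed
  qed auto
  moreover have "\<forall>\<^sub>F x in nhds (pathstart \<gamma>). F 0 x = H 0 x"
    using F(3) H(3) by eventually_elim simp
  then have "E 0" by (simp add: E_def pathstart_def)
  ultimately have "E 1" by simp
  then have "\<forall>\<^sub>F x in nhds (pathfinish \<gamma>). F 1 x = H 1 x" by (simp add: E_def pathfinish_def)
  then show ?thesis using F(4) H(4) by eventually_elim simp
qed

section \<open>Intertwiners at a non-resonant singularity\<close>

text \<open>The square of the Frobenius norm; it is differentiable along real paths.\<close>

definition sqnorm :: "cmat2 \<Rightarrow> real" where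
  "sqnorm M = (\<Sum>j\<in>UNIV. \<Sum>k\<in>UNIV. (cmod (M $ j $ k))\<^sup>2)"

lemma sqnorm_nonneg: "sqnorm M \<ge> 0"
  by (simp add: sqnorm_def sum_nonneg)

lemma entry_le_sqnorm: "(cmod (M $ j $ k))\<^sup>2 \<le> sqnorm M"
proof -
  have "(cmod (M $ j $ k))\<^sup>2 \<le> (\<Sum>k\<in>UNIV. (cmod (M $ j $ k))\<^sup>2)"
    by (rule member_le_sum) auto
  also have "\<dots> \<le> sqnorm M"
    unfolding sqnorm_def by (rule member_le_sum) (auto intro: sum_nonneg)
  finally show ?thesis .
qed

text \<open>A form of Gronwall's lemma: if \<open>\<bar>g'\<bar> \<le> (c / s) \<bar>g\<bar>\<close> entrywise, then the logarithmic derivative of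
  \<open>\<bar>g\<bar>\<^sup>2\<close> is at least \<open>-8c / s\<close>, the sum over the four entries contributing a factor 4.  Hence \<open>s\<^sup>2\<^sup>N \<bar>g\<bar>\<^sup>2\<close>
  increases as soon as \<open>2N \<ge> 8c\<close>.\<close>

lemma sqnorm_growth:
  fixes g :: "real \<Rightarrow> cmat2"
  assumes der: "\<And>s j k. 0 < s \<Longrightarrow> s \<le> R \<Longrightarrow> ((\<lambda>s. g s $ j $ k) has_vector_derivative g' s $ j $ k) (at s)"
    and bnd: "\<And>s j k. 0 < s \<Longrightarrow> s \<le> R \<Longrightarrow> cmod (g' s $ j $ k) \<le> c * sqrt (sqnorm (g s)) / s"
    and N: "real N \<ge> 4 * c" and s: "0 < s" "s \<le> R"
  shows "s ^ (2 * N) * sqnorm (g s) \<le> R ^ (2 * N) * sqnorm (g R)"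
proof (rule DERIV_nonneg_imp_nondecreasing[OF s(2)])
  fix r assume "s \<le> r" "r \<le> R"
  with s have r: "0 < r" "r \<le> R" by auto
  define n where "n = sqrt (sqnorm (g r))"
  have n: "n \<ge> 0" "n\<^sup>2 = sqnorm (g r)" by (simp_all add: n_def sqnorm_nonneg)
  define D where "D = (\<Sum>j\<in>UNIV. \<Sum>k\<in>UNIV. 2 * (g r $ j $ k \<bullet> g' r $ j $ k))"
  have "((\<lambda>s. (cmod (g s $ j $ k))\<^sup>2) has_real_derivative 2 * (g r $ j $ k \<bullet> g' r $ j $ k)) (at r)" for j k
  proof -
    have "((\<lambda>s. g s $ j $ k \<bullet> g s $ j $ k) has_vector_derivative
            (g r $ j $ k \<bullet> g' r $ j $ k + g' r $ j $ k \<bullet> g r $ j $ k)) (at r)"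
      by (rule bounded_bilinear.has_vector_derivative[OF bounded_bilinear_inner der[OF r] der[OF r]])
    then show ?thesis
      unfolding has_real_derivative_iff_has_vector_derivative power2_norm_eq_inner mult_2
      by (simp only: inner_commute[of "g' r $ j $ k"])
  qed
  then have D: "((\<lambda>s. sqnorm (g s)) has_real_derivative D) (at r)"
    unfolding sqnorm_def D_def by (intro DERIV_sum)
  have "2 * (g r $ j $ k \<bullet> g' r $ j $ k) \<ge> - (2 * (n * (c * n / r)))" for j k
  proof -
    have "\<bar>g r $ j $ k \<bullet> g' r $ j $ k\<bar> \<le> cmod (g r $ j $ k) * cmod (g' r $ j $ k)"
      by (rule Cauchy_Schwarz_ineq2)
    also have "\<dots> \<le> n * (c * n / r)"
      using bnd[OF r] n entry_le_sqnorm[of "g r" j k]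
      by (intro mult_mono) (auto simp: n_def intro: real_le_rsqrt)
    finally show ?thesis by (simp add: abs_le_iff)
  qed
  then have "D \<ge> (\<Sum>j\<in>(UNIV::2 set). \<Sum>k\<in>(UNIV::2 set). - (2 * (n * (c * n / r))))"
    unfolding D_def by (intro sum_mono)
  then have "D \<ge> - (8 * c * n\<^sup>2 / r)"
    by (simp add: sum_2 power2_eq_square algebra_simps)
  then have "r * D \<ge> - (8 * c * n\<^sup>2)" using r by (simp add: field_simps)
  then have rD: "2 * real N * n\<^sup>2 + r * D \<ge> 0"
    using mult_right_mono[OF N, of "2 * n\<^sup>2"] by (simp add: algebra_simps)
  show "\<exists>y. ((\<lambda>s. s ^ (2 * N) * sqnorm (g s)) has_real_derivative y) (at r) \<and> 0 \<le> y"
  proof (cases "N = 0")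
    case True
    with rD r D show ?thesis by (auto simp: zero_le_mult_iff)
  next
    case False
    then have pow: "r ^ (2 * N) = r ^ (2 * N - 1) * r"
      by (subst power_minus_mult) auto
    have "((\<lambda>s. s ^ (2 * N) * sqnorm (g s)) has_real_derivative
        real (2 * N) * r ^ (2 * N - 1) * sqnorm (g r) + r ^ (2 * N) * D) (at r)"
      using D by (auto intro!: derivative_eq_intros simp: algebra_simps)
    moreover have "real (2 * N) * r ^ (2 * N - 1) * sqnorm (g r) + r ^ (2 * N) * D
        = r ^ (2 * N - 1) * (2 * real N * n\<^sup>2 + r * D)"
      unfolding pow n(2) by (simp add: algebra_simps)
    moreover have "0 \<le> r ^ (2 * N - 1) * (2 * real N * n\<^sup>2 + r * D)"
      by (rule mult_nonneg_nonneg) (use r rD in auto)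
    ultimately show ?thesis by auto
  qed
qed

lemma zero_at_puncture:
  assumes "continuous (at (t :: complex)) \<phi>" "\<forall>\<^sub>F x in at t. \<phi> x = (0 :: complex)"
  shows "\<phi> t = 0"
proof -
  have "(\<phi> \<longlongrightarrow> \<phi> t) (at t)" using assms(1) by (simp add: continuous_within)
  moreover have "(\<phi> \<longlongrightarrow> 0) (at t)" using assms(2) by (rule tendsto_eventually)
  ultimately show ?thesis by (rule LIM_unique)
qed

text \<open>
  In the following lemmas \<open>P\<close> and \<open>Q\<close> are \<open>(x - t) A(x)\<close> and \<open>(x - t) B(x)\<close>, so that \<open>G\<close> is a solution of
  \<open>G' = A G - G B\<close> in a punctured disc in which \<open>A\<close> and \<open>B\<close> have at most a simple pole.  The residues
  may vanish, so that regular points of the systems are covered.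
\<close>

context
  fixes t r and P Q G :: "complex \<Rightarrow> cmat2"
  assumes r: "r > 0" and P: "mholo P (ball t r)" and Q: "mholo Q (ball t r)"
    and der: "\<And>x. x \<in> ball t r - {t} \<Longrightarrow>
       mderiv G (map_matrix (\<lambda>a. a / (x - t)) (P x ** G x - G x ** Q x)) x"
begin

text \<open>Gronwall's lemma is applied on each ray issuing from \<open>t\<close>, starting from the circle of radius \<open>r / 2\<close>.\<close>

lemma moderate_growth:
  obtains N C where "\<And>x j k. x \<in> ball t (r / 2) - {t} \<Longrightarrow> cmod ((x - t) ^ N * G x $ j $ k) \<le> C"
proof -
  have sub: "cball t (r / 2) \<subseteq> ball t r" "sphere t (r / 2) \<subseteq> ball t r - {t}"
    using r by (auto simp: dist_norm)
  obtain b1 where b1: "b1 \<ge> 0" "\<And>x j k. x \<in> cball t (r / 2) \<Longrightarrow> cmod (P x $ j $ k) \<le> b1"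
    using bounded_entries[OF P _ sub(1)] by auto
  obtain b2 where b2: "b2 \<ge> 0" "\<And>x j k. x \<in> cball t (r / 2) \<Longrightarrow> cmod (Q x $ j $ k) \<le> b2"
    using bounded_entries[OF Q _ sub(1)] by auto
  have "mholo G (ball t r - {t})"
    by (rule mholo_I_mderiv[OF _ der]) auto
  then obtain b3 where b3: "b3 \<ge> 0" "\<And>x j k. x \<in> sphere t (r / 2) \<Longrightarrow> cmod (G x $ j $ k) \<le> b3"
    using bounded_entries[OF _ _ sub(2)] by auto
  define c where "c = 2 * b1 + 2 * b2"
  obtain N where N: "real N \<ge> 4 * c" using real_arch_simple by blast
  define C where "C = (r / 2) ^ N * (2 * b3)"
  show ?thesis
  proof (rule that)
    fix x j k assume x: "x \<in> ball t (r / 2) - {t}"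
    define s where "s = cmod (x - t)"
    define e where "e = (x - t) / s"
    have s: "0 < s" "s < r / 2" using x by (auto simp: s_def dist_norm norm_minus_commute)
    have e: "cmod e = 1" using s by (simp add: e_def norm_divide s_def)
    define p where "p u = t + of_real u * e" for u :: real
    have p: "p u \<in> cball t (r / 2)" "p u \<in> ball t r - {t}" "cmod (p u - t) = u" if "0 < u" "u \<le> r / 2" for u
      using that e r by (auto simp: p_def dist_norm norm_mult)
    have px: "p s = x" using s by (simp add: p_def e_def)
    define g' where "g' u = map_matrix (\<lambda>a. e * (a / (p u - t)))
        (P (p u) ** G (p u) - G (p u) ** Q (p u))" for u
    have "s ^ (2 * N) * sqnorm (G (p s)) \<le> (r / 2) ^ (2 * N) * sqnorm (G (p (r / 2)))"
    proof (rule sqnorm_growth[where g' = g' and c = c])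
      fix u :: real and j k :: 2 assume u: "0 < u" "u \<le> r / 2"
      have "(p has_vector_derivative e) (at u)"
        unfolding p_def by (auto intro!: derivative_eq_intros)
      moreover have "((\<lambda>w. G w $ j $ k) has_field_derivative
          (P (p u) ** G (p u) - G (p u) ** Q (p u)) $ j $ k / (p u - t)) (at (p u))"
        using der[OF p(2)[OF u]] by (simp add: mderiv_def)
      ultimately have "((\<lambda>w. G w $ j $ k) \<circ> p has_vector_derivative e *
          ((P (p u) ** G (p u) - G (p u) ** Q (p u)) $ j $ k / (p u - t))) (at u)"
        by (rule field_vector_diff_chain_at)
      then show "((\<lambda>u. G (p u) $ j $ k) has_vector_derivative g' u $ j $ k) (at u)"
        by (simp add: o_def g'_def)
      let ?n = "sqrt (sqnorm (G (p u)))"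
      have n: "cmod (G (p u) $ j $ k) \<le> ?n" for j k
        using entry_le_sqnorm real_le_rsqrt by blast
      have 1: "cmod (P (p u) $ j $ l * G (p u) $ l $ k) \<le> b1 * ?n" for l
        unfolding norm_mult using b1 n p(1)[OF u] by (intro mult_mono) auto
      have 2: "cmod (G (p u) $ j $ l * Q (p u) $ l $ k) \<le> ?n * b2" for l
        unfolding norm_mult using b2 n p(1)[OF u]
        by (intro mult_mono) (auto simp: sqnorm_nonneg)
      have "cmod ((P (p u) ** G (p u) - G (p u) ** Q (p u)) $ j $ k)
         \<le> (b1 * ?n + b1 * ?n) + (?n * b2 + ?n * b2)"
        unfolding vector_minus_component mult_entry
        by (intro order.trans[OF norm_triangle_ineq4] add_mono order.trans[OF norm_triangle_ineq] 1 2)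
      also have "\<dots> = c * ?n" by (simp add: c_def algebra_simps)
      finally show "cmod (g' u $ j $ k) \<le> c * ?n / u"
        using u e p(3)[OF u] by (simp add: g'_def norm_mult norm_divide divide_right_mono)
    qed (use N s in auto)
    also have "sqnorm (G (p (r / 2))) \<le> (\<Sum>j\<in>(UNIV::2 set). \<Sum>k\<in>(UNIV::2 set). b3\<^sup>2)"
      unfolding sqnorm_def
      by (intro sum_mono power_mono b3) (use e r in \<open>auto simp: p_def dist_norm norm_mult\<close>)
    also have "\<dots> = (2 * b3)\<^sup>2" by (simp add: sum_2 power2_eq_square)
    finally have "s ^ (2 * N) * sqnorm (G x) \<le> (r / 2) ^ (2 * N) * (2 * b3)\<^sup>2"
      using r px by (simp add: mult_left_mono)
    then have "s ^ (2 * N) * (cmod (G x $ j $ k))\<^sup>2 \<le> (r / 2) ^ (2 * N) * (2 * b3)\<^sup>2"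
      using entry_le_sqnorm[of "G x" j k] s by (meson less_imp_le mult_left_mono order.trans zero_le_power)
    then have "(s ^ N * cmod (G x $ j $ k))\<^sup>2 \<le> C\<^sup>2"
      by (simp only: C_def power_mult_distrib power_even_eq)
    moreover have "C \<ge> 0" using r b3(1) by (simp add: C_def)
    ultimately have "s ^ N * cmod (G x $ j $ k) \<le> C" by (rule power2_le_imp_le)
    then show "cmod ((x - t) ^ N * G x $ j $ k) \<le> C"
      by (simp add: norm_mult norm_power s_def)
  qed
qed

text \<open>If \<open>H = (x - t)\<^sup>N G\<close> is holomorphic and \<open>N > 0\<close>, then \<open>(x - t) H' = N H + P H - H Q\<close>, and at \<open>x = t\<close> this says that
  \<open>- N H(t) = A\<^sub>0 H(t) - H(t) B\<^sub>0\<close> for the residues \<open>A\<^sub>0 = P(t)\<close> and \<open>B\<^sub>0 = Q(t)\<close>.  Hence \<open>H(t) = 0\<close>, and the exponent can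
  be lowered.\<close>

lemma lower_pole_order:
  assumes nonres: "\<And>k X. k > 0 \<Longrightarrow> map_matrix ((*) (- of_nat k)) X = P t ** X - X ** Q t \<Longrightarrow> X = 0"
    and H: "mholo H (ball t r)"
      "\<And>x j k. x \<in> ball t r - {t} \<Longrightarrow> H x $ j $ k = (x - t) ^ N * G x $ j $ k"
  shows "\<exists>H. mholo H (ball t r) \<and> (\<forall>x\<in>ball t r - {t}. H x = G x)"
  using H
proof (induction N arbitrary: H)
  case 0
  then show ?case by (auto simp: vec_eq_iff)
next
  case (Suc N)
  have ht: "t \<in> ball t r" using r by simp
  have ev: "\<forall>\<^sub>F x in at t. x \<in> ball t r - {t}"
    unfolding eventually_at using r by (intro exI[of _ r]) (auto simp: dist_commute)
  have "H t = 0"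
  proof (rule nonres[of "Suc N"])
    have "- of_nat (Suc N) * H t $ j $ k = (P t ** H t - H t ** Q t) $ j $ k" for j k
    proof -
      define \<phi> where "\<phi> x = (x - t) * deriv (\<lambda>z. H z $ j $ k) x
          - (of_nat (Suc N) * H x $ j $ k + (P x ** H x - H x ** Q x) $ j $ k)" for x
      have "\<phi> holomorphic_on ball t r"
        using Suc.prems(1) P Q
        unfolding \<phi>_def mult_entry mholo_def vector_minus_component
        by (intro holomorphic_intros) auto
      then have "continuous (at t) \<phi>"
        using ht holomorphic_on_imp_continuous_on continuous_on_eq_continuous_at by blast
      moreover have "\<forall>\<^sub>F x in at t. \<phi> x = 0"
        using ev
      proof eventually_elim
        case (elim x)
        then have xt: "x \<noteq> t" by auto
        let ?g = "(P x ** G x - G x ** Q x) $ j $ k"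
        have "((\<lambda>z. G z $ j $ k) has_field_derivative ?g / (x - t)) (at x)"
          using der[OF elim] by (simp add: mderiv_def)
        then have "((\<lambda>z. (z - t) ^ Suc N * G z $ j $ k) has_field_derivative
            (of_nat (Suc N) * (x - t) ^ N * G x $ j $ k + (x - t) ^ Suc N * (?g / (x - t)))) (at x)"
          by (auto intro!: derivative_eq_intros simp: algebra_simps simp del: of_nat_Suc power_Suc)
        then have "((\<lambda>z. H z $ j $ k) has_field_derivative
            (of_nat (Suc N) * (x - t) ^ N * G x $ j $ k + (x - t) ^ Suc N * (?g / (x - t)))) (at x)"
          by (rule has_field_derivative_transform_within_open[where S = "ball t r - {t}"])
             (use elim Suc.prems(2) in auto)
        then have d: "deriv (\<lambda>z. H z $ j $ k) x =
            of_nat (Suc N) * (x - t) ^ N * G x $ j $ k + (x - t) ^ N * ?g"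
          using xt by (simp add: DERIV_imp_deriv)
        have "(P x ** H x - H x ** Q x) $ j $ k = (x - t) ^ Suc N * ?g"
          unfolding vector_minus_component mult_entry Suc.prems(2)[OF elim]
          by (simp add: algebra_simps)
        then show "\<phi> x = 0"
          unfolding \<phi>_def d Suc.prems(2)[OF elim] by (simp add: algebra_simps)
      qed
      ultimately have "\<phi> t = 0" by (rule zero_at_puncture)
      then show ?thesis unfolding \<phi>_def by (simp add: algebra_simps)
    qed
    then show "map_matrix ((*) (- of_nat (Suc N))) (H t) = P t ** H t - H t ** Q t"
      by (simp add: vec_eq_iff)
  qed simp
  then have H0: "H t $ j $ k = 0" for j k by simp
  define H1 where "H1 x = (\<chi> j k. if x = t then deriv (\<lambda>z. H z $ j $ k) t
      else (H x $ j $ k - H t $ j $ k) / (x - t))" for x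
  have "mholo H1 (ball t r)"
    using Suc.prems(1) pole_lemma_open[of "\<lambda>z. H z $ _ $ _" "ball t r" t]
    by (simp add: mholo_def H1_def)
  moreover have "H1 x $ j $ k = (x - t) ^ N * G x $ j $ k" if "x \<in> ball t r - {t}" for x j k
    using that Suc.prems(2)[OF that] by (auto simp: H1_def H0)
  ultimately show ?case by (rule Suc.IH)
qed

theorem removable_nonresonant:
  assumes nonres: "\<And>k X. k > 0 \<Longrightarrow> map_matrix ((*) (- of_nat k)) X = P t ** X - X ** Q t \<Longrightarrow> X = 0"
  obtains H where "mholo H (ball t r)" "\<And>x. x \<in> ball t r - {t} \<Longrightarrow> H x = G x"
proof -
  obtain N C where NC: "\<And>x j k. x \<in> ball t (r / 2) - {t} \<Longrightarrow> cmod ((x - t) ^ N * G x $ j $ k) \<le> C"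
    using moderate_growth by blast
  have G: "mholo G (ball t r - {t})"
    by (rule mholo_I_mderiv[OF _ der]) auto
  have "\<exists>h. h holomorphic_on ball t r \<and> (\<forall>x\<in>ball t r - {t}. h x = (x - t) ^ N * G x $ j $ k)" for j k
  proof (subst holomorphic_on_extend_bounded)
    show "(\<lambda>x. (x - t) ^ N * G x $ j $ k) holomorphic_on ball t r - {t}"
      using G by (auto simp: mholo_def intro!: holomorphic_intros)
    show "t \<in> interior (ball t r)" using r by simp
    have "\<forall>\<^sub>F x in at t. x \<in> ball t (r / 2) - {t}"
      unfolding eventually_at using r by (intro exI[of _ "r/2"]) (auto simp: dist_commute)
    then have "\<forall>\<^sub>F x in at t. cmod ((x - t) ^ N * G x $ j $ k) \<le> C"
      by eventually_elim (rule NC)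
    then show "\<exists>B. \<forall>\<^sub>F x in at t. cmod ((x - t) ^ N * G x $ j $ k) \<le> B" ..
  qed
  then obtain h where h: "\<And>j k. h j k holomorphic_on ball t r"
    "\<And>j k x. x \<in> ball t r - {t} \<Longrightarrow> h j k x = (x - t) ^ N * G x $ j $ k" by metis
  define H where "H x = (\<chi> j k. h j k x)" for x
  have Hh: "H x $ j $ k = h j k x" for x j k by (simp add: H_def)
  have "mholo H (ball t r)" unfolding mholo_def Hh using h(1) by blast
  moreover have "H x $ j $ k = (x - t) ^ N * G x $ j $ k" if "x \<in> ball t r - {t}" for x j k
    unfolding Hh using h(2)[OF that] .
  ultimately have "\<exists>H. mholo H (ball t r) \<and> (\<forall>x\<in>ball t r - {t}. H x = G x)"
    using lower_pole_order[of H N] nonres by blast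
  then show ?thesis using that by blast
qed

end

lemma char_poly_trace_det:
  assumes "\<And>z. det (mat z - (A :: cmat2)) = (z - p) * (z - m)"
  shows "A $ 1 $ 1 + A $ 2 $ 2 = p + m" "A $ 1 $ 1 * A $ 2 $ 2 - A $ 1 $ 2 * A $ 2 $ 1 = p * m"
proof -
  from assms[of 0] show 1: "A $ 1 $ 1 * A $ 2 $ 2 - A $ 1 $ 2 * A $ 2 $ 1 = p * m"
    by (simp add: det_2)
  from assms[of 1] have "(1 - A $ 1 $ 1) * (1 - A $ 2 $ 2) - A $ 1 $ 2 * A $ 2 $ 1 = (1 - p) * (1 - m)"
    by (simp add: det_2)
  with 1 show "A $ 1 $ 1 + A $ 2 $ 2 = p + m" by (simp add: algebra_simps)
qed

text \<open>From \<open>A X = X (B - k)\<close> one gets \<open>q(A) X = X q(B - k)\<close> for the common characteristic polynomial \<open>q\<close> of \<open>A\<close>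
  and \<open>B\<close>.  By the theorem of Cayley and Hamilton the left-hand side is 0 and the right-hand side is
  \<open>- k X (2B - (p + m + k))\<close>, where the determinant of the last factor is \<open>(m - p - k) (p - m - k)\<close>, which
  non-resonance makes nonzero.\<close>

lemma nonresonant_sylvester:
  assumes A: "\<And>z. det (mat z - (A :: cmat2)) = (z - p) * (z - m)"
    and B: "\<And>z. det (mat z - (B :: cmat2)) = (z - p) * (z - m)"
    and pm: "p - m \<notin> \<int>" and k: "k > (0 :: nat)"
    and X: "map_matrix ((*) (- of_nat k)) X = A ** X - X ** B"
  shows "X = 0"
proof -
  define c :: complex where "c = of_nat k"
  have c: "c \<noteq> 0" "p - m \<noteq> c" "m - p \<noteq> c"
    using k pm by (auto simp: c_def) (metis Ints_minus Ints_of_nat minus_diff_eq)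
  note a = char_poly_trace_det[OF A] and b = char_poly_trace_det[OF B]
  have e: "- c * X $ i $ j = (A ** X) $ i $ j - (X ** B) $ i $ j" for i j
    using X unfolding vec_eq_iff c_def by simp
  define Y where "Y = mat2 (2 * B $ 1 $ 1 - (p + m + c)) (2 * B $ 1 $ 2)
      (2 * B $ 2 $ 1) (2 * B $ 2 $ 2 - (p + m + c))"
  obtain a11 a12 a21 a22 where A': "A = mat2 a11 a12 a21 a22"
    by (metis mat2_eq_iff mat2_entry)
  obtain b11 b12 b21 b22 where B': "B = mat2 b11 b12 b21 b22"
    by (metis mat2_eq_iff mat2_entry)
  obtain x11 x12 x21 x22 where X': "X = mat2 x11 x12 x21 x22"
    by (metis mat2_eq_iff mat2_entry)
  have a': "a11 + a22 = p + m" "a11 * a22 - a12 * a21 = p * m" using a by (simp_all add: A')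
  have b': "b11 + b22 = p + m" "b11 * b22 - b12 * b21 = p * m" using b by (simp_all add: B')
  have e': "- c * x11 = a11 * x11 + a12 * x21 - (x11 * b11 + x12 * b21)"
    "- c * x12 = a11 * x12 + a12 * x22 - (x11 * b12 + x12 * b22)"
    "- c * x21 = a21 * x11 + a22 * x21 - (x21 * b11 + x22 * b21)"
    "- c * x22 = a21 * x12 + a22 * x22 - (x21 * b12 + x22 * b22)"
    using e[of 1 1] e[of 1 2] e[of 2 1] e[of 2 2] by (simp_all add: A' B' X' mult_entry)
  \<comment> \<open>Cayley-Hamilton for \<open>A\<close> and \<open>B\<close>; then \<open>c X Y = A R + R (B - c) - (p + m) R - q(A) X + X q(B)\<close>,
    where \<open>R = A X - X B + c X\<close> vanishes\<close>
  define T where "T = p + m"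
  define d where "d = p * m"
  have T: "T = a11 + a22" "d = a11 * a22 - a12 * a21" using a' by (simp_all add: T_def d_def)
  have qA: "a11 * a11 + a12 * a21 - T * a11 + d = 0" "a11 * a12 + a12 * a22 - T * a12 = 0"
    "a21 * a11 + a22 * a21 - T * a21 = 0" "a21 * a12 + a22 * a22 - T * a22 + d = 0"
    unfolding T by (simp_all add: algebra_simps)
  have T: "T = b11 + b22" "d = b11 * b22 - b12 * b21" using b' by (simp_all add: T_def d_def)
  have qB: "b11 * b11 + b12 * b21 - T * b11 + d = 0" "b11 * b12 + b12 * b22 - T * b12 = 0"
    "b21 * b11 + b22 * b21 - T * b21 = 0" "b21 * b12 + b22 * b22 - T * b22 + d = 0"
    unfolding T by (simp_all add: algebra_simps)
  define R11 R12 R21 R22 where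
    "R11 = a11 * x11 + a12 * x21 - (x11 * b11 + x12 * b21) + c * x11" and
    "R12 = a11 * x12 + a12 * x22 - (x11 * b12 + x12 * b22) + c * x12" and
    "R21 = a21 * x11 + a22 * x21 - (x21 * b11 + x22 * b21) + c * x21" and
    "R22 = a21 * x12 + a22 * x22 - (x21 * b12 + x22 * b22) + c * x22"
  note R_def = R11_def R12_def R21_def R22_def
  have R0: "R11 = 0" "R12 = 0" "R21 = 0" "R22 = 0"
    using e' by (simp_all add: R_def algebra_simps)
  have "c * (x11 * (2 * b11 - (T + c)) + x12 * (2 * b21)) =
      a11 * R11 + a12 * R21 + (R11 * (b11 - c) + R12 * b21) - T * R11
      - ((a11 * a11 + a12 * a21 - T * a11 + d) * x11 + (a11 * a12 + a12 * a22 - T * a12) * x21)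
      + (x11 * (b11 * b11 + b12 * b21 - T * b11 + d) + x12 * (b21 * b11 + b22 * b21 - T * b21))"
    unfolding R_def by (simp add: algebra_simps)
  then have z11: "c * (x11 * (2 * b11 - (T + c)) + x12 * (2 * b21)) = 0" by (simp only: qA qB R0 mult_zero_left mult_zero_right add_0 diff_zero)
  have "c * (x11 * (2 * b12) + x12 * (2 * b22 - (T + c))) =
      a11 * R12 + a12 * R22 + (R11 * b12 + R12 * (b22 - c)) - T * R12
      - ((a11 * a11 + a12 * a21 - T * a11 + d) * x12 + (a11 * a12 + a12 * a22 - T * a12) * x22)
      + (x11 * (b11 * b12 + b12 * b22 - T * b12) + x12 * (b21 * b12 + b22 * b22 - T * b22 + d))"
    unfolding R_def by (simp add: algebra_simps)
  then have z12: "c * (x11 * (2 * b12) + x12 * (2 * b22 - (T + c))) = 0" by (simp only: qA qB R0 mult_zero_left mult_zero_right add_0 diff_zero)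
  have "c * (x21 * (2 * b11 - (T + c)) + x22 * (2 * b21)) =
      a21 * R11 + a22 * R21 + (R21 * (b11 - c) + R22 * b21) - T * R21
      - ((a21 * a11 + a22 * a21 - T * a21) * x11 + (a21 * a12 + a22 * a22 - T * a22 + d) * x21)
      + (x21 * (b11 * b11 + b12 * b21 - T * b11 + d) + x22 * (b21 * b11 + b22 * b21 - T * b21))"
    unfolding R_def by (simp add: algebra_simps)
  then have z21: "c * (x21 * (2 * b11 - (T + c)) + x22 * (2 * b21)) = 0" by (simp only: qA qB R0 mult_zero_left mult_zero_right add_0 diff_zero)
  have "c * (x21 * (2 * b12) + x22 * (2 * b22 - (T + c))) =
      a21 * R12 + a22 * R22 + (R21 * b12 + R22 * (b22 - c)) - T * R22
      - ((a21 * a11 + a22 * a21 - T * a21) * x12 + (a21 * a12 + a22 * a22 - T * a22 + d) * x22)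
      + (x21 * (b11 * b12 + b12 * b22 - T * b12) + x22 * (b21 * b12 + b22 * b22 - T * b22 + d))"
    unfolding R_def by (simp add: algebra_simps)
  then have z22: "c * (x21 * (2 * b12) + x22 * (2 * b22 - (T + c))) = 0" by (simp only: qA qB R0 mult_zero_left mult_zero_right add_0 diff_zero)
  from z11 z12 z21 z22 have XY: "X ** Y = 0"
    using c by (simp add: mat2_eq_iff mult_entry X' Y_def B' T_def)
  have "(2 * b11 - (T + c)) * (2 * b22 - (T + c)) - 2 * b12 * (2 * b21)
      = 4 * d - 2 * (T + c) * T + (T + c) * (T + c)"
    unfolding T by (simp add: algebra_simps)
  also have "\<dots> = (m - p - c) * (p - m - c)"
    unfolding T_def d_def by (simp add: algebra_simps)
  finally have "det Y = (m - p - c) * (p - m - c)" by (simp add: det_2 Y_def B' T_def)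
  then have "det Y \<noteq> 0" using c by simp
  then obtain Z where "Y ** Z = mat 1" using invertible_det_nz invertible_def by blast
  then have "X = (X ** Y) ** Z" by (simp flip: matrix_mul_assoc)
  also have "\<dots> = 0" unfolding XY by (simp add: mat2_eq_iff mult_entry)
  finally show ?thesis .
qed

section \<open>Rigidity of intertwiners\<close>

lemma fuchs_entry:
  "fuchs n t A x $ j $ k = (\<Sum>i=1..n+2. A i $ j $ k / (x - complex_of_real (t i)))"
  by (simp add: fuchs_def)

lemma fuchs_mult_const: "fuchs n t A x ** K = fuchs n t (\<lambda>i. A i ** K) x"
  unfolding vec_eq_iff mult_entry fuchs_entry sum_distrib_right sum.distrib[symmetric]
  by (intro allI sum.cong) (simp_all add: add_divide_distrib)

lemma fuchs_const_mult: "K ** fuchs n t A x = fuchs n t (\<lambda>i. K ** A i) x"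
  unfolding vec_eq_iff mult_entry fuchs_entry sum_distrib_left sum.distrib[symmetric]
  by (intro allI sum.cong) (simp_all add: add_divide_distrib)

lemma fuchs_diff: "fuchs n t A x - fuchs n t B x = fuchs n t (\<lambda>i. A i - B i) x"
  unfolding vec_eq_iff vector_minus_component fuchs_entry sum_subtractf[symmetric]
  by (intro allI sum.cong) (simp_all add: diff_divide_distrib)

lemma finite_sing: "finite (sing n t)"
  by (simp add: sing_def)

lemma sing_iff: "x \<in> sing n t \<longleftrightarrow> (\<exists>i\<in>{1..n+2}. x = complex_of_real (t i))"
  by (auto simp: sing_def)

lemma eventually_notin_finite:
  assumes "finite S"
  shows "\<forall>\<^sub>F x in at (a :: complex). x \<notin> S"
proof -
  have "open (- (S - {a}))" using assms by (intro open_Compl finite_imp_closed) simp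
  then show ?thesis
    unfolding eventually_at_topological by (intro exI[of _ "- (S - {a})"]) auto
qed

text \<open>The product \<open>(x - c) A(x)\<close>, continued to \<open>x = c\<close>; there its value is the residue of the system at \<open>c\<close>.\<close>

definition cleared :: "nat \<Rightarrow> (nat \<Rightarrow> real) \<Rightarrow> (nat \<Rightarrow> cmat2) \<Rightarrow> complex \<Rightarrow> complex \<Rightarrow> cmat2" where
  "cleared n t A c x = (\<chi> j k. \<Sum>i=1..n+2.
     (if complex_of_real (t i) = c then 1 else (x - c) / (x - complex_of_real (t i))) * A i $ j $ k)"

lemma cleared_eq:
  assumes "x \<noteq> c"
  shows "cleared n t A c x $ j $ k = (x - c) * fuchs n t A x $ j $ k"
proof -
  have "cleared n t A c x $ j $ k
      = (\<Sum>i=1..n+2. (x - c) * (A i $ j $ k / (x - complex_of_real (t i))))"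
    unfolding cleared_def using assms by (simp, intro sum.cong) auto
  then show ?thesis unfolding fuchs_entry sum_distrib_left .
qed

lemma cleared_holo:
  assumes "\<And>s. s \<in> sing n t \<Longrightarrow> s \<noteq> c \<Longrightarrow> s \<notin> U"
  shows "mholo (cleared n t A c) U"
  unfolding mholo_def cleared_def vec_lambda_beta
proof (intro allI holomorphic_on_sum holomorphic_on_mult holomorphic_on_const)
  fix i assume i: "i \<in> {1..n + 2}"
  show "(\<lambda>z. if complex_of_real (t i) = c then 1 else (z - c) / (z - complex_of_real (t i)))
      holomorphic_on U"
  proof (cases "complex_of_real (t i) = c")
    case False
    then have "complex_of_real (t i) \<notin> U" using i assms[of "t i"] unfolding sing_iff by blast
    then show ?thesis using False by (auto intro!: holomorphic_intros)
  qed simp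
qed

lemma cleared_at_sing:
  assumes "inj_on t {1..n+2}" "m \<in> {1..n+2}"
  shows "cleared n t A (complex_of_real (t m)) (complex_of_real (t m)) = A m"
proof -
  have "(\<Sum>i=1..n+2. (if t i = t m then 1 else 0) * A i $ j $ k) = A m $ j $ k" for j k
  proof -
    have "(\<Sum>i=1..n+2. (if t i = t m then 1 else 0) * A i $ j $ k)
        = (\<Sum>i=1..n+2. if i = m then A i $ j $ k else 0)"
      using assms by (intro sum.cong) (auto dest: inj_onD)
    also have "\<dots> = A m $ j $ k" using assms(2) by (subst sum.delta) simp_all
    finally show ?thesis .
  qed
  then show ?thesis
    unfolding cleared_def vec_eq_iff vec_lambda_beta of_real_eq_iff diff_self div_0 by blast
qed

lemma cleared_off_sing:
  assumes "c \<notin> sing n t"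
  shows "cleared n t A c c = 0"
  unfolding cleared_def vec_eq_iff using assms by (auto simp: sing_iff intro!: sum.neutral)

lemma partial_fractions_unique:
  fixes c :: "nat \<Rightarrow> complex"
  assumes inj: "inj_on t {1..n+2}" and S: "finite S" and m: "m \<in> {1..n+2}"
    and eq: "\<And>x. x \<notin> S \<Longrightarrow> (\<Sum>i=1..n+2. c i / (x - complex_of_real (t i))) = 0"
  shows "c m = 0"
proof -
  define A :: "nat \<Rightarrow> cmat2" where "A i = mat2 (c i) 0 0 0" for i
  let ?t = "complex_of_real (t m)"
  let ?\<phi> = "\<lambda>x. cleared n t A ?t x $ 1 $ 1"
  obtain U where U: "open U" "?t \<in> U" "U \<inter> (sing n t - {?t}) = {}"
    using finite_sing[of n t]
    by (metis Compl_disjoint2 Diff_iff finite_Diff finite_imp_closed open_Compl insertI1 ComplI)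
  have "mholo (cleared n t A ?t) U" using U(3) by (intro cleared_holo) auto
  then have "continuous (at ?t) ?\<phi>"
    using U(1,2) holomorphic_on_imp_continuous_on continuous_on_eq_continuous_at
    unfolding mholo_def by blast
  moreover have "\<forall>\<^sub>F x in at ?t. ?\<phi> x = 0"
  proof -
    have "\<forall>\<^sub>F x in at ?t. x \<notin> insert ?t S"
      by (rule eventually_notin_finite) (use S in simp)
    then show ?thesis
    proof eventually_elim
      case (elim x)
      then have "x \<noteq> ?t" "(\<Sum>i=1..n+2. c i / (x - complex_of_real (t i))) = 0" using eq by auto
      then show ?case using cleared_eq[of x ?t n t A 1 1] by (simp add: fuchs_entry A_def)
    qed
  qed
  ultimately have "?\<phi> ?t = 0" by (rule zero_at_puncture)
  then show ?thesis unfolding cleared_at_sing[OF inj m] by (simp add: A_def)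
qed

text \<open>The exceptional set \<open>S\<close> may contain regular points of the two systems: the gauge transformation built
  from the second-order equation has possible poles at the zeros of \<open>A\<^sub>1\<^sub>2\<close>.\<close>

theorem intertwiner_constant_diagonal:
  fixes G :: "complex \<Rightarrow> cmat2"
  assumes inj: "inj_on t {1..n+2}" and S: "finite S" "sing n t \<subseteq> S"
    and der: "\<And>x. x \<notin> S \<Longrightarrow> mderiv G (fuchs n t A x ** G x - G x ** fuchs n t B x) x"
    and eigA: "\<And>i z. i \<in> {1..n+2} \<Longrightarrow> det (mat z - A i) = (z - p i) * (z - m i)"
    and eigB: "\<And>i z. i \<in> {1..n+2} \<Longrightarrow> det (mat z - B i) = (z - p i) * (z - m i)"
    and nonres: "\<And>i. i \<in> {1..n+2} \<Longrightarrow> p i - m i \<notin> \<int>"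
    and infA: "- (\<Sum>i=1..n+2. A i) = mat2 p' 0 0 m'"
    and infB: "- (\<Sum>i=1..n+2. B i) = mat2 p' 0 0 m'"
    and nonres': "p' - m' \<notin> \<int>"
  obtains g1 g2 where "\<And>x. x \<notin> S \<Longrightarrow> G x = mat2 g1 0 0 g2"
    "\<And>i. i \<in> {1..n+2} \<Longrightarrow> A i ** mat2 g1 0 0 g2 = mat2 g1 0 0 g2 ** B i"
proof -
  have Gholo: "mholo G (- S)"
    by (rule mholo_I_mderiv[OF _ der]) (use S in \<open>auto simp: finite_imp_closed open_Compl\<close>)
  have local: "\<exists>b r. r > 0 \<and> (\<forall>x\<in>ball c r - {c}. \<forall>j k. cmod (G x $ j $ k) \<le> b)" for c
  proof -
    obtain r where r: "r > 0" "\<forall>x\<in>S. x \<noteq> c \<longrightarrow> r \<le> dist c x"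
      using finite_set_avoid[OF S(1)] by blast
    have notS: "x \<notin> S" if "x \<in> ball c r - {c}" for x using r(2) that by force
    have holo: "mholo (cleared n t C c) (ball c r)" for C
      using notS S(2) by (intro cleared_holo) auto
    have "\<exists>H. mholo H (ball c r) \<and> (\<forall>x\<in>ball c r - {c}. H x = G x)"
    proof (rule removable_nonresonant[OF r(1) holo[of A] holo[of B], of G])
      fix x assume x: "x \<in> ball c r - {c}"
      have "map_matrix (\<lambda>a. a / (x - c)) (cleared n t A c x ** G x - G x ** cleared n t B c x)
          = fuchs n t A x ** G x - G x ** fuchs n t B x"
        using x unfolding vec_eq_iff
        by (auto simp: mult_entry cleared_eq field_simps)
      then show "mderiv G (map_matrix (\<lambda>a. a / (x - c))
          (cleared n t A c x ** G x - G x ** cleared n t B c x)) x"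
        using der[OF notS[OF x]] by simp
    next
      fix k :: nat and X
      assume k: "k > 0" and X: "map_matrix ((*) (- of_nat k)) X
          = cleared n t A c c ** X - X ** cleared n t B c c"
      show "X = 0"
      proof (cases "c \<in> sing n t")
        case True
        then obtain i where i: "i \<in> {1..n+2}" "c = complex_of_real (t i)" by (auto simp: sing_iff)
        show ?thesis
          using nonresonant_sylvester[OF eigA[OF i(1)] eigB[OF i(1)] nonres[OF i(1)] k]
            X cleared_at_sing[OF inj i(1)] i(2) by metis
      next
        case False
        then have "- of_nat k * X $ i $ j = 0" for i j
          using X by (auto simp: cleared_off_sing vec_eq_iff mult_entry)
        then show ?thesis using k by (simp add: vec_eq_iff)
      qed
    qed blast
    then obtain H where H: "mholo H (ball c r)" "\<And>x. x \<in> ball c r - {c} \<Longrightarrow> H x = G x" by blast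
    have sub: "cball c (r / 2) \<subseteq> ball c r" using r by auto
    obtain b where b: "\<And>x j k. x \<in> cball c (r / 2) \<Longrightarrow> cmod (H x $ j $ k) \<le> b"
      by (rule bounded_entries[OF H(1) compact_cball sub], rule that)
    have "cmod (G x $ j $ k) \<le> b" if "x \<in> ball c (r / 2) - {c}" for x j k
    proof -
      have "dist c x < r / 2" "x \<noteq> c" using that by auto
      moreover from this have "dist c x < r" using r(1) by linarith
      ultimately have "x \<in> ball c r - {c}" "x \<in> cball c (r / 2)" by auto
      then show ?thesis using b H(2) by metis
    qed
    then show ?thesis using r(1) by (intro exI[of _ b] exI[of _ "r / 2"]) auto
  qed
  have "\<exists>g. g holomorphic_on UNIV \<and> (\<forall>x\<in>UNIV - S. g x = G x $ j $ k)" for j k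
  proof (rule removable_singularities[OF S(1)])
    show "(\<lambda>x. G x $ j $ k) holomorphic_on UNIV - S"
      using Gholo by (simp add: mholo_def Compl_eq_Diff_UNIV)
    fix c
    obtain b r where br: "r > 0" "\<And>x j k. x \<in> ball c r - {c} \<Longrightarrow> cmod (G x $ j $ k) \<le> b"
      using local[of c] by blast
    have "\<forall>\<^sub>F x in at c. x \<in> ball c r - {c}"
      unfolding eventually_at using br(1) by (intro exI[of _ r]) (auto simp: dist_commute)
    then have "\<forall>\<^sub>F x in at c. norm (G x $ j $ k) \<le> b * norm (1 :: complex)"
      by eventually_elim (use br(2) in simp)
    then show "(\<lambda>x. G x $ j $ k) \<in> O[at c](\<lambda>_. 1 :: complex)" by (rule bigoI)
  qed auto
  then obtain g where g: "\<And>j k. g j k holomorphic_on UNIV"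
    "\<And>j k x. x \<notin> S \<Longrightarrow> g j k x = G x $ j $ k" by (metis UNIV_I DiffI)
  \<comment> \<open>in the coordinate \<open>z = 1/x\<close> the point at infinity is a singularity like the others, with residue
    \<open>A\<^sub>\<infinity>\<close>\<close>
  obtain R where R: "R > 0" "\<And>s. s \<in> S \<Longrightarrow> cmod s < R"
    using finite_imp_bounded[OF S(1)] unfolding bounded_pos_less by blast
  define P where "P C z = (\<chi> j k. - (\<Sum>i=1..n+2. C i $ j $ k / (1 - z * complex_of_real (t i))))"
    for C :: "nat \<Rightarrow> cmat2" and z
  have nz: "1 - z * complex_of_real (t i) \<noteq> 0" if "z \<in> ball 0 (1 / R)" "i \<in> {1..n+2}" for z i
  proof -
    have "complex_of_real (t i) \<in> S" using that(2) S(2) unfolding sing_def by blast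
    then have "\<bar>t i\<bar> < R" using R(2)[of "complex_of_real (t i)"] by simp
    then have "cmod z * \<bar>t i\<bar> < 1"
      using that(1) R(1) mult_strict_mono'[of "cmod z" "1 / R" "\<bar>t i\<bar>" R] by simp
    then show ?thesis by (metis norm_mult norm_of_real norm_one right_minus_eq order_less_irrefl)
  qed
  have out: "1 / z \<notin> S" if "z \<in> ball 0 (1 / R) - {0}" for z
    using R that by (auto simp: norm_divide field_simps dest!: R(2))
  have "\<exists>H. mholo H (ball 0 (1 / R)) \<and> (\<forall>z\<in>ball 0 (1 / R) - {0}. H z = G (1 / z))"
  proof (rule removable_nonresonant[of "1 / R" "P A" 0 "P B" "\<lambda>z. G (1 / z)"])
    show "1 / R > 0" using R by simp
    show "mholo (P A) (ball 0 (1 / R))" "mholo (P B) (ball 0 (1 / R))"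
      unfolding mholo_def P_def vec_lambda_beta using nz by (auto intro!: holomorphic_intros)
  next
    fix z :: complex assume z: "z \<in> ball 0 (1 / R) - {0}"
    then have z0: "z \<noteq> 0" by simp
    have PC: "P C z $ j $ k = - (1 / z) * fuchs n t C (1 / z) $ j $ k" for C j k
    proof -
      have "C i $ j $ k / (1 - z * complex_of_real (t i))
          = (1 / z) * (C i $ j $ k / (1 / z - complex_of_real (t i)))" for i
        using z0 by (simp add: field_simps)
      then show ?thesis
        unfolding P_def fuchs_entry vec_lambda_beta by (simp only: sum_distrib_left mult_minus_left sum_negf)
    qed
    have "((\<lambda>z. G (1 / z) $ j $ k) has_field_derivative
        (fuchs n t A (1 / z) ** G (1 / z) - G (1 / z) ** fuchs n t B (1 / z)) $ j $ k * (- 1 / z\<^sup>2)) (at z)"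
      for j k
    proof (rule DERIV_chain2[of "\<lambda>x. G x $ j $ k"])
      show "((/) 1 has_field_derivative - 1 / z\<^sup>2) (at z)"
        using z0 by (auto intro!: derivative_eq_intros simp: power2_eq_square)
    qed (use der[OF out[OF z]] in \<open>simp add: mderiv_def\<close>)
    moreover have "(fuchs n t A (1 / z) ** G (1 / z) - G (1 / z) ** fuchs n t B (1 / z)) $ j $ k * (- 1 / z\<^sup>2)
        = (P A z ** G (1 / z) - G (1 / z) ** P B z) $ j $ k / (z - 0)" for j k
      using z0 by (simp add: PC mult_entry field_simps power2_eq_square)
    ultimately show "mderiv (\<lambda>z. G (1 / z))
        (map_matrix (\<lambda>a. a / (z - 0)) (P A z ** G (1 / z) - G (1 / z) ** P B z)) z"
      by (simp add: mderiv_def)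
  next
    fix k :: nat and X
    have P0: "P C 0 = - (\<Sum>i=1..n+2. C i)" for C
      by (simp add: P_def vec_eq_iff del: sum.cl_ivl_Suc)
    have char: "det (mat z - mat2 p' 0 0 m') = (z - p') * (z - m')" for z
      by (simp add: det_2)
    assume "k > 0" "map_matrix ((*) (- of_nat k)) X = P A 0 ** X - X ** P B 0"
    then show "X = 0"
      using nonresonant_sylvester[OF char char nonres'] unfolding P0 infA infB by blast
  qed blast
  then obtain H where H: "mholo H (ball 0 (1 / R))"
    "\<And>z. z \<in> ball 0 (1 / R) - {0} \<Longrightarrow> H z = G (1 / z)" by blast
  have "1 / R / 2 < 1 / R" using R(1) by (simp add: field_simps)
  then have sub: "cball 0 (1 / R / 2) \<subseteq> ball (0 :: complex) (1 / R)"
    by (auto intro: le_less_trans)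
  obtain b where b: "\<And>x j k. x \<in> cball 0 (1 / R / 2) \<Longrightarrow> cmod (H x $ j $ k) \<le> b"
    by (rule bounded_entries[OF H(1) compact_cball sub], rule that)
  have "\<exists>c. \<forall>x. g j k x = c" for j k
  proof -
    have "continuous_on (cball 0 (2 * R)) (g j k)"
      using g(1) holomorphic_on_imp_continuous_on continuous_on_subset by blast
    then have "bounded (g j k ` cball 0 (2 * R))"
      using compact_cball compact_continuous_image compact_imp_bounded by blast
    then obtain b' where b': "\<And>x. x \<in> cball 0 (2 * R) \<Longrightarrow> cmod (g j k x) \<le> b'"
      unfolding bounded_iff by blast
    have "cmod (g j k x) \<le> max b b'" for x
    proof (cases "cmod x \<le> 2 * R")
      case True
      then show ?thesis using b'[of x] by simp
    next
      case False
      then have xR: "cmod x > 2 * R" by simp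
      then have x0: "x \<noteq> 0" and xS: "x \<notin> S" using R by force+
      have "cmod (1 / x) \<le> 1 / R / 2"
        using xR R(1) x0 by (simp add: norm_divide field_simps)
      then have "cmod (H (1 / x) $ j $ k) \<le> b" by (intro b) simp
      moreover have "H (1 / x) = G x"
        using \<open>cmod (1 / x) \<le> 1 / R / 2\<close> sub x0 H(2)[of "1 / x"] by force
      ultimately show ?thesis using g(2)[OF xS] by simp
    qed
    then have "bounded (range (g j k))" by (auto simp: bounded_iff)
    then have "g j k constant_on UNIV" by (rule Liouville_theorem[OF g(1)])
    then show ?thesis unfolding constant_on_def by simp
  qed
  then have c: "g j k x = g j k 0" for j k x by metis
  define K where "K = (\<chi> j k. g j k 0)"
  have GK: "G x = K" if "x \<notin> S" for x
    unfolding K_def vec_eq_iff vec_lambda_beta using g(2)[OF that] c by metis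
  \<comment> \<open>as \<open>K\<close> is constant, \<open>A(x) K - K B(x)\<close> vanishes, hence so do all its residues\<close>
  have AK: "A i ** K = K ** B i" if i: "i \<in> {1..n+2}" for i
  proof -
    have "(A i ** K - K ** B i) $ j $ k = 0" for j k
    proof (rule partial_fractions_unique[OF inj S(1) i, of "\<lambda>i. (A i ** K - K ** B i) $ j $ k"])
      fix x assume x: "x \<notin> S"
      have "open (- S)" using S(1) by (simp add: finite_imp_closed open_Compl)
      then have ev: "\<forall>\<^sub>F z in nhds x. G z = K"
        unfolding eventually_nhds using x GK by (intro exI[of _ "- S"]) auto
      have "mderiv (\<lambda>_. K) (fuchs n t A x ** K - K ** fuchs n t B x) x"
        using mderiv_cong_ev[OF der[OF x] ev] GK[OF x] by simp
      then have "(fuchs n t A x ** K - K ** fuchs n t B x) $ j $ k = 0"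
        unfolding mderiv_def using DERIV_unique DERIV_const by blast
      then show "(\<Sum>i=1..n+2. (A i ** K - K ** B i) $ j $ k / (x - complex_of_real (t i))) = 0"
        unfolding fuchs_mult_const fuchs_const_mult fuchs_diff fuchs_entry .
    qed
    then show ?thesis by (simp add: vec_eq_iff)
  qed
  have "mat2 p' 0 0 m' ** K = K ** mat2 p' 0 0 m'"
  proof -
    have "(\<Sum>i=1..n+2. A i) ** K = (\<Sum>i=1..n+2. A i ** K)"
      unfolding vec_eq_iff by (simp only: mult_entry sum_component sum_distrib_right sum.distrib) simp
    also have "\<dots> = (\<Sum>i=1..n+2. K ** B i)" using AK by (intro sum.cong) auto
    also have "\<dots> = K ** (\<Sum>i=1..n+2. B i)"
      unfolding vec_eq_iff by (simp only: mult_entry sum_component sum_distrib_left sum.distrib) simp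
    finally have "- (\<Sum>i=1..n+2. A i) ** K = K ** - (\<Sum>i=1..n+2. B i)"
      by (simp only: matrix_mult_minus_left matrix_mult_minus_right)
    then show ?thesis unfolding infA infB .
  qed
  then have "p' * K $ 1 $ 2 = K $ 1 $ 2 * m'" "m' * K $ 2 $ 1 = K $ 2 $ 1 * p'"
    by (simp_all add: mat2_eq_iff mult_entry)
  moreover have "p' \<noteq> m'" using nonres' by auto
  ultimately have "K $ 1 $ 2 = 0" "K $ 2 $ 1 = 0" by auto
  then have "K = mat2 (K $ 1 $ 1) 0 0 (K $ 2 $ 2)" by (simp add: mat2_eq_iff)
  then show ?thesis using that GK AK by metis
qed

section \<open>Matrix algebra\<close>

lemma inv_cancel: "(P :: cmat2) ** Q = mat 1 \<Longrightarrow> P ** (Q ** X) = X"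
  by (simp add: matrix_mul_assoc)

lemma matrix_inv_eq: "(A :: cmat2) ** B = mat 1 \<Longrightarrow> matrix_inv A = B"
proof -
  assume AB: "A ** B = mat 1"
  then have BA: "B ** A = mat 1" by (simp add: matrix_left_right_inverse)
  have "A ** matrix_inv A = mat 1 \<and> matrix_inv A ** A = mat 1"
    unfolding matrix_inv_def by (rule someI[of _ B]) (use AB BA in simp)
  then show ?thesis using inv_cancel[OF BA, of "matrix_inv A"] by simp
qed

lemma inverse_pair:
  assumes "invertible (A :: cmat2)"
  obtains B where "A ** B = mat 1" "B ** A = mat 1" "matrix_inv A = B"
  using assms matrix_inv_eq unfolding invertible_def by metis

lemma cnj_mat_entry: "cnj_mat M $ j $ k = cnj (M $ j $ k)"
  by simp

lemma cnj_mat_mult: "cnj_mat (M ** N) = cnj_mat M ** cnj_mat N"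
  by (simp add: mat2_eq_iff mult_entry)

lemma cnj_mat_1: "cnj_mat (mat 1) = mat 1"
  by (simp add: mat2_eq_iff)

abbreviation smat :: "complex \<Rightarrow> cmat2 \<Rightarrow> cmat2" where
  "smat c \<equiv> map_matrix ((*) c)"

lemma smat_mult_left: "smat c M ** N = smat c (M ** N)"
  and smat_mult_right: "M ** smat c N = smat c (M ** N)"
  and smat_smat: "smat c (smat d M) = smat (c * d) M"
  and smat_1: "smat 1 M = M"
  by (simp_all add: mat2_eq_iff mult_entry algebra_simps)

lemma invertible_matrix_mult: "invertible (M :: cmat2) \<Longrightarrow> invertible (N :: cmat2) \<Longrightarrow> invertible (M ** N)"
  by (simp add: invertible_det_nz det_mul)

lemma rprod_invertible:
  "(\<And>i. 1 \<le> i \<Longrightarrow> i \<le> j \<Longrightarrow> invertible (N i)) \<Longrightarrow> invertible (rprod N j)"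
  by (induction j) (auto simp: det_mul invertible_det_nz)

section \<open>Conditions on the monodromy matrices\<close>

text \<open>For \<open>W\<^sub>j = N\<^sub>j \<cdots> N\<^sub>1\<close> this says \<open>cnj W\<^sub>j = X\<^sup>-\<^sup>1 W\<^sub>j\<^sup>-\<^sup>1 X\<close>.  It is the form of the conjugacy of the
  monodromies in which each equation involves a single partial product, and the one that the
  gluing of solutions produces.\<close>

definition conj_intertwiner :: "(nat \<Rightarrow> cmat2) \<Rightarrow> nat \<Rightarrow> cmat2 \<Rightarrow> bool" where
  "conj_intertwiner N m X \<longleftrightarrow> invertible X \<and> (\<forall>j\<le>m. rprod N j ** X ** cnj_mat (rprod N j) = X)"

text \<open>With \<open>C = X\<^sup>-\<^sup>1\<close> the conjugacy relation for \<open>N\<close> reads \<open>N W X cnj N = W X\<close>; multiplied by \<open>cnj W\<close> from the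
  right, it becomes the relation for \<open>N W\<close>, because the relation for \<open>W\<close> is known.\<close>

lemma conjugacy_step:
  assumes N: "invertible N" and W: "invertible W" and CX: "C ** X = mat 1"
    and prev: "W ** X ** cnj_mat W = X"
  shows "matrix_inv C ** cnj_mat N ** C = matrix_inv (N ** W) ** matrix_inv N ** (N ** W)
     \<longleftrightarrow> (N ** W) ** X ** cnj_mat (N ** W) = X"
proof -
  obtain N' where N': "N ** N' = mat 1" "N' ** N = mat 1" "matrix_inv N = N'"
    using inverse_pair[OF N] .
  obtain V where V: "(N ** W) ** V = mat 1" "V ** (N ** W) = mat 1" "matrix_inv (N ** W) = V"
    using inverse_pair[OF invertible_matrix_mult[OF N W]] .
  obtain W' where W': "W ** W' = mat 1" "W' ** W = mat 1"
    using inverse_pair[OF W] .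
  have XC: "X ** C = mat 1" using CX by (simp add: matrix_left_right_inverse)
  have C: "matrix_inv C = X" using CX by (rule matrix_inv_eq)
  note assoc = matrix_mul_assoc[symmetric]
  have cW: "cnj_mat W ** cnj_mat W' = mat 1" "cnj_mat W' ** cnj_mat W = mat 1"
    using W' by (simp_all flip: cnj_mat_mult add: cnj_mat_1)
  have rhs: "matrix_inv (N ** W) ** matrix_inv N ** (N ** W) = V ** W"
    unfolding V(3) N'(3) assoc by (simp only: inv_cancel[OF N'(2)])
  have "matrix_inv C ** cnj_mat N ** C = V ** W
      \<longleftrightarrow> (N ** W) ** X ** cnj_mat N = W ** X" (is "?a \<longleftrightarrow> ?b")
  proof
    assume ?a
    then have "(N ** W) ** ((X ** cnj_mat N ** C) ** X) = (N ** W) ** ((V ** W) ** X)"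
      unfolding C by simp
    moreover have "(N ** W) ** ((X ** cnj_mat N ** C) ** X) = (N ** W) ** X ** cnj_mat N"
      by (simp only: assoc CX matrix_mul_rid)
    moreover have "(N ** W) ** ((V ** W) ** X) = W ** X"
      by (simp only: matrix_mul_assoc[of "N ** W"] matrix_mul_assoc[of "N ** W" V] V(1) matrix_mul_lid)
    ultimately show ?b by simp
  next
    assume ?b
    then have "V ** (((N ** W) ** X ** cnj_mat N) ** C) = V ** ((W ** X) ** C)" by simp
    moreover have "V ** (((N ** W) ** X ** cnj_mat N) ** C) = X ** cnj_mat N ** C"
      by (simp only: assoc inv_cancel[OF V(2), unfolded assoc])
    moreover have "V ** ((W ** X) ** C) = V ** W"
      by (simp only: assoc XC matrix_mul_rid)
    ultimately show ?a unfolding C by simp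
  qed
  also have "?b \<longleftrightarrow> (N ** W) ** X ** cnj_mat (N ** W) = X" (is "_ \<longleftrightarrow> ?c")
  proof
    assume ?b
    then have "((N ** W) ** X ** cnj_mat N) ** cnj_mat W = (W ** X) ** cnj_mat W" by simp
    then show ?c unfolding prev cnj_mat_mult by (simp only: assoc)
  next
    assume ?c
    then have "((N ** W) ** X ** cnj_mat (N ** W)) ** cnj_mat W'
        = (W ** X ** cnj_mat W) ** cnj_mat W'" unfolding prev by simp
    then show ?b by (simp only: cnj_mat_mult assoc cW matrix_mul_rid)
  qed
  finally show ?thesis unfolding rhs .
qed

lemma conjugation_iff_conj_intertwiner:
  assumes N: "\<And>i. i \<in> {1..m} \<Longrightarrow> invertible (N i)"
  shows "(\<exists>C. invertible C \<and> (\<forall>j\<in>{1..m}. matrix_inv C ** cnj_mat (N j) ** C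
             = matrix_inv (rprod N j) ** matrix_inv (N j) ** rprod N j))
     \<longleftrightarrow> (\<exists>X. conj_intertwiner N m X)" (is "(\<exists>C. invertible C \<and> ?conj C) \<longleftrightarrow> _")
proof -
  have *: "?conj C \<longleftrightarrow> conj_intertwiner N m X" if CX: "C ** X = mat 1" for C X
  proof -
    have X: "invertible X"
      using CX unfolding invertible_def by (auto simp: matrix_left_right_inverse)
    let ?P = "\<lambda>j. rprod N j ** X ** cnj_mat (rprod N j) = X"
    have step: "matrix_inv C ** cnj_mat (N (Suc j)) ** C
        = matrix_inv (rprod N (Suc j)) ** matrix_inv (N (Suc j)) ** rprod N (Suc j)
        \<longleftrightarrow> ?P (Suc j)" if "Suc j \<le> m" "?P j" for j
      unfolding rprod.simps
      by (rule conjugacy_step[OF _ _ CX that(2)]) (use that N in \<open>auto intro!: rprod_invertible\<close>)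
    have P0: "?P 0" by (simp add: cnj_mat_1)
    have "?conj C \<longleftrightarrow> (\<forall>j\<le>m. ?P j)"
    proof
      assume conj: "?conj C"
      have "j \<le> m \<longrightarrow> ?P j" for j
      proof (induction j)
        case 0 show ?case using P0 by blast
      next
        case (Suc j)
        show ?case
        proof
          assume "Suc j \<le> m"
          with Suc conj show "?P (Suc j)" using step[of j] by auto
        qed
      qed
      then show "\<forall>j\<le>m. ?P j" by blast
    next
      assume P: "\<forall>j\<le>m. ?P j"
      show "?conj C"
      proof
        fix j assume j: "j \<in> {1..m}"
        then obtain i where "j = Suc i" by (cases j) auto
        then show "matrix_inv C ** cnj_mat (N j) ** C
             = matrix_inv (rprod N j) ** matrix_inv (N j) ** rprod N j"
          using step[of i] P j by auto
      qed
    qed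
    then show ?thesis unfolding conj_intertwiner_def using X by blast
  qed
  show ?thesis
  proof
    assume "\<exists>C. invertible C \<and> ?conj C"
    then obtain C where C: "invertible C" "?conj C" by blast
    obtain X where "C ** X = mat 1" using inverse_pair[OF C(1)] by metis
    with * C(2) show "\<exists>X. conj_intertwiner N m X" by blast
  next
    assume "\<exists>X. conj_intertwiner N m X"
    then obtain X where X: "conj_intertwiner N m X" by blast
    then obtain C where C: "C ** X = mat 1" "X ** C = mat 1"
      unfolding conj_intertwiner_def using inverse_pair by metis
    then have "invertible C" unfolding invertible_def by blast
    with * C(1) X show "\<exists>C. invertible C \<and> ?conj C" by blast
  qed
qed

text \<open>Condition C2 forces \<open>D\<^sub>j = W\<^sub>j D\<^sub>0\<close> with \<open>W\<^sub>j = M\<^sub>j \<cdots> M\<^sub>1\<close>; cancelling \<open>D\<^sub>0\<close> in the equality of the normalized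
  squares leaves the equation for \<open>G = D\<^sub>0\<close>.  Conversely \<open>D\<^sub>j = W\<^sub>j G\<close>, which is periodic in \<open>j\<close> because
  \<open>W\<^sub>n\<^sub>+\<^sub>3\<close> is the identity.\<close>

lemma condition_C2_iff:
  assumes M: "\<And>i. i \<in> {1..n+3} \<Longrightarrow> invertible (M i)" and last: "rprod M (n + 3) = mat 1"
  shows "condition_C2 n M \<longleftrightarrow> (\<exists>G. invertible G \<and>
     (\<forall>j\<le>n+3. rprod M j ** G ** rprod M j = smat (det (rprod M j)) G))"
proof
  assume "condition_C2 n M"
  then obtain D where D: "D 0 = D (n + 3)" "\<And>j. j \<in> {1..n+3} \<Longrightarrow> invertible (D j)"
    "\<And>j. j \<in> {1..n+3} \<Longrightarrow> M j = D j ** matrix_inv (D (j - 1))"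
    "\<And>i j. i \<in> {1..n+3} \<Longrightarrow> j \<in> {1..n+3} \<Longrightarrow> smat (1 / det (D i)) (D i ** D i) = smat (1 / det (D j)) (D j ** D j)"
    unfolding condition_C2_def by blast
  have inv: "invertible (D j)" if "j \<le> n + 3" for j
    using D(1) D(2)[of j] D(2)[of "n + 3"] that by (cases "j = 0") auto
  have DW: "j \<le> n + 3 \<longrightarrow> D j = rprod M j ** D 0" for j
  proof (induction j)
    case (Suc j)
    show ?case
    proof
      assume j: "Suc j \<le> n + 3"
      obtain E where E: "E ** D j = mat 1" "matrix_inv (D j) = E"
        using inverse_pair[OF inv[of j]] j by auto
      have "M (Suc j) ** D j = D (Suc j)"
        using D(3)[of "Suc j"] j by (simp add: E flip: matrix_mul_assoc)
      then show "D (Suc j) = rprod M (Suc j) ** D 0"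
        using Suc j by (simp flip: matrix_mul_assoc)
    qed
  qed simp
  obtain E where E: "D 0 ** E = mat 1" using inverse_pair[OF inv[of 0]] by auto
  have d0: "det (D 0) \<noteq> 0" using inv[of 0] by (simp add: invertible_det_nz)
  have "rprod M j ** D 0 ** rprod M j = smat (det (rprod M j)) (D 0)" if j: "j \<le> n + 3" for j
  proof (cases "j = 0")
    case True then show ?thesis by (simp add: smat_1)
  next
    case False
    let ?W = "rprod M j"
    have Dj: "D j = ?W ** D 0" using DW j by blast
    have dW: "det ?W \<noteq> 0"
      using rprod_invertible[of j M] M j by (auto simp: invertible_det_nz)
    have "smat (1 / det (D j)) (D j ** D j) = smat (1 / det (D 0)) (D 0 ** D 0)"
      using D(4)[of j "n + 3"] D(1) False j by simp
    then have "smat (1 / (det ?W * det (D 0))) (?W ** D 0 ** (?W ** D 0))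
        = smat (1 / det (D 0)) (D 0 ** D 0)"
      by (simp add: Dj det_mul)
    then have "smat (det ?W * det (D 0)) (smat (1 / (det ?W * det (D 0))) (?W ** D 0 ** (?W ** D 0)))
        = smat (det ?W * det (D 0)) (smat (1 / det (D 0)) (D 0 ** D 0))" by simp
    then have "?W ** D 0 ** (?W ** D 0) = smat (det ?W) (D 0 ** D 0)"
      using dW d0 by (simp add: smat_smat smat_1)
    then have "?W ** D 0 ** (?W ** D 0) ** E = smat (det ?W) (D 0 ** D 0) ** E" by simp
    then show ?thesis
      by (simp add: smat_mult_left E flip: matrix_mul_assoc)
  qed
  then show "\<exists>G. invertible G \<and>
     (\<forall>j\<le>n+3. rprod M j ** G ** rprod M j = smat (det (rprod M j)) G)"
    using inv[of 0] by blast
next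
  assume "\<exists>G. invertible G \<and> (\<forall>j\<le>n+3. rprod M j ** G ** rprod M j = smat (det (rprod M j)) G)"
  then obtain G where G: "invertible G"
    "\<And>j. j \<le> n+3 \<Longrightarrow> rprod M j ** G ** rprod M j = smat (det (rprod M j)) G" by blast
  define D where "D j = rprod M j ** G" for j
  have W: "invertible (rprod M j)" if "j \<le> n + 3" for j
    using that M by (intro rprod_invertible) auto
  have D: "invertible (D j)" if "j \<le> n + 3" for j
    unfolding D_def by (intro invertible_matrix_mult W that G)
  have "smat (1 / det (D j)) (D j ** D j) = smat (1 / det G) (G ** G)" if "j \<le> n + 3" for j
  proof -
    have "D j ** D j = (rprod M j ** G ** rprod M j) ** G"
      unfolding D_def by (simp add: matrix_mul_assoc)
    also have "\<dots> = smat (det (rprod M j)) (G ** G)" unfolding G(2)[OF that] smat_mult_left ..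
    finally show ?thesis
      using W[OF that] by (simp add: smat_smat D_def det_mul invertible_det_nz)
  qed
  moreover have "M j = D j ** matrix_inv (D (j - 1))" if j: "j \<in> {1..n+3}" for j
  proof -
    obtain i where i: "j = Suc i" using j by (cases j) auto
    obtain E where E: "D i ** E = mat 1" "matrix_inv (D i) = E"
      using inverse_pair[OF D[of i]] i j by auto
    have "D j = M j ** D i" by (simp add: D_def i matrix_mul_assoc)
    then show ?thesis using E i by (simp flip: matrix_mul_assoc)
  qed
  moreover have "D 0 = D (n + 3)" unfolding D_def last by simp
  ultimately show "condition_C2 n M"
    unfolding condition_C2_def using D by (intro exI[of _ D]) auto
qed

text \<open>In other words, \<open>cnj W\<close> is the conjugate of \<open>W / det W\<close> by \<open>J\<close>.  For unitary matrices this holds because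
  \<open>cnj W\<close> is the inverse transpose of \<open>W\<close>, and the inverse transpose of a \<open>2\<times>2\<close> matrix is its conjugate by
  a rotation, divided by the determinant.  For \<open>U(1,1)\<close> the matrix \<open>diag(1,-1)\<close> is absorbed in \<open>J\<close>.\<close>

definition conjugated_by :: "cmat2 \<Rightarrow> cmat2 \<Rightarrow> bool" where
  "conjugated_by J W \<longleftrightarrow> invertible W \<and> smat (det W) (cnj_mat W ** J) = J ** W"

lemma conjugated_by_mult:
  assumes "conjugated_by J V" "conjugated_by J W"
  shows "conjugated_by J (V ** W)"
proof -
  have "smat (det (V ** W)) (cnj_mat (V ** W) ** J)
      = smat (det V) (cnj_mat V ** smat (det W) (cnj_mat W ** J))"
    by (simp add: det_mul cnj_mat_mult smat_mult_right smat_smat matrix_mul_assoc)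
  also have "\<dots> = smat (det V) (cnj_mat V ** J) ** W"
    using assms(2) by (simp add: conjugated_by_def smat_mult_left matrix_mul_assoc)
  also have "\<dots> = J ** (V ** W)"
    using assms(1) by (simp add: conjugated_by_def matrix_mul_assoc)
  finally show ?thesis using assms by (simp add: conjugated_by_def invertible_matrix_mult)
qed

lemma U2_conjugated_by: "W \<in> U2 \<Longrightarrow> conjugated_by (mat2 0 1 (-1) 0) W"
  and U11_conjugated_by: "W \<in> U11 \<Longrightarrow> conjugated_by (mat2 0 1 1 0) W"
proof -
  obtain a b c d where W: "W = mat2 a b c d" by (metis mat2_eq_iff mat2_entry)
  {
    assume "W \<in> U2"
    then have e: "W ** transpose (cnj_mat W) = mat 1" by (simp add: U2_def)
    then have inv: "invertible W" unfolding invertible_def by (auto simp: matrix_left_right_inverse)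
    from e have "a * cnj a + b * cnj b = 1" "a * cnj c + b * cnj d = 0"
      "c * cnj a + d * cnj b = 0" "c * cnj c + d * cnj d = 1"
      by (simp_all add: W mat2_eq_iff mult_entry transpose_def)
    then have "(a * d - b * c) * cnj a = d" "(a * d - b * c) * cnj b = - c"
       "(a * d - b * c) * cnj c = - b" "(a * d - b * c) * cnj d = a"
      by algebra+
    with inv show "conjugated_by (mat2 0 1 (-1) 0) W"
      by (simp add: conjugated_by_def W mat2_eq_iff mult_entry det_2)
  next
    assume "W \<in> U11"
    then have e: "W ** mat2 1 0 0 (-1) ** transpose (cnj_mat W) = mat2 1 0 0 (-1)"
      by (simp add: U11_def)
    then have "det (W ** mat2 1 0 0 (-1) ** transpose (cnj_mat W)) = -1" by (simp add: det_2)
    then have inv: "invertible W" by (auto simp: invertible_det_nz det_mul)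
    from e have "a * cnj a - b * cnj b = 1" "a * cnj c - b * cnj d = 0"
      "c * cnj a - d * cnj b = 0" "c * cnj c - d * cnj d = - 1"
      by (simp_all add: W mat2_eq_iff mult_entry transpose_def)
    then have "(a * d - b * c) * cnj a = d" "(a * d - b * c) * cnj b = c"
       "(a * d - b * c) * cnj c = b" "(a * d - b * c) * cnj d = a"
      by algebra+
    with inv show "conjugated_by (mat2 0 1 1 0) W"
      by (simp add: conjugated_by_def W mat2_eq_iff mult_entry det_2)
  }
qed

lemma condition_C2_iff_conj_intertwiner:
  assumes U: "(\<forall>i\<in>{1..n+3}. M i \<in> U2) \<or> (\<forall>i\<in>{1..n+3}. M i \<in> U11)"
    and last: "rprod M (n + 3) = mat 1"
  shows "condition_C2 n M \<longleftrightarrow> (\<exists>X. conj_intertwiner M (n + 3) X)"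
proof -
  obtain J where J: "invertible J" "\<And>i. i \<in> {1..n+3} \<Longrightarrow> conjugated_by J (M i)"
  proof (cases "\<forall>i\<in>{1..n+3}. M i \<in> U2")
    case True
    then show ?thesis
      using that[of "mat2 0 1 (-1) 0"] U2_conjugated_by by (simp add: invertible_det_nz det_2)
  next
    case False
    have "invertible (mat2 0 1 1 0)" by (simp add: invertible_det_nz det_2)
    then show ?thesis using False U that[of "mat2 0 1 1 0"] U11_conjugated_by by blast
  qed
  have W: "j \<le> n + 3 \<longrightarrow> conjugated_by J (rprod M j)" for j
  proof (induction j)
    case 0
    show ?case by (simp add: conjugated_by_def cnj_mat_1 smat_1 invertible_det_nz)
  next
    case (Suc j)
    then show ?case using conjugated_by_mult[OF J(2)[of "Suc j"]] by auto
  qed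
  obtain J' where J': "J ** J' = mat 1" "J' ** J = mat 1" using inverse_pair[OF J(1)] .
  have *: "rprod M j ** X ** cnj_mat (rprod M j) = X \<longleftrightarrow>
      rprod M j ** (X ** J) ** rprod M j = smat (det (rprod M j)) (X ** J)" if "j \<le> n + 3" for j X
  proof -
    let ?W = "rprod M j"
    have d: "det ?W \<noteq> 0" and WJ: "J ** ?W = smat (det ?W) (cnj_mat ?W ** J)"
      using W that by (auto simp: conjugated_by_def invertible_det_nz)
    have "?W ** (X ** J) ** ?W = ?W ** X ** (J ** ?W)" by (simp add: matrix_mul_assoc)
    also have "\<dots> = smat (det ?W) (?W ** X ** cnj_mat ?W ** J)"
      unfolding WJ by (simp add: smat_mult_right matrix_mul_assoc)
    finally have e: "?W ** (X ** J) ** ?W = smat (det ?W) (?W ** X ** cnj_mat ?W ** J)" .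
    show ?thesis
    proof
      assume "?W ** X ** cnj_mat ?W = X"
      then show "?W ** (X ** J) ** ?W = smat (det ?W) (X ** J)" unfolding e by simp
    next
      assume "?W ** (X ** J) ** ?W = smat (det ?W) (X ** J)"
      then have "smat (1 / det ?W) (smat (det ?W) (?W ** X ** cnj_mat ?W ** J)) ** J'
          = smat (1 / det ?W) (smat (det ?W) (X ** J)) ** J'"
        unfolding e by simp
      then show "?W ** X ** cnj_mat ?W = X"
        using d by (simp add: smat_smat smat_1 J' flip: matrix_mul_assoc)
    qed
  qed
  have "condition_C2 n M \<longleftrightarrow> (\<exists>G. invertible G \<and>
     (\<forall>j\<le>n+3. rprod M j ** G ** rprod M j = smat (det (rprod M j)) G))"
    by (rule condition_C2_iff[OF _ last]) (use J(2) in \<open>auto simp: conjugated_by_def\<close>)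
  also have "\<dots> \<longleftrightarrow> (\<exists>X. conj_intertwiner M (n + 3) X)"
  proof
    assume "\<exists>G. invertible G \<and> (\<forall>j\<le>n+3. rprod M j ** G ** rprod M j = smat (det (rprod M j)) G)"
    then obtain G where G: "invertible G"
      "\<And>j. j \<le> n+3 \<Longrightarrow> rprod M j ** G ** rprod M j = smat (det (rprod M j)) G" by blast
    have GJ: "G ** J' ** J = G" by (simp add: J' flip: matrix_mul_assoc)
    have "invertible J'" unfolding invertible_def using J' by blast
    with G(1) have "invertible (G ** J')" by (rule invertible_matrix_mult)
    then have "conj_intertwiner M (n + 3) (G ** J')"
      unfolding conj_intertwiner_def using *[of _ "G ** J'"] G(2) by (simp add: GJ)
    then show "\<exists>X. conj_intertwiner M (n + 3) X" ..
  next
    assume "\<exists>X. conj_intertwiner M (n + 3) X"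
    then obtain X where "conj_intertwiner M (n + 3) X" ..
    then show "\<exists>G. invertible G \<and>
        (\<forall>j\<le>n+3. rprod M j ** G ** rprod M j = smat (det (rprod M j)) G)"
      unfolding conj_intertwiner_def using * invertible_matrix_mult[OF _ J(1)]
      by (intro exI[of _ "X ** J"]) auto
  qed
  finally show ?thesis .
qed

section \<open>Real residues up to a phase\<close>

text \<open>The quotient of the diagonal entries is \<open>exp (2 \<i> \<eta>)\<close>.  Conversely, it has modulus 1 as soon as one of the
  residues is not diagonal, by comparison of absolute values; if all residues are diagonal, every \<open>\<eta>\<close> will do.\<close>

lemma phase_form_iff_intertwiner:
  "phase_form UNIV n A \<longleftrightarrow> (\<exists>g1 g2. g1 \<noteq> 0 \<and> g2 \<noteq> 0 \<and>
     (\<forall>i\<in>{1..n+2}. A i ** mat2 g1 0 0 g2 = mat2 g1 0 0 g2 ** cnj_mat (A i)))"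
proof
  assume "phase_form UNIV n A"
  then obtain \<eta> :: real where \<eta>: "\<And>i. i \<in> {1..n+2} \<Longrightarrow> \<exists>a b c d :: real.
      A i = mat2 (of_real a) (of_real b * exp (\<i> * of_real \<eta>))
                 (of_real c * exp (- \<i> * of_real \<eta>)) (of_real d)"
    unfolding phase_form_def by blast
  define e where "e = exp (\<i> * complex_of_real \<eta>)"
  define e' where "e' = exp (- \<i> * complex_of_real \<eta>)"
  have e: "cnj e = e'" "cnj e' = e" "e * e' = 1"
    by (simp_all add: e_def e'_def exp_cnj flip: exp_add)
  have ee: "e' * e = 1" "e * (e' * x) = x" for x using e(3) by (simp_all flip: mult.assoc add: mult.commute)
  have "A i ** mat2 (e * e) 0 0 1 = mat2 (e * e) 0 0 1 ** cnj_mat (A i)" if "i \<in> {1..n+2}" for i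
  proof -
    from \<eta>[OF that] obtain a b c d :: real
      where "A i = mat2 (of_real a) (of_real b * e) (of_real c * e') (of_real d)"
      unfolding e_def[symmetric] e'_def[symmetric] by blast
    then show ?thesis by (simp add: mat2_eq_iff mult_entry e ee mult_ac)
  qed
  moreover have "e \<noteq> 0" by (simp add: e_def)
  ultimately show "\<exists>g1 g2. g1 \<noteq> 0 \<and> g2 \<noteq> 0 \<and>
     (\<forall>i\<in>{1..n+2}. A i ** mat2 g1 0 0 g2 = mat2 g1 0 0 g2 ** cnj_mat (A i))"
    by (intro exI[of _ "e * e"] exI[of _ 1]) auto
next
  assume "\<exists>g1 g2. g1 \<noteq> 0 \<and> g2 \<noteq> 0 \<and>
     (\<forall>i\<in>{1..n+2}. A i ** mat2 g1 0 0 g2 = mat2 g1 0 0 g2 ** cnj_mat (A i))"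
  then obtain g1 g2 where g: "g1 \<noteq> 0" "g2 \<noteq> 0"
    "\<And>i. i \<in> {1..n+2} \<Longrightarrow> A i ** mat2 g1 0 0 g2 = mat2 g1 0 0 g2 ** cnj_mat (A i)" by blast
  have ent: "A i $ 1 $ 1 = cnj (A i $ 1 $ 1)" "A i $ 2 $ 2 = cnj (A i $ 2 $ 2)"
    "A i $ 1 $ 2 * g2 = g1 * cnj (A i $ 1 $ 2)" "A i $ 2 $ 1 * g1 = g2 * cnj (A i $ 2 $ 1)"
    if "i \<in> {1..n+2}" for i
    using g(1,2) g(3)[OF that] by (simp_all add: mat2_eq_iff mult_entry)
  obtain \<eta> :: real where \<eta>: "\<And>i. i \<in> {1..n+2} \<Longrightarrow>
      A i $ 1 $ 2 * exp (- \<i> * of_real \<eta>) \<in> \<real> \<and> A i $ 2 $ 1 * exp (\<i> * of_real \<eta>) \<in> \<real>"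
  proof (cases "\<forall>i\<in>{1..n+2}. A i $ 1 $ 2 = 0 \<and> A i $ 2 $ 1 = 0")
    case True
    then show ?thesis using that[of 0] by simp
  next
    case False
    have "cmod g1 = cmod g2"
    proof -
      obtain i where i: "i \<in> {1..n+2}" "A i $ 1 $ 2 \<noteq> 0 \<or> A i $ 2 $ 1 \<noteq> 0" using False by blast
      have "cmod (A i $ 1 $ 2) * cmod g2 = cmod g1 * cmod (A i $ 1 $ 2)"
        using arg_cong[OF ent(3)[OF i(1)], of cmod] by (simp add: norm_mult)
      moreover have "cmod (A i $ 2 $ 1) * cmod g1 = cmod g2 * cmod (A i $ 2 $ 1)"
        using arg_cong[OF ent(4)[OF i(1)], of cmod] by (simp add: norm_mult)
      ultimately show ?thesis using i(2) by auto
    qed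
    then have "cmod (g1 / g2) = 1" using g by (simp add: norm_divide)
    then obtain \<tau> where \<tau>: "g1 / g2 = exp (\<i> * of_real \<tau>)"
      by (metis complex_norm_eq_1_exp)
    define e where "e = exp (\<i> * complex_of_real (\<tau> / 2))"
    define e' where "e' = exp (- \<i> * complex_of_real (\<tau> / 2))"
    have e: "cnj e = e'" "cnj e' = e" "e * e' = 1"
      by (simp_all add: e_def e'_def exp_cnj flip: exp_add)
    have "e * e = g1 / g2" unfolding \<tau> e_def by (simp flip: exp_add)
    then have g1: "g1 = e * e * g2" using g by simp
    show ?thesis
    proof (rule that[of "\<tau> / 2"])
      fix i assume i: "i \<in> {1..n+2}"
      let ?b = "A i $ 1 $ 2" and ?c = "A i $ 2 $ 1"
      have "?b * g2 = e * e * cnj ?b * g2"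
        using ent(3)[OF i, unfolded g1] by (simp only: mult_ac)
      then have "?b = e * e * cnj ?b" using g(2) by (simp only: mult_cancel_right) simp
      then have "?b * e' = e * (e * e') * cnj ?b" by (metis mult.assoc mult.commute)
      then have "?b * e' = e * cnj ?b" by (simp only: e(3) mult_1_right)
      moreover have "cnj (?b * e') = e * cnj ?b" by (simp only: complex_cnj_mult e mult.commute)
      ultimately have real_b: "?b * e' \<in> \<real>" by (metis Reals_cnj_iff)
      have "?c * (e * e) * g2 = cnj ?c * g2"
        using ent(4)[OF i, unfolded g1] by (simp only: mult_ac)
      then have "?c * (e * e) = cnj ?c" using g(2) by (simp only: mult_cancel_right) simp
      then have "?c * e * (e * e') = cnj ?c * e'" by (metis mult.assoc)
      then have "?c * e = cnj ?c * e'" by (simp only: e(3) mult_1_right)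
      moreover have "cnj (?c * e) = cnj ?c * e'" by (simp only: complex_cnj_mult e)
      ultimately have "?c * e \<in> \<real>" by (metis Reals_cnj_iff)
      with real_b show "?b * exp (- \<i> * of_real (\<tau> / 2)) \<in> \<real> \<and> ?c * exp (\<i> * of_real (\<tau> / 2)) \<in> \<real>"
        unfolding e_def[symmetric] e'_def[symmetric] by blast
    qed
  qed
  define e where "e = exp (\<i> * complex_of_real \<eta>)"
  define e' where "e' = exp (- \<i> * complex_of_real \<eta>)"
  have ee: "e * e' = 1" "e' * e = 1" by (simp_all add: e_def e'_def flip: exp_add)
  have "\<exists>a b c d :: real. A i = mat2 (of_real a) (of_real b * e) (of_real c * e') (of_real d)"
    if i: "i \<in> {1..n+2}" for i
  proof -
    obtain a d where "A i $ 1 $ 1 = of_real a" "A i $ 2 $ 2 = of_real d"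
      using ent(1,2)[OF i] by (metis Reals_cnj_iff Reals_cases)
    moreover obtain b c where "A i $ 1 $ 2 * e' = of_real b" "A i $ 2 $ 1 * e = of_real c"
      using \<eta>[OF i] unfolding e_def e'_def by (metis Reals_cases)
    then have "A i $ 1 $ 2 = of_real b * e" "A i $ 2 $ 1 = of_real c * e'"
      using ee by (metis mult.assoc mult.right_neutral)+
    ultimately show ?thesis by (metis mat2_eq_iff mat2_entry)
  qed
  then show "phase_form UNIV n A" unfolding phase_form_def e_def e'_def by blast
qed

section \<open>Reality of the associated equation\<close>

text \<open>The derivative of \<open>fuchs\<close>, as a rational function.\<close>

definition dfuchs :: "nat \<Rightarrow> (nat \<Rightarrow> real) \<Rightarrow> (nat \<Rightarrow> cmat2) \<Rightarrow> complex \<Rightarrow> cmat2" where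
  "dfuchs n t A x = (\<chi> j k. \<Sum>i=1..n+2. - A i $ j $ k / (x - complex_of_real (t i))\<^sup>2)"

lemma mderiv_fuchs:
  assumes "x \<notin> sing n t"
  shows "mderiv (fuchs n t A) (dfuchs n t A x) x"
  unfolding mderiv_def fuchs_entry dfuchs_def vec_lambda_beta
proof (intro allI DERIV_sum)
  fix j k i assume "i \<in> {1..n + 2}"
  then have "x - complex_of_real (t i) \<noteq> 0" using assms by (auto simp: sing_def)
  then show "((\<lambda>x. A i $ j $ k / (x - complex_of_real (t i))) has_field_derivative
      - A i $ j $ k / (x - complex_of_real (t i))\<^sup>2) (at x)"
    by (auto intro!: derivative_eq_intros simp: power2_eq_square)
qed

lemma deriv_fuchs:
  "x \<notin> sing n t \<Longrightarrow> deriv (\<lambda>z. fuchs n t A z $ j $ k) x = dfuchs n t A x $ j $ k"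
  using mderiv_fuchs[of x n t A] by (auto simp: mderiv_def intro!: DERIV_imp_deriv)

lemma fuchs_cnj: "fuchs n t (\<lambda>i. cnj_mat (A i)) x = cnj_mat (fuchs n t A (cnj x))"
  unfolding vec_eq_iff fuchs_entry cnj_mat_entry cnj_sum
  by (intro allI sum.cong) simp_all

lemma dfuchs_cnj: "dfuchs n t (\<lambda>i. cnj_mat (A i)) x = cnj_mat (dfuchs n t A (cnj x))"
  unfolding vec_eq_iff dfuchs_def vec_lambda_beta cnj_mat_entry cnj_sum
  by (intro allI sum.cong) simp_all

lemma dfuchs_mult_const: "dfuchs n t A x ** K = dfuchs n t (\<lambda>i. A i ** K) x"
  unfolding vec_eq_iff mult_entry dfuchs_def vec_lambda_beta sum_distrib_right sum.distrib[symmetric]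
  by (intro allI sum.cong) (simp_all add: add_divide_distrib diff_divide_distrib)

lemma dfuchs_const_mult: "K ** dfuchs n t A x = dfuchs n t (\<lambda>i. K ** A i) x"
  unfolding vec_eq_iff mult_entry dfuchs_def vec_lambda_beta sum_distrib_left sum.distrib[symmetric]
  by (intro allI sum.cong) (simp_all add: add_divide_distrib diff_divide_distrib)

lemma fuchs_holo: "mholo (fuchs n t A) (- sing n t)"
  by (rule mholo_I_mderiv[OF _ mderiv_fuchs]) (auto simp: finite_sing finite_imp_closed open_Compl)

lemma dfuchs_holo: "mholo (dfuchs n t A) (- sing n t)"
  unfolding mholo_def dfuchs_def vec_lambda_beta
  by (intro allI holomorphic_intros) (auto simp: sing_def)

lemma fuchs_cong: "(\<And>i. i \<in> {1..n+2} \<Longrightarrow> A i = B i) \<Longrightarrow> fuchs n t A x = fuchs n t B x"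
  unfolding fuchs_def by (intro sum.cong) auto

lemma dfuchs_cong: "(\<And>i. i \<in> {1..n+2} \<Longrightarrow> A i = B i) \<Longrightarrow> dfuchs n t A x = dfuchs n t B x"
  unfolding dfuchs_def vec_eq_iff vec_lambda_beta by (intro allI sum.cong) auto

text \<open>Multiplied by the product of all \<open>x - t\<^sub>i\<close>, an entry becomes a nonzero polynomial.\<close>

lemma finite_zeros_fuchs:
  assumes "x \<notin> sing n t" "fuchs n t A x $ j $ k \<noteq> 0"
  shows "finite {x. x \<notin> sing n t \<and> fuchs n t A x $ j $ k = 0}"
proof -
  define D where "D = (\<Prod>i=1..n+2. [:- complex_of_real (t i), 1:])"
  define N where "N = (\<Sum>i=1..n+2. smult (A i $ j $ k)
      (\<Prod>l\<in>{1..n+2} - {i}. [:- complex_of_real (t l), 1:]))"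
  have N: "poly N x = fuchs n t A x $ j $ k * poly D x" if "x \<notin> sing n t" for x
  proof -
    have "poly N x = (\<Sum>i=1..n+2. A i $ j $ k / (x - complex_of_real (t i)) * poly D x)"
      unfolding N_def poly_sum
    proof (intro sum.cong refl)
      fix i assume i: "i \<in> {1..n+2}"
      then have "x - complex_of_real (t i) \<noteq> 0" using that by (auto simp: sing_def)
      moreover have "poly D x = (x - complex_of_real (t i)) *
          poly (\<Prod>l\<in>{1..n+2} - {i}. [:- complex_of_real (t l), 1:]) x"
        unfolding D_def by (subst prod.remove[OF _ i]) (simp_all add: algebra_simps)
      ultimately show "poly (smult (A i $ j $ k) (\<Prod>l\<in>{1..n+2} - {i}. [:- complex_of_real (t l), 1:])) x
          = A i $ j $ k / (x - complex_of_real (t i)) * poly D x"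
        by simp
    qed
    then show ?thesis unfolding fuchs_entry sum_distrib_right .
  qed
  have "poly D x \<noteq> 0"
    using assms(1) unfolding D_def poly_prod by (auto simp: sing_def)
  then have "poly N x \<noteq> 0" using N[OF assms(1)] assms(2) by simp
  then have "finite {x. poly N x = 0}" by (intro poly_roots_finite) auto
  then show ?thesis by (rule finite_subset[rotated]) (use N in auto)
qed

lemma connected_complement_finite: "finite S \<Longrightarrow> connected (- (S :: complex set))"
  using connected_open_delete_finite[of "UNIV :: complex set" S] connected_UNIV
  by (simp add: Compl_eq_Diff_UNIV)

lemma real_point_outside:
  assumes "finite S"
  obtains r :: real where "complex_of_real r \<notin> S"
proof -
  have "\<not> range complex_of_real \<subseteq> S"
    using assms finite_imageD[of complex_of_real UNIV] finite_subset infinite_UNIV_char_0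
    by (auto simp: inj_on_def)
  then show ?thesis using that by blast
qed

lemma zero_on_reals_imp_zero:
  assumes S: "finite S" and f: "f holomorphic_on - S"
    and zero: "\<And>x::real. complex_of_real x \<notin> S \<Longrightarrow> f (complex_of_real x) = 0" and w: "w \<notin> S"
  shows "f w = 0"
proof -
  obtain r where r: "complex_of_real r \<notin> S" using real_point_outside[OF S] .
  let ?U = "range complex_of_real - S"
  have "complex_of_real r islimpt range complex_of_real"
    unfolding islimpt_approachable
  proof (intro allI impI)
    fix e :: real assume "e > 0"
    then show "\<exists>x'\<in>range complex_of_real. x' \<noteq> complex_of_real r \<and> dist x' (complex_of_real r) < e"
      by (intro bexI[of _ "complex_of_real (r + e / 2)"] rangeI) (simp add: dist_norm)
  qed
  then have "complex_of_real r islimpt (S \<union> ?U)" by (rule islimpt_subset) auto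
  then have lim: "complex_of_real r islimpt ?U" using islimpt_Un_finite[OF S] by blast
  have conn: "connected (- S)" using S by (rule connected_complement_finite)
  show ?thesis
    by (rule analytic_continuation[OF f _ conn _ _ lim])
       (use S r zero w in \<open>auto simp: finite_imp_closed open_Compl\<close>)
qed

text \<open>The eigenvalues being real or conjugate to each other, the conjugate residues have the same eigenvalues;
  the matrix at infinity is its own conjugate.\<close>

locale real_exponents =
  fixes n :: nat and t :: "nat \<Rightarrow> real" and A :: "nat \<Rightarrow> cmat2" and \<theta>p \<theta>m :: "nat \<Rightarrow> complex"
  assumes inj_t: "inj_on t {1..n+2}"
    and eigenvalues: "\<And>i z. i \<in> {1..n+2} \<Longrightarrow> det (mat z - A i) = (z - \<theta>p i) * (z - \<theta>m i)"
    and normalized: "- (\<Sum>i=1..n+2. A i) = mat2 (\<theta>p (n + 3)) 0 0 (\<theta>m (n + 3))"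
    and nonres: "\<And>i. i \<in> {1..n+3} \<Longrightarrow> \<theta>p i - \<theta>m i \<notin> \<int>"
    and real_eig: "\<And>i. i \<in> {1..n+2} \<Longrightarrow> (\<theta>p i \<in> \<real> \<and> \<theta>m i \<in> \<real>) \<or> \<theta>m i = cnj (\<theta>p i)"
    and real_inf: "\<theta>p (n + 3) \<in> \<real>" "\<theta>m (n + 3) \<in> \<real>"
begin

abbreviation "cA \<equiv> \<lambda>i. cnj_mat (A i)"

lemma cnj_eigenvalues:
  assumes "i \<in> {1..n+2}"
  shows "det (mat z - cA i) = (z - \<theta>p i) * (z - \<theta>m i)"
proof -
  have "det (mat z - cA i) = cnj (det (mat (cnj z) - A i))" by (simp add: det_2)
  also have "\<dots> = (z - cnj (\<theta>p i)) * (z - cnj (\<theta>m i))"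
    unfolding eigenvalues[OF assms] by simp
  also have "\<dots> = (z - \<theta>p i) * (z - \<theta>m i)"
    using real_eig[OF assms] by (auto simp: Reals_cnj_iff mult.commute)
  finally show ?thesis .
qed

lemma cnj_normalized: "- (\<Sum>i=1..n+2. cA i) = mat2 (\<theta>p (n + 3)) 0 0 (\<theta>m (n + 3))"
proof -
  have "- (\<Sum>i=1..n+2. cA i) = cnj_mat (- (\<Sum>i=1..n+2. A i))"
    unfolding vec_eq_iff vector_uminus_component sum_component cnj_mat_entry complex_cnj_minus cnj_sum
    by blast
  then show ?thesis
    unfolding normalized using real_inf by (simp add: mat2_eq_iff Reals_cnj_iff)
qed

lemma trace_cnj:
  assumes "x \<notin> sing n t"
  shows "fuchs n t A x $ 1 $ 1 + fuchs n t A x $ 2 $ 2 = fuchs n t cA x $ 1 $ 1 + fuchs n t cA x $ 2 $ 2"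
  unfolding fuchs_entry sum.distrib[symmetric] add_divide_distrib[symmetric]
  using char_poly_trace_det(1)[OF eigenvalues] char_poly_trace_det(1)[OF cnj_eigenvalues]
  by (intro sum.cong) simp_all

theorem phase_form_if_conjugate_intertwiner:
  assumes S: "finite S" "sing n t \<subseteq> S"
    and G: "\<And>x. x \<notin> S \<Longrightarrow> mderiv G (fuchs n t A x ** G x - G x ** fuchs n t cA x) x"
    and inv: "x0 \<notin> S" "invertible (G x0)"
  shows "phase_form UNIV n A"
proof -
  obtain g1 g2 where g: "\<And>x. x \<notin> S \<Longrightarrow> G x = mat2 g1 0 0 g2"
    "\<And>i. i \<in> {1..n+2} \<Longrightarrow> A i ** mat2 g1 0 0 g2 = mat2 g1 0 0 g2 ** cA i"
    by (rule intertwiner_constant_diagonal[OF inj_t S G eigenvalues cnj_eigenvalues _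
          normalized cnj_normalized]) (use nonres in auto)
  have "invertible (mat2 g1 0 0 g2)" using inv g(1) by simp
  then have "g1 \<noteq> 0" "g2 \<noteq> 0" by (auto simp: invertible_det_nz det_2)
  then show ?thesis using g(2) unfolding phase_form_iff_intertwiner by blast
qed

lemma real_equation_if_phase_form:
  assumes "phase_form UNIV n A"
  shows "real_equation n t A"
  unfolding real_equation_def
proof (intro allI impI)
  obtain g1 g2 where g: "g1 \<noteq> 0" "g2 \<noteq> 0"
    "\<And>i. i \<in> {1..n+2} \<Longrightarrow> A i ** mat2 g1 0 0 g2 = mat2 g1 0 0 g2 ** cA i"
    using assms unfolding phase_form_iff_intertwiner by blast
  fix r :: real
  define x where "x = complex_of_real r"
  assume "complex_of_real r \<notin> sing n t \<and> fuchs n t A (complex_of_real r) $ 1 $ 2 \<noteq> 0"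
  then have x: "x \<notin> sing n t" "fuchs n t A x $ 1 $ 2 \<noteq> 0" by (simp_all add: x_def)
  have cx: "cnj x = x" by (simp add: x_def)
  have "fuchs n t A x ** mat2 g1 0 0 g2 = mat2 g1 0 0 g2 ** fuchs n t cA x"
    unfolding fuchs_mult_const fuchs_const_mult by (rule fuchs_cong) (rule g(3))
  then have F: "fuchs n t A x ** mat2 g1 0 0 g2 = mat2 g1 0 0 g2 ** cnj_mat (fuchs n t A x)"
    unfolding fuchs_cnj cx .
  have "dfuchs n t A x ** mat2 g1 0 0 g2 = mat2 g1 0 0 g2 ** dfuchs n t cA x"
    unfolding dfuchs_mult_const dfuchs_const_mult by (rule dfuchs_cong) (rule g(3))
  then have D: "dfuchs n t A x ** mat2 g1 0 0 g2 = mat2 g1 0 0 g2 ** cnj_mat (dfuchs n t A x)"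
    unfolding dfuchs_cnj cx .
  obtain a b c d where abcd: "fuchs n t A x = mat2 a b c d" by (metis mat2_eq_iff mat2_entry)
  have e: "cnj a = a" "b * g2 = g1 * cnj b" "c * g1 = g2 * cnj c" "cnj d = d"
    using F g(1,2) unfolding abcd by (simp_all add: mat2_eq_iff mult_entry)
  let ?da = "dfuchs n t A x $ 1 $ 1" and ?db = "dfuchs n t A x $ 1 $ 2"
  have e': "cnj ?da = ?da" "?db * g2 = g1 * cnj ?db"
    using D g(1,2) by (simp_all add: mat2_eq_iff mult_entry)
  have b0: "b \<noteq> 0" using x(2) by (simp add: abcd)
  have r1: "cnj (?db / b) = ?db / b"
  proof -
    have "?db * g2 * (g1 * cnj b) = g1 * cnj ?db * (b * g2)" using e(2) e'(2) by simp
    then have "(g1 * g2) * (?db * cnj b) = (g1 * g2) * (cnj ?db * b)" by (simp only: mult_ac)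
    then have "?db * cnj b = cnj ?db * b" using g by (simp only: mult_cancel_left) simp
    then show ?thesis using b0 by (simp add: field_simps)
  qed
  have r2: "cnj (b * c) = b * c"
  proof -
    have "b * g2 * (c * g1) = g1 * cnj b * (g2 * cnj c)" using e(2,3) by simp
    then have "(g1 * g2) * (b * c) = (g1 * g2) * (cnj b * cnj c)" by (simp only: mult_ac)
    then show ?thesis using g by simp
  qed
  have p: "coeff_p n t A x = - (?db / b) - (a + d)"
    unfolding coeff_p_def deriv_fuchs[OF x(1)] by (simp add: trace_def sum_2 abcd)
  have q: "coeff_q n t A x = - ?da + a * (?db / b) + (a * d - b * c)"
    unfolding coeff_q_def deriv_fuchs[OF x(1)] by (simp add: det_2 abcd)
  have "cnj (coeff_p n t A x) = coeff_p n t A x"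
    unfolding p complex_cnj_diff complex_cnj_minus complex_cnj_add r1 e ..
  moreover have "cnj (coeff_q n t A x) = coeff_q n t A x"
    unfolding q complex_cnj_diff complex_cnj_minus complex_cnj_add complex_cnj_mult[of a] r1 r2 e e'(1) ..
  ultimately show "coeff_p n t A (complex_of_real r) \<in> \<real> \<and> coeff_q n t A (complex_of_real r) \<in> \<real>"
    unfolding x_def[symmetric] Reals_cnj_iff by blast
qed

text \<open>
  Let \<open>a, b, c, d\<close> be the entries of \<open>A(x)\<close> and \<open>a\<^sub>B, b\<^sub>B, c\<^sub>B, d\<^sub>B\<close> those of \<open>B(x) = cnj (A (cnj x))\<close>.  As \<open>p\<close> is
  real and the traces agree, \<open>b\<close> and \<open>b\<^sub>B\<close> have the same logarithmic derivative, hence \<open>b\<^sub>B = \<kappa> b\<close> with a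
  constant \<open>\<kappa>\<close>.  A solution of \<open>A\<close> with first component \<open>y\<close> has the second component \<open>(y' - a y) / b\<close>, and one of
  \<open>B\<close> has \<open>(y' - a\<^sub>B y) / (\<kappa> b)\<close>, where \<open>y\<close> runs through the solutions of the same equation.  The matrix with
  rows \<open>(1, 0)\<close> and \<open>(w, \<kappa>)\<close>, where \<open>w = (a\<^sub>B - a) / b\<close>, therefore carries solutions of \<open>B\<close> to solutions of \<open>A\<close>.
  That it satisfies \<open>G' = A G - G B\<close> is checked directly; the lower left entry of this equation
  is the equality of the two coefficients \<open>q\<close>.
\<close>

lemma phase_form_if_real_equation:
  assumes nz: "A12_nonzero n t A" and real: "real_equation n t A"
  shows "phase_form UNIV n A"
proof -
  define S where "S = sing n t \<union> {x. x \<notin> sing n t \<and> fuchs n t A x $ 1 $ 2 = 0}"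
  have S: "finite S" "sing n t \<subseteq> S"
    using nz finite_zeros_fuchs finite_sing unfolding S_def A12_nonzero_def by blast+
  have oS: "open (- S)" using S(1) by (simp add: finite_imp_closed open_Compl)
  have notS: "x \<notin> sing n t" "fuchs n t A x $ 1 $ 2 \<noteq> 0" if "x \<notin> S" for x
    using that unfolding S_def by blast+
  \<comment> \<open>\<open>f\<close> and \<open>h\<close> are the entries of the system and of its conjugate\<close>
  define f where "f j k x = fuchs n t A x $ j $ k" for j k x
  define f' where "f' j k x = dfuchs n t A x $ j $ k" for j k x
  define h where "h j k x = fuchs n t cA x $ j $ k" for j k x
  define h' where "h' j k x = dfuchs n t cA x $ j $ k" for j k x
  have real_pt: "h j k (complex_of_real x) = cnj (f j k (complex_of_real x))"
    "h' j k (complex_of_real x) = cnj (f' j k (complex_of_real x))" for j k x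
    by (simp_all add: h_def h'_def f_def f'_def fuchs_cnj dfuchs_cnj)
  have der: "(f j k has_field_derivative f' j k x) (at x)" "(h j k has_field_derivative h' j k x) (at x)"
    if "x \<notin> S" for j k x
    using mderiv_fuchs[OF notS(1)[OF that], of A] mderiv_fuchs[OF notS(1)[OF that], of cA]
    unfolding mderiv_def f_def f'_def h_def h'_def by blast+
  have holo: "f j k holomorphic_on - S" "f' j k holomorphic_on - S"
     "h j k holomorphic_on - S" "h' j k holomorphic_on - S" for j k
    using fuchs_holo[of n t A] fuchs_holo[of n t cA] dfuchs_holo[of n t A] dfuchs_holo[of n t cA] S(2)
    unfolding mholo_def f_def f'_def h_def h'_def
    by (meson Compl_subset_Compl_iff holomorphic_on_subset)+
  have f0: "f 1 2 x \<noteq> 0" if "x \<notin> S" for x using notS(2)[OF that] by (simp add: f_def)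
  have tr: "f 1 1 x + f 2 2 x = h 1 1 x + h 2 2 x" if "x \<notin> S" for x
    using trace_cnj[OF notS(1)[OF that]] by (simp add: f_def h_def)
  have p: "coeff_p n t A x = - f' 1 2 x / f 1 2 x - (f 1 1 x + f 2 2 x)" if "x \<notin> S" for x
    unfolding coeff_p_def deriv_fuchs[OF notS(1)[OF that]]
    by (simp add: trace_def sum_2 f_def f'_def)
  have q: "coeff_q n t A x = - f' 1 1 x + f 1 1 x * f' 1 2 x / f 1 2 x
      + (f 1 1 x * f 2 2 x - f 1 2 x * f 2 1 x)" if "x \<notin> S" for x
    unfolding coeff_q_def deriv_fuchs[OF notS(1)[OF that]]
    by (simp add: det_2 f_def f'_def)
  have real': "cnj (coeff_p n t A (complex_of_real r)) = coeff_p n t A (complex_of_real r)"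
    "cnj (coeff_q n t A (complex_of_real r)) = coeff_q n t A (complex_of_real r)"
    if "complex_of_real r \<notin> S" for r
    using real notS[OF that] unfolding real_equation_def Reals_cnj_iff by blast+
  have wronskian: "f' 1 2 x * h 1 2 x - f 1 2 x * h' 1 2 x = 0" if "x \<notin> S" for x
  proof (rule zero_on_reals_imp_zero[OF S(1) _ _ that])
    show "(\<lambda>x. f' 1 2 x * h 1 2 x - f 1 2 x * h' 1 2 x) holomorphic_on - S"
      by (intro holomorphic_intros holo)
    fix r :: real
    define x where "x = complex_of_real r"
    assume "complex_of_real r \<notin> S"
    then have x: "x \<notin> S" by (simp add: x_def)
    have "cnj (f 1 1 x + f 2 2 x) = f 1 1 x + f 2 2 x"
      using tr[OF x] real_pt(1)[of _ _ r, folded x_def] by simp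
    then have "cnj (f' 1 2 x / f 1 2 x) = f' 1 2 x / f 1 2 x"
      using real'(1)[of r, folded x_def, OF x] unfolding p[OF x] by simp
    then have "cnj (f' 1 2 x) * f 1 2 x = f' 1 2 x * cnj (f 1 2 x)"
      using f0[OF x] by (simp add: field_simps)
    then show "f' 1 2 x * h 1 2 x - f 1 2 x * h' 1 2 x = 0"
      using real_pt[of _ _ r, folded x_def] by (simp add: mult.commute)
  qed
  obtain c where c: "h 1 2 x = c * f 1 2 x" if "x \<notin> S" for x
  proof -
    have "((\<lambda>x. h 1 2 x / f 1 2 x) has_field_derivative 0) (at x)" if "x \<notin> S" for x
    proof -
      have "((\<lambda>x. h 1 2 x / f 1 2 x) has_field_derivative
          (h' 1 2 x * f 1 2 x - h 1 2 x * f' 1 2 x) / (f 1 2 x * f 1 2 x)) (at x)"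
        by (intro DERIV_divide der that f0)
      then show ?thesis using wronskian[OF that] by (simp add: mult.commute)
    qed
    then have d: "\<forall>x\<in>- S - {}. ((\<lambda>x. h 1 2 x / f 1 2 x) has_field_derivative 0) (at x)" by blast
    have conn: "connected (- S)" using S(1) by (rule connected_complement_finite)
    have "continuous_on (- S) (\<lambda>x. h 1 2 x / f 1 2 x)"
      using holo f0 by (intro holomorphic_on_imp_continuous_on holomorphic_intros) auto
    from DERIV_zero_connected_constant[OF conn oS _ this d]
    obtain c where c: "\<And>x. x \<in> - S \<Longrightarrow> h 1 2 x / f 1 2 x = c" by auto
    have "h 1 2 x = c * f 1 2 x" if "x \<notin> S" for x
      using f0[OF that] c[of x] that by (metis ComplI nonzero_divide_eq_eq)
    then show ?thesis by (rule that)
  qed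
  have c': "h' 1 2 x = c * f' 1 2 x" if "x \<notin> S" for x
  proof -
    have "f 1 2 x * (c * f' 1 2 x) = f 1 2 x * h' 1 2 x"
      using wronskian[OF that] c[OF that] by (simp add: algebra_simps)
    then show ?thesis using f0[OF that] by simp
  qed
  \<comment> \<open>the difference of the two coefficients \<open>q\<close>, the logarithmic derivatives being equal\<close>
  define Q where "Q x = (- f' 1 1 x + f 1 1 x * f' 1 2 x / f 1 2 x
      + (f 1 1 x * f 2 2 x - f 1 2 x * f 2 1 x))
      - (- h' 1 1 x + h 1 1 x * f' 1 2 x / f 1 2 x
      + (h 1 1 x * h 2 2 x - h 1 2 x * h 2 1 x))" for x
  obtain r where r: "complex_of_real r \<notin> S"
    using real_point_outside[OF S(1)] .
  have c0: "c \<noteq> 0"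
    using c[OF r] real_pt(1)[of 1 2 r] f0[OF r] by auto
  have Q: "Q x = 0" if "x \<notin> S" for x
  proof (rule zero_on_reals_imp_zero[OF S(1) _ _ that])
    show "Q holomorphic_on - S"
      unfolding Q_def using f0 by (intro holomorphic_intros holo) auto
    fix r :: real
    define x where "x = complex_of_real r"
    assume "complex_of_real r \<notin> S"
    then have x: "x \<notin> S" by (simp add: x_def)
    have "cnj (f' 1 2 x) / cnj (f 1 2 x) = f' 1 2 x / f 1 2 x"
      using c[OF x] c'[OF x] c0 real_pt[of 1 2 r, folded x_def] by simp
    then have "cnj (coeff_q n t A x) = - h' 1 1 x + h 1 1 x * f' 1 2 x / f 1 2 x
      + (h 1 1 x * h 2 2 x - h 1 2 x * h 2 1 x)"
      unfolding q[OF x] using real_pt[of _ _ r, folded x_def]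
      by (simp flip: times_divide_eq_right)
    then show "Q x = 0"
      using real'(2)[of r, folded x_def, OF x] q[OF x] unfolding Q_def by simp
  qed
  define w where "w x = (h 1 1 x - f 1 1 x) / f 1 2 x" for x
  define G where "G x = mat2 1 0 (w x) c" for x
  have "mderiv G (fuchs n t A x ** G x - G x ** fuchs n t cA x) x" if x: "x \<notin> S" for x
  proof -
    have "(w has_field_derivative
       ((h' 1 1 x - f' 1 1 x) * f 1 2 x - (h 1 1 x - f 1 1 x) * f' 1 2 x) / (f 1 2 x * f 1 2 x)) (at x)"
      unfolding w_def by (intro DERIV_divide DERIV_diff der x f0)
    moreover have "((h' 1 1 x - f' 1 1 x) * f 1 2 x - (h 1 1 x - f 1 1 x) * f' 1 2 x) / (f 1 2 x * f 1 2 x)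
       = f 2 1 x + f 2 2 x * w x - (w x * h 1 1 x + c * h 2 1 x)"
    proof -
      have a: "h 1 1 x = f 1 1 x + w x * f 1 2 x" using f0[OF x] by (simp add: w_def)
      have d: "h 2 2 x = f 2 2 x - w x * f 1 2 x" using tr[OF x] a by (simp add: algebra_simps)
      have "h' 1 1 x - f' 1 1 x = (h 1 1 x - f 1 1 x) * (f' 1 2 x / f 1 2 x)
          + (h 1 1 x * h 2 2 x - h 1 2 x * h 2 1 x) - (f 1 1 x * f 2 2 x - f 1 2 x * f 2 1 x)"
        using Q[OF x] unfolding Q_def by (simp add: algebra_simps diff_divide_distrib)
      also have "\<dots> = w x * f' 1 2 x + (f 2 1 x + f 2 2 x * w x - (w x * h 1 1 x + c * h 2 1 x)) * f 1 2 x"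
        unfolding a d c[OF x] using f0[OF x] by (simp add: algebra_simps)
      finally have dh: "h' 1 1 x - f' 1 1 x = w x * f' 1 2 x
          + (f 2 1 x + f 2 2 x * w x - (w x * h 1 1 x + c * h 2 1 x)) * f 1 2 x" .
      have "h 1 1 x - f 1 1 x = w x * f 1 2 x" using a by simp
      then have "(h' 1 1 x - f' 1 1 x) * f 1 2 x - (h 1 1 x - f 1 1 x) * f' 1 2 x
          = (f 2 1 x + f 2 2 x * w x - (w x * h 1 1 x + c * h 2 1 x)) * (f 1 2 x * f 1 2 x)"
        unfolding dh by (simp only:) (simp add: algebra_simps)
      then show ?thesis using f0[OF x] by simp
    qed
    ultimately have dw: "(w has_field_derivative
        f 2 1 x + f 2 2 x * w x - (w x * h 1 1 x + c * h 2 1 x)) (at x)" by simp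
    have a: "h 1 1 x = f 1 1 x + w x * f 1 2 x" using f0[OF x] by (simp add: w_def)
    have d: "f 2 2 x = h 2 2 x + w x * f 1 2 x" using tr[OF x] a by (simp add: algebra_simps)
    have "fuchs n t A x ** G x - G x ** fuchs n t cA x =
        mat2 0 0 (f 2 1 x + f 2 2 x * w x - (w x * h 1 1 x + c * h 2 1 x)) 0"
      using a d c[OF x]
      by (simp add: mat2_eq_iff mult_entry G_def f_def h_def algebra_simps)
    then show ?thesis
      using dw by (simp add: mderiv_def forall_2 G_def)
  qed
  moreover have "invertible (G (complex_of_real r))"
    using c0 by (simp add: invertible_det_nz det_2 G_def)
  ultimately show ?thesis
    using phase_form_if_conjugate_intertwiner[OF S _ r, of G] by blast
qed

end

section \<open>Slit planes and loops\<close>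

text \<open>The two half-planes together with one interval between consecutive singularities.  It is starlike
  with respect to every point of the interval, and closed under conjugation.\<close>

definition slit_plane :: "nat \<Rightarrow> (nat \<Rightarrow> real) \<Rightarrow> nat \<Rightarrow> complex set" where
  "slit_plane n t j = {x. Im x \<noteq> 0 \<or> Re x \<in> gap n t j}"

lemma open_gap: "open (gap n t j)"
  by (simp add: gap_def)

lemma convex_gap: "convex (gap n t j)"
  by (simp add: gap_def)

lemma gap_last: "gap n t (n + 3) = gap n t 0"
  by (simp add: gap_def)

lemma open_slit_plane: "open (slit_plane n t j)"
proof -
  have "slit_plane n t j = Im -` (- {0}) \<union> Re -` gap n t j"
    unfolding slit_plane_def by auto
  moreover have "open (Im -` (- {0}))" "open (Re -` gap n t j)"
    by (intro open_vimage continuous_intros open_Compl open_gap; simp)+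
  ultimately show ?thesis by (metis open_Un)
qed

lemma slit_plane_star:
  assumes a: "a \<in> gap n t j" and x: "x \<in> slit_plane n t j"
  shows "closed_segment (complex_of_real a) x \<subseteq> slit_plane n t j"
proof
  fix w assume "w \<in> closed_segment (complex_of_real a) x"
  then obtain s where s: "0 \<le> s" "s \<le> 1" "w = (1 - s) *\<^sub>R complex_of_real a + s *\<^sub>R x"
    unfolding closed_segment_def by blast
  have w: "Im w = s * Im x" "Re w = (1 - s) * a + s * Re x" by (simp_all add: s(3))
  show "w \<in> slit_plane n t j"
  proof (cases "Im w = 0")
    case True
    then consider "s = 0" | "Im x = 0" using w(1) by auto
    then have "Re w \<in> gap n t j"
    proof cases
      case 1 then show ?thesis using a by (simp add: w(2))
    next
      case 2
      then have "Re x \<in> gap n t j" using x by (simp add: slit_plane_def)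
      then show ?thesis
        using convexD_alt[OF convex_gap a _ s(1,2)] by (simp add: w(2))
    qed
    then show ?thesis by (simp add: slit_plane_def)
  qed (simp add: slit_plane_def)
qed

lemma cnj_slit_plane: "cnj x \<in> slit_plane n t j \<longleftrightarrow> x \<in> slit_plane n t j"
  by (simp add: slit_plane_def)

text \<open>The germ is induced by \<open>f\<close> until the loop reaches the middle of its passage through the lower half-plane, and
  by \<open>g\<close> afterwards.\<close>

lemma continuation_along_gamma_loop:
  assumes loop: "gamma_loop n t x0 i \<gamma>"
    and f: "f holomorphic_on slit_plane n t (i - 1)" and g: "g holomorphic_on slit_plane n t i"
    and fg: "\<And>x. Im x < 0 \<Longrightarrow> f x = g x"
  shows "continues_along \<gamma> f g"
proof -
  obtain u v where uv: "0 < u" "u < v" "v < 1"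
    "\<gamma> u \<in> complex_of_real ` gap n t (i - 1)" "\<gamma> v \<in> complex_of_real ` gap n t i"
    "\<And>s. s \<in> {0..<u} \<union> {v<..1} \<Longrightarrow> Im (\<gamma> s) > 0" "\<And>s. s \<in> {u<..<v} \<Longrightarrow> Im (\<gamma> s) < 0"
    using loop unfolding gamma_loop_def by blast
  define m where "m = (u + v) / 2"
  have m: "u < m" "m < v" using uv by (simp_all add: m_def)
  have midpoint: "u < s \<and> s < v" if "\<bar>s - m\<bar> < m - u" for s
  proof -
    have "s - m < m - u" "- (s - m) < m - u" using that by (simp_all only: abs_less_iff)
    then show ?thesis by (simp add: m_def field_simps)
  qed
  have left: "\<gamma> s \<in> slit_plane n t (i - 1)" if "0 \<le> s" "s \<le> m" for s
  proof -
    consider "s < u" | "s = u" | "u < s" by linarith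
    then show ?thesis
    proof cases
      case 1 then show ?thesis using uv(6)[of s] that by (simp add: slit_plane_def)
    next
      case 2 then show ?thesis using uv(4) by (auto simp: slit_plane_def)
    next
      case 3 then show ?thesis using uv(7)[of s] that m by (simp add: slit_plane_def)
    qed
  qed
  have right: "\<gamma> s \<in> slit_plane n t i" if "m \<le> s" "s \<le> 1" for s
  proof -
    consider "s < v" | "s = v" | "v < s" by linarith
    then show ?thesis
    proof cases
      case 1 then show ?thesis using uv(7)[of s] that m by (simp add: slit_plane_def)
    next
      case 2 then show ?thesis using uv(5) by (auto simp: slit_plane_def)
    next
      case 3 then show ?thesis using uv(6)[of s] that by (simp add: slit_plane_def)
    qed
  qed
  define F where "F s = (if s < m then f else g)" for s
  show ?thesis
    unfolding continues_along_def
  proof (intro exI[of _ F] conjI ballI)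
    fix s :: real assume s: "s \<in> {0..1}"
    show "F s analytic_on {\<gamma> s}"
    proof (cases "s < m")
      case True
      then show ?thesis
        using left[of s] s analytic_on_subset[OF iffD2[OF analytic_on_open[OF open_slit_plane] f]]
        by (simp add: F_def)
    next
      case False
      then show ?thesis
        using right[of s] s analytic_on_subset[OF iffD2[OF analytic_on_open[OF open_slit_plane] g]]
        by (simp add: F_def)
    qed
    show "\<exists>d>0. \<forall>s'\<in>{0..1}. \<bar>s' - s\<bar> < d \<longrightarrow> (\<forall>\<^sub>F x in nhds (\<gamma> s'). F s' x = F s x)"
    proof (cases "s = m")
      case False
      show ?thesis
      proof (intro exI conjI ballI impI)
        show "\<bar>s - m\<bar> > 0" using False by simp
        fix s' assume "\<bar>s' - s\<bar> < \<bar>s - m\<bar>"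
        then have "s' < m \<longleftrightarrow> s < m" by linarith
        then show "\<forall>\<^sub>F x in nhds (\<gamma> s'). F s' x = F s x" by (simp add: F_def)
      qed
    next
      case True
      have "\<forall>\<^sub>F x in nhds (\<gamma> s'). F s' x = F s x" if "\<bar>s' - s\<bar> < m - u" for s'
      proof -
        have "s' \<in> {u<..<v}" using that True midpoint by simp
        then have "Im (\<gamma> s') < 0" by (rule uv(7))
        then have "\<forall>\<^sub>F x in nhds (\<gamma> s'). Im x < 0"
          unfolding eventually_nhds
          by (intro exI[of _ "{x. Im x < 0}"]) (auto simp: open_halfspace_Im_lt)
        then show ?thesis
          by eventually_elim (use fg in \<open>auto simp: F_def\<close>)
      qed
      then show ?thesis using m by (intro exI[of _ "m - u"]) auto
    qed
  next
    show "\<forall>\<^sub>F x in nhds (pathstart \<gamma>). F 0 x = f x" using m uv by (simp add: F_def)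
    show "\<forall>\<^sub>F x in nhds (pathfinish \<gamma>). F 1 x = g x" using m uv by (simp add: F_def)
  qed
qed

lemma continues_along_cong:
  assumes "continues_along \<gamma> f g" "\<forall>\<^sub>F x in nhds (pathstart \<gamma>). f x = f' x"
  shows "continues_along \<gamma> f' g"
proof -
  obtain F where F: "\<forall>s\<in>{0..1}. F s analytic_on {\<gamma> s}"
        "\<forall>s\<in>{0..1}. \<exists>d>0. \<forall>s'\<in>{0..1}. \<bar>s' - s\<bar> < d \<longrightarrow> (\<forall>\<^sub>F x in nhds (\<gamma> s'). F s' x = F s x)"
        "\<forall>\<^sub>F x in nhds (pathstart \<gamma>). F 0 x = f x" "\<forall>\<^sub>F x in nhds (pathfinish \<gamma>). F 1 x = g x"
    using assms(1) unfolding continues_along_def by blast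
  from F(3) assms(2) have "\<forall>\<^sub>F x in nhds (pathstart \<gamma>). F 0 x = f' x"
    by eventually_elim simp
  with F show ?thesis unfolding continues_along_def by blast
qed

text \<open>A quadrilateral through \<open>x0\<close>, \<open>a\<close>, \<open>-\<i>\<close> and \<open>b\<close>; in the parametrization of nested joins, the real axis is
  met at the times \<open>1/4\<close> and \<open>3/4\<close>.\<close>

lemma gamma_loop_exists:
  assumes x0: "Im x0 > 0" and a: "a \<in> gap n t (i - 1)" and b: "b \<in> gap n t i"
  obtains \<gamma> where "gamma_loop n t x0 i \<gamma>"
proof -
  let ?\<gamma> = "(linepath x0 (complex_of_real a) +++ linepath (complex_of_real a) (- \<i>)) +++
      (linepath (- \<i>) (complex_of_real b) +++ linepath (complex_of_real b) x0)"
  have \<gamma>: "?\<gamma> s = (if s \<le> 1/4 then linepath x0 (complex_of_real a) (4 * s)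
      else if s \<le> 1/2 then linepath (complex_of_real a) (- \<i>) (4 * s - 1)
      else if s \<le> 3/4 then linepath (- \<i>) (complex_of_real b) (4 * s - 2)
      else linepath (complex_of_real b) x0 (4 * s - 3))" for s
    by (auto simp: joinpaths_def)
  have cross: "?\<gamma> (1/4) \<in> complex_of_real ` gap n t (i - 1)" "?\<gamma> (3/4) \<in> complex_of_real ` gap n t i"
    unfolding \<gamma> using a b by (simp_all add: linepath_def)
  have up: "\<forall>s\<in>{0..<1/4} \<union> {3/4<..1}. Im (?\<gamma> s) > 0"
    unfolding \<gamma> using x0 by (auto simp: linepath_def)
  have down: "\<forall>s\<in>{1/4<..<3/4}. Im (?\<gamma> s) < 0"
    unfolding \<gamma> by (auto simp: linepath_def)
  have "0 < (1/4 :: real) \<and> (1/4 :: real) < 3/4 \<and> (3/4 :: real) < 1" by simp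
  then have "\<exists>u v. 0 < u \<and> u < v \<and> v < 1 \<and>
        ?\<gamma> u \<in> complex_of_real ` gap n t (i - 1) \<and>
        ?\<gamma> v \<in> complex_of_real ` gap n t i \<and>
        (\<forall>s\<in>{0..<u} \<union> {v<..1}. Im (?\<gamma> s) > 0) \<and>
        (\<forall>s\<in>{u<..<v}. Im (?\<gamma> s) < 0)"
    using cross up down by blast
  moreover have "path ?\<gamma>" "pathstart ?\<gamma> = x0" "pathfinish ?\<gamma> = x0"
    by (simp_all add: path_join_imp)
  ultimately have "gamma_loop n t x0 i ?\<gamma>"
    unfolding gamma_loop_def by blast
  then show ?thesis by (rule that)
qed

locale ordered_singularities =
  fixes n :: nat and t :: "nat \<Rightarrow> real"
  assumes mono_t: "strict_mono_on {1..n+2} t"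
begin

lemma t_le: "1 \<le> i \<Longrightarrow> i \<le> j \<Longrightarrow> j \<le> n + 2 \<Longrightarrow> t i \<le> t j"
  using strict_mono_on_leD[OF mono_t, of i j] by auto

lemma gap_upper: "j \<le> n + 1 \<Longrightarrow> x \<in> gap n t j \<Longrightarrow> x < t (j + 1)"
  by (auto simp: gap_def split: if_splits)

lemma gap_lower: "1 \<le> j \<Longrightarrow> j \<le> n + 2 \<Longrightarrow> x \<in> gap n t j \<Longrightarrow> t j < x"
  by (auto simp: gap_def split: if_splits)

lemma gap_nonempty:
  assumes "j \<le> n + 3"
  obtains a where "a \<in> gap n t j"
proof (cases "j = 0 \<or> j = n + 3")
  case True
  then show ?thesis using that[of "t 1 - 1"] by (auto simp: gap_def)
next
  case False
  show ?thesis
  proof (cases "j = n + 2")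
    case True
    then show ?thesis using that[of "t (n + 2) + 1"] by (auto simp: gap_def)
  next
    case j: False
    then have "t j < t (j + 1)"
      using False assms by (intro strict_mono_onD[OF mono_t]) auto
    then show ?thesis using that[of "(t j + t (j + 1)) / 2"] False j by (auto simp: gap_def)
  qed
qed

lemma gap_avoids:
  assumes "i \<in> {1..n+2}" "j \<le> n + 3"
  shows "t i \<notin> gap n t j"
proof -
  have *: "t i \<notin> gap n t j" if j: "j \<le> n + 2" for j
  proof
    assume g: "t i \<in> gap n t j"
    show False
    proof (cases "i \<le> j")
      case True
      then show False using gap_lower[OF _ j g] t_le[of i j] assms(1) j by auto
    next
      case False
      then show False using gap_upper[OF _ g] t_le[of "j + 1" i] assms(1) by auto
    qed
  qed
  show ?thesis
    using *[of j] *[of 0] gap_last[of n t] assms(2) by (cases "j = n + 3") auto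
qed

lemma gap_disjoint:
  assumes "x \<in> gap n t j" "x \<in> gap n t k" "j \<le> n + 2" "k \<le> n + 2"
  shows "j = k"
proof -
  have "\<not> j < k" if "x \<in> gap n t j" "x \<in> gap n t k" "j \<le> n + 2" "k \<le> n + 2" for j k
    using gap_upper[OF _ that(1)] gap_lower[OF _ that(4,2)] t_le[of "j + 1" k] that by auto
  from this[of j k] this[of k j] show ?thesis using assms by auto
qed

lemma gap_cover:
  assumes "x \<notin> t ` {1..n+2}"
  obtains j where "j \<le> n + 2" "x \<in> gap n t j"
proof (cases "\<exists>i\<in>{1..n+2}. t i < x")
  case False
  then have "x < t 1" using assms by (metis atLeastAtMost_iff image_eqI le_add2 linorder_neqE one_le_numeral order_refl order_trans)
  then show ?thesis using that[of 0] by (simp add: gap_def)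
next
  case True
  define K where "K = {i\<in>{1..n+2}. t i < x}"
  define j where "j = Max K"
  have "finite K" "K \<noteq> {}" using True by (auto simp: K_def)
  then have "j \<in> K" and max: "\<And>i. i \<in> K \<Longrightarrow> i \<le> j" by (simp_all add: j_def)
  then have j: "1 \<le> j" "j \<le> n + 2" "t j < x" by (auto simp: K_def)
  have "x < t (j + 1)" if "j \<noteq> n + 2"
  proof -
    have "j + 1 \<in> {1..n+2}" using j that by auto
    moreover have "j + 1 \<notin> K" using max[of "j + 1"] by auto
    ultimately show ?thesis using assms unfolding K_def by (auto simp: not_less le_less)
  qed
  then have "x \<in> gap n t j" using j by (auto simp: gap_def)
  then show ?thesis using that j by blast
qed

lemma slit_plane_avoids: "j \<le> n + 3 \<Longrightarrow> slit_plane n t j \<subseteq> - sing n t"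
  using gap_avoids by (auto simp: slit_plane_def sing_def)

lemma slit_plane_cover:
  assumes "x \<notin> sing n t"
  obtains j where "j \<le> n + 2" "x \<in> slit_plane n t j"
proof (cases "Im x = 0")
  case False
  then show ?thesis using that[of 0] by (simp add: slit_plane_def)
next
  case True
  then have "x = complex_of_real (Re x)" by (simp add: complex_eq_iff)
  then have "Re x \<notin> t ` {1..n+2}" using assms unfolding sing_def by auto
  then show ?thesis using gap_cover[of "Re x"] that by (auto simp: slit_plane_def)
qed

end

section \<open>Monodromy in terms of the two half-planes\<close>

lemma mderiv_cnj:
  assumes "mderiv F D (cnj x)"
  shows "mderiv (\<lambda>x. cnj_mat (F (cnj x))) (cnj_mat D) x"
  unfolding mderiv_def cnj_mat_entry
proof (intro allI)
  fix j k
  have "((\<lambda>z. F z $ j $ k) has_field_derivative D $ j $ k) (at (cnj x))"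
    using assms by (simp add: mderiv_def)
  then show "((\<lambda>x. cnj (F (cnj x) $ j $ k)) has_field_derivative cnj (D $ j $ k)) (at x)"
    using has_field_derivative_cnj_cnj[of "\<lambda>z. F z $ j $ k" "D $ j $ k" x] by (simp add: o_def)
qed

lemma det_cnj_mat: "det (cnj_mat M) = cnj (det M)"
  by (simp add: det_2)

lemma matrix_left_cancel:
  assumes "invertible (M :: cmat2)" "M ** X = M ** Y"
  shows "X = Y"
proof -
  obtain M' where "M' ** M = mat 1" using assms(1) unfolding invertible_def by blast
  then show ?thesis using assms(2) by (metis inv_cancel)
qed

lemma left_inverse_invertible: "(Z :: cmat2) ** Y = mat 1 \<Longrightarrow> invertible Y \<and> invertible Z"
  unfolding invertible_def using matrix_left_right_inverse[of Z Y] by auto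

lemma connected_half_planes: "connected {x. Im x > 0}" "connected {x. Im x < 0}"
  by (intro convex_connected convex_halfspace_Im_gt convex_halfspace_Im_lt)+

text \<open>\<open>Z j\<close> is the inverse of the fundamental matrix \<open>\<Phi> j\<close> on the \<open>j\<close>-th slit plane, and \<open>W j\<close> measures how the
  continuations through the intervals 0 and \<open>j\<close> differ in the lower half-plane.\<close>

definition half_plane_solutions ::
    "nat \<Rightarrow> (nat \<Rightarrow> real) \<Rightarrow> (nat \<Rightarrow> cmat2) \<Rightarrow> (nat \<Rightarrow> cmat2)
     \<Rightarrow> (nat \<Rightarrow> complex \<Rightarrow> cmat2) \<Rightarrow> (nat \<Rightarrow> complex \<Rightarrow> cmat2) \<Rightarrow> bool" where
  "half_plane_solutions n t A W \<Phi> Z \<longleftrightarrow>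
     (\<forall>j\<le>n+3. (\<forall>x\<in>slit_plane n t j. mderiv (\<Phi> j) (fuchs n t A x ** \<Phi> j x) x
          \<and> mderiv (Z j) (- (Z j x ** fuchs n t A x)) x \<and> Z j x ** \<Phi> j x = mat 1)
        \<and> (\<forall>x. Im x > 0 \<longrightarrow> \<Phi> j x = \<Phi> 0 x) \<and> (\<forall>x. Im x < 0 \<longrightarrow> \<Phi> 0 x = \<Phi> j x ** W j)
        \<and> invertible (W j))"

lemma half_plane_solutions_cong:
  assumes "\<And>j. j \<le> n + 3 \<Longrightarrow> W j = W' j" "half_plane_solutions n t A W \<Phi> Z"
  shows "half_plane_solutions n t A W' \<Phi> Z"
  using assms unfolding half_plane_solutions_def by metis

context ordered_singularities
begin

lemma slit_plane_connected:
  assumes "j \<le> n + 3"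
  shows "connected (slit_plane n t j)"
proof -
  obtain a where "a \<in> gap n t j" using gap_nonempty[OF assms] .
  then show ?thesis
    by (intro starlike_connected[of _ "complex_of_real a"] slit_plane_star) (auto simp: slit_plane_def)
qed

lemma fundamental_on_slit_plane:
  assumes j: "j \<le> n + 3"
  obtains \<Phi> Z where "\<And>x. x \<in> slit_plane n t j \<Longrightarrow> mderiv \<Phi> (fuchs n t A x ** \<Phi> x) x"
    "\<And>x. x \<in> slit_plane n t j \<Longrightarrow> mderiv Z (- (Z x ** fuchs n t A x)) x"
    "\<And>x. x \<in> slit_plane n t j \<Longrightarrow> Z x ** \<Phi> x = mat 1"
proof -
  obtain a where a: "a \<in> gap n t j" using gap_nonempty[OF j] .
  have "mholo (fuchs n t A) (slit_plane n t j)"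
    using fuchs_holo slit_plane_avoids[OF j] unfolding mholo_def
    by (meson holomorphic_on_subset)
  moreover have "complex_of_real a \<in> slit_plane n t j" using a by (simp add: slit_plane_def)
  ultimately show ?thesis
    using fundamental_solution[OF open_slit_plane _ slit_plane_star[OF a]] that by metis
qed

text \<open>On each slit plane some fundamental matrix exists, and it is multiplied by a constant to agree with \<open>Y\<close> near
  the base point.  The intervals 0 and \<open>n + 3\<close> are the same, which gives \<open>W\<^sub>n\<^sub>+\<^sub>3 = 1\<close>.\<close>

lemma half_plane_solutions_from_fundamental:
  assumes x0: "Im x0 > 0" and Y: "fundamental_at n t A x0 Y"
  obtains W \<Phi> Z where "half_plane_solutions n t A W \<Phi> Z" "W 0 = mat 1" "W (n + 3) = mat 1"
    "\<And>j. j \<le> n + 3 \<Longrightarrow> \<forall>\<^sub>F x in nhds x0. \<Phi> j x = Y x" "invertible (Y x0)"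
proof -
  obtain U where U: "open U" "x0 \<in> U" "\<And>x. x \<in> U \<Longrightarrow> invertible (Y x) \<and> mderiv Y (fuchs n t A x ** Y x) x"
    using Y unfolding fundamental_at_def eventually_nhds mderiv_def by blast
  have "open (U \<inter> {x. Im x > 0})" using U(1) by (intro open_Int open_halfspace_Im_gt)
  then obtain r where r: "r > 0" "ball x0 r \<subseteq> U \<inter> {x. Im x > 0}"
    using U(2) x0 open_contains_ball by blast
  have upper: "x \<in> slit_plane n t j" if "Im x > 0" for x j using that by (simp add: slit_plane_def)
  have lower: "x \<in> slit_plane n t j" if "Im x < 0" for x j using that by (simp add: slit_plane_def)
  have Y0: "invertible (Y x0)" using U by blast
  have "\<exists>\<Phi> Z. (\<forall>x\<in>slit_plane n t j. mderiv \<Phi> (fuchs n t A x ** \<Phi> x) x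
          \<and> mderiv Z (- (Z x ** fuchs n t A x)) x \<and> Z x ** \<Phi> x = mat 1)
        \<and> (\<forall>x\<in>ball x0 r. \<Phi> x = Y x)" if j: "j \<le> n + 3" for j
  proof -
    obtain \<Phi> Z where *: "\<And>x. x \<in> slit_plane n t j \<Longrightarrow> mderiv \<Phi> (fuchs n t A x ** \<Phi> x) x"
      "\<And>x. x \<in> slit_plane n t j \<Longrightarrow> mderiv Z (- (Z x ** fuchs n t A x)) x"
      "\<And>x. x \<in> slit_plane n t j \<Longrightarrow> Z x ** \<Phi> x = mat 1"
      using fundamental_on_slit_plane[OF j, of A] by blast
    have sub: "x \<in> slit_plane n t j" "x \<in> U" if "x \<in> ball x0 r" for x
      using r(2) that upper by auto
    obtain C where C: "\<And>x. x \<in> ball x0 r \<Longrightarrow> Y x = \<Phi> x ** C"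
      using solution_unique[of "ball x0 r" Z "fuchs n t A" \<Phi> Y] * sub U(3) by auto
    have "det (Y x0) \<noteq> 0" using Y0 by (simp add: invertible_det_nz)
    then have "invertible C" using C[of x0] r(1) by (simp add: invertible_det_nz det_mul)
    then obtain C' where C': "C' ** C = mat 1" using inverse_pair by metis
    have "mderiv (\<lambda>x. \<Phi> x ** C) (fuchs n t A x ** (\<Phi> x ** C)) x"
      and "mderiv (\<lambda>x. C' ** Z x) (- ((C' ** Z x) ** fuchs n t A x)) x"
      and "(C' ** Z x) ** (\<Phi> x ** C) = mat 1" if x: "x \<in> slit_plane n t j" for x
    proof -
      show "mderiv (\<lambda>x. \<Phi> x ** C) (fuchs n t A x ** (\<Phi> x ** C)) x"
        using mderiv_mult_const[OF *(1)[OF x], of C] by (simp add: matrix_mul_assoc)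
      show "mderiv (\<lambda>x. C' ** Z x) (- ((C' ** Z x) ** fuchs n t A x)) x"
        using mderiv_const_mult[OF *(2)[OF x], of C']
        by (simp add: matrix_mul_assoc matrix_mult_minus_right)
      have "(C' ** Z x) ** (\<Phi> x ** C) = C' ** ((Z x ** \<Phi> x) ** C)" by (simp only: matrix_mul_assoc)
      then show "(C' ** Z x) ** (\<Phi> x ** C) = mat 1" using *(3)[OF x] C' by simp
    qed
    then show ?thesis using C by (intro exI[of _ "\<lambda>x. \<Phi> x ** C"] exI[of _ "\<lambda>x. C' ** Z x"]) auto
  qed
  then have "\<forall>j. \<exists>\<Phi> Z. j \<le> n + 3 \<longrightarrow> (\<forall>x\<in>slit_plane n t j. mderiv \<Phi> (fuchs n t A x ** \<Phi> x) x
          \<and> mderiv Z (- (Z x ** fuchs n t A x)) x \<and> Z x ** \<Phi> x = mat 1)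
        \<and> (\<forall>x\<in>ball x0 r. \<Phi> x = Y x)" by blast
  from choice[OF this] obtain \<Phi> where "\<forall>j. \<exists>Z. j \<le> n + 3 \<longrightarrow>
      (\<forall>x\<in>slit_plane n t j. mderiv (\<Phi> j) (fuchs n t A x ** \<Phi> j x) x
          \<and> mderiv Z (- (Z x ** fuchs n t A x)) x \<and> Z x ** \<Phi> j x = mat 1)
        \<and> (\<forall>x\<in>ball x0 r. \<Phi> j x = Y x)" ..
  from choice[OF this] obtain Z where sol: "\<forall>j. j \<le> n + 3 \<longrightarrow>
      (\<forall>x\<in>slit_plane n t j. mderiv (\<Phi> j) (fuchs n t A x ** \<Phi> j x) x
          \<and> mderiv (Z j) (- (Z j x ** fuchs n t A x)) x \<and> Z j x ** \<Phi> j x = mat 1)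
        \<and> (\<forall>x\<in>ball x0 r. \<Phi> j x = Y x)" ..
  have \<Phi>: "\<And>j x. j \<le> n + 3 \<Longrightarrow> x \<in> slit_plane n t j \<Longrightarrow>
      mderiv (\<Phi> j) (fuchs n t A x ** \<Phi> j x) x"
    and Z: "\<And>j x. j \<le> n + 3 \<Longrightarrow> x \<in> slit_plane n t j \<Longrightarrow> mderiv (Z j) (- (Z j x ** fuchs n t A x)) x"
    and Z\<Phi>: "\<And>j x. j \<le> n + 3 \<Longrightarrow> x \<in> slit_plane n t j \<Longrightarrow> Z j x ** \<Phi> j x = mat 1"
    and \<Phi>Y: "\<And>j x. j \<le> n + 3 \<Longrightarrow> x \<in> ball x0 r \<Longrightarrow> \<Phi> j x = Y x"
    using sol by blast+
  have agree: "\<Phi> j x = \<Phi> k x" if "open V" "connected V" "V \<subseteq> slit_plane n t j \<inter> slit_plane n t k"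
    "x0 \<in> V" "x \<in> V" "j \<le> n + 3" "k \<le> n + 3" for V j k x
  proof -
    have V: "x \<in> slit_plane n t j" "x \<in> slit_plane n t k" if "x \<in> V" for x
      using that \<open>V \<subseteq> _\<close> by auto
    have "\<exists>C. \<forall>x\<in>V. \<Phi> j x = \<Phi> k x ** C"
      by (rule solution_unique[of V "Z k" "fuchs n t A" "\<Phi> k" "\<Phi> j"])
         (use that(1,2) \<Phi>[OF that(6)] Z[OF that(7)] Z\<Phi>[OF that(7)] V in blast)+
    then obtain C where C: "\<And>x. x \<in> V \<Longrightarrow> \<Phi> j x = \<Phi> k x ** C" by blast
    have "Y x0 ** C = Y x0 ** mat 1" using C[OF \<open>x0 \<in> V\<close>] \<Phi>Y[of _ x0] that r(1) by simp
    then have "C = mat 1" by (rule matrix_left_cancel[OF Y0])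
    then show ?thesis using C[OF \<open>x \<in> V\<close>] by simp
  qed
  have up: "\<Phi> j x = \<Phi> 0 x" if "j \<le> n + 3" "Im x > 0" for j x
    using agree[of "{x. Im x > 0}" j 0 x] that x0 upper connected_half_planes
    by (auto simp: open_halfspace_Im_gt)
  have "\<exists>C. \<forall>x. Im x < 0 \<longrightarrow> \<Phi> 0 x = \<Phi> j x ** C" if j: "j \<le> n + 3" for j
    by (rule solution_unique[of "{x. Im x < 0}" "Z j" "fuchs n t A" "\<Phi> j" "\<Phi> 0"])
       (use \<Phi>[of 0] Z[OF j] Z\<Phi>[OF j] lower connected_half_planes open_halfspace_Im_lt in auto)
  then obtain W where W: "\<And>j x. j \<le> n + 3 \<Longrightarrow> Im x < 0 \<Longrightarrow> \<Phi> 0 x = \<Phi> j x ** W j" by metis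
  have inv\<Phi>: "invertible (\<Phi> j x)" if "j \<le> n + 3" "x \<in> slit_plane n t j" for j x
    using left_inverse_invertible Z\<Phi>[OF that] by blast
  have Winv: "invertible (W j)" if j: "j \<le> n + 3" for j
  proof -
    have "det (\<Phi> 0 (- \<i>)) \<noteq> 0" using inv\<Phi>[of 0 "- \<i>"] by (simp add: lower invertible_det_nz)
    then show ?thesis using W[OF j, of "- \<i>"] by (simp add: invertible_det_nz det_mul)
  qed
  have triv: "W j = mat 1" if "j = 0 \<or> j = n + 3" for j
  proof -
    have j: "j \<le> n + 3" "slit_plane n t j = slit_plane n t 0"
      using that by (auto simp: slit_plane_def gap_last)
    have "\<Phi> j (- \<i>) = \<Phi> 0 (- \<i>)"
      using agree[of "slit_plane n t 0" j 0 "- \<i>"] j upper[OF x0] lower[of "- \<i>"]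
        slit_plane_connected[of 0] open_slit_plane by auto
    then have "\<Phi> 0 (- \<i>) ** W j = \<Phi> 0 (- \<i>) ** mat 1" using W[OF j(1), of "- \<i>"] by simp
    then show ?thesis by (rule matrix_left_cancel[OF inv\<Phi>, rotated 2]) (auto simp: lower)
  qed
  have "\<forall>\<^sub>F x in nhds x0. \<Phi> j x = Y x" if "j \<le> n + 3" for j
    unfolding eventually_nhds using \<Phi>Y[OF that] r(1) by (intro exI[of _ "ball x0 r"]) auto
  moreover have "half_plane_solutions n t A W \<Phi> Z"
    unfolding half_plane_solutions_def using \<Phi> Z Z\<Phi> up W Winv by blast
  ultimately show ?thesis using that triv Y0 by blast
qed

text \<open>On its way along \<open>\<gamma>\<^sub>i\<close>, the solution \<open>Y\<close> is \<open>\<Phi>\<^sub>i\<^sub>-\<^sub>1\<close> in the lower half-plane, which is \<open>\<Phi>\<^sub>i W\<^sub>i W\<^sub>i\<^sub>-\<^sub>1\<^sup>-\<^sup>1\<close> there;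
  it returns as \<open>Y W\<^sub>i W\<^sub>i\<^sub>-\<^sub>1\<^sup>-\<^sup>1\<close>.  Uniqueness of the continuation along one such loop identifies the generator.\<close>

theorem monodromy_half_planes:
  assumes x0: "Im x0 > 0" and N: "monodromy_generators n t A x0 N"
  obtains \<Phi> Z where "half_plane_solutions n t A (rprod N) \<Phi> Z"
    "rprod N (n + 3) = mat 1" "\<And>i. i \<in> {1..n+3} \<Longrightarrow> invertible (N i)"
proof -
  obtain Y where Y: "fundamental_at n t A x0 Y"
    "\<And>i \<gamma> j k. i \<in> {1..n+3} \<Longrightarrow> gamma_loop n t x0 i \<gamma> \<Longrightarrow>
       continues_along \<gamma> (\<lambda>x. Y x $ j $ k) (\<lambda>x. (Y x ** N i) $ j $ k)"
    using N unfolding monodromy_generators_def by blast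
  obtain W \<Phi> Z where sol: "half_plane_solutions n t A W \<Phi> Z" and W: "W 0 = mat 1" "W (n + 3) = mat 1"
    and germ: "\<And>j. j \<le> n + 3 \<Longrightarrow> \<forall>\<^sub>F x in nhds x0. \<Phi> j x = Y x" and Y0: "invertible (Y x0)"
    using half_plane_solutions_from_fundamental[OF x0 Y(1)] by blast
  have holo: "mholo (\<Phi> j) (slit_plane n t j)" if "j \<le> n + 3" for j
    using sol that unfolding half_plane_solutions_def
    by (intro mholo_I_mderiv[OF open_slit_plane]) blast
  have Winv: "invertible (W j)" if "j \<le> n + 3" for j
    using sol that unfolding half_plane_solutions_def by blast
  have step: "N i ** W (i - 1) = W i" and Ninv: "invertible (N i)" if i: "i \<in> {1..n+3}" for i
  proof -
    have i': "i \<le> n + 3" "i - 1 \<le> n + 3" using i by auto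
    obtain V where V: "W (i - 1) ** V = mat 1" "V ** W (i - 1) = mat 1"
      using inverse_pair[OF Winv[OF i'(2)]] by metis
    obtain a b where "a \<in> gap n t (i - 1)" "b \<in> gap n t i"
      using gap_nonempty i' by metis
    then obtain \<gamma> where \<gamma>: "gamma_loop n t x0 i \<gamma>" using gamma_loop_exists[OF x0] by blast
    then have path: "path \<gamma>" "pathstart \<gamma> = x0" "pathfinish \<gamma> = x0"
      unfolding gamma_loop_def by blast+
    have "\<forall>\<^sub>F x in nhds x0. (\<Phi> i x ** (W i ** V)) $ j $ k = (Y x ** N i) $ j $ k" for j k
    proof -
      have "continues_along \<gamma> (\<lambda>x. \<Phi> (i - 1) x $ j $ k) (\<lambda>x. (\<Phi> i x ** (W i ** V)) $ j $ k)"
      proof (rule continuation_along_gamma_loop[OF \<gamma>])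
        show "(\<lambda>x. \<Phi> (i - 1) x $ j $ k) holomorphic_on slit_plane n t (i - 1)"
          using holo[OF i'(2)] by (simp add: mholo_def)
        show "(\<lambda>x. (\<Phi> i x ** (W i ** V)) $ j $ k) holomorphic_on slit_plane n t i"
          using holo[OF i'(1)] unfolding mult_entry mholo_def by (intro holomorphic_intros) auto
        fix x assume x: "Im x < 0"
        have "\<Phi> 0 x = \<Phi> i x ** W i" "\<Phi> 0 x = \<Phi> (i - 1) x ** W (i - 1)"
          using sol i' x unfolding half_plane_solutions_def by blast+
        then have "\<Phi> (i - 1) x ** W (i - 1) ** V = \<Phi> i x ** W i ** V" by simp
        then show "\<Phi> (i - 1) x $ j $ k = (\<Phi> i x ** (W i ** V)) $ j $ k"
          using V(1) by (metis matrix_mul_assoc matrix_mul_rid)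
      qed
      moreover have "\<forall>\<^sub>F x in nhds (pathstart \<gamma>). \<Phi> (i - 1) x $ j $ k = Y x $ j $ k"
        using germ[OF i'(2)] unfolding path by eventually_elim simp
      ultimately have "continues_along \<gamma> (\<lambda>x. Y x $ j $ k) (\<lambda>x. (\<Phi> i x ** (W i ** V)) $ j $ k)"
        by (rule continues_along_cong)
      from continues_along_unique[OF path(1) this Y(2)[OF i \<gamma>]] show ?thesis unfolding path .
    qed
    then have "\<Phi> i x0 ** (W i ** V) = Y x0 ** N i"
      unfolding vec_eq_iff using eventually_nhds_x_imp_x by blast
    moreover have "\<Phi> i x0 = Y x0" using germ[OF i'(1)] by (rule eventually_nhds_x_imp_x)
    ultimately have "W i ** V = N i" using matrix_left_cancel[OF Y0] by metis
    then show "N i ** W (i - 1) = W i" using V(2) by (metis matrix_mul_assoc matrix_mul_rid)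
    then have "det (N i) * det (W (i - 1)) = det (W i)" by (metis det_mul)
    then show "invertible (N i)" using Winv[OF i'(1)] by (auto simp: invertible_det_nz)
  qed
  have WN: "j \<le> n + 3 \<longrightarrow> W j = rprod N j" for j
  proof (induction j)
    case 0 show ?case by (simp add: W)
  next
    case (Suc j) then show ?case using step[of "Suc j"] by auto
  qed
  then have "half_plane_solutions n t A (rprod N) \<Phi> Z"
    using half_plane_solutions_cong[OF _ sol] by blast
  moreover have "rprod N (n + 3) = mat 1" using WN[of "n + 3"] W(2) by (metis order_refl)
  ultimately show ?thesis using Ninv by (rule that)
qed

end

locale real_fuchsian_system = ordered_singularities n t + real_exponents n t A \<theta>p \<theta>m
  for n t A \<theta>p \<theta>m
begin

text \<open>Given \<open>X\<close>, the solutions \<open>\<Phi>\<^sub>j W\<^sub>j X cnj (Z\<^sub>j (cnj x))\<close> of \<open>G' = A G - G B\<close> on the slit planes agree in both half-planes.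
  Given a constant \<open>Q\<close> with \<open>A Q = Q B\<close>, the functions \<open>Q cnj (\<Phi>\<^sub>j (cnj x))\<close> are solutions of \<open>A\<close>, hence of
  the form \<open>\<Phi>\<^sub>j K\<^sub>j\<close>; comparison with \<open>j = 0\<close> in either half-plane gives \<open>K\<^sub>j cnj W\<^sub>j = K\<^sub>0\<close> and \<open>K\<^sub>j = W\<^sub>j K\<^sub>0\<close>, so that
  \<open>X = K\<^sub>0\<close> works.\<close>

theorem half_plane_intertwiner_iff_phase_form:
  assumes sol: "half_plane_solutions n t A W \<Phi> Z"
  shows "(\<exists>X. invertible X \<and> (\<forall>j\<le>n+3. W j ** X ** cnj_mat (W j) = X)) \<longleftrightarrow> phase_form UNIV n A"
proof
  have \<Phi>: "mderiv (\<Phi> j) (fuchs n t A x ** \<Phi> j x) x"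
    and Z: "mderiv (Z j) (- (Z j x ** fuchs n t A x)) x" and Z\<Phi>: "Z j x ** \<Phi> j x = mat 1"
    if "j \<le> n + 3" "x \<in> slit_plane n t j" for j x
    using sol that unfolding half_plane_solutions_def by blast+
  have up: "\<Phi> j x = \<Phi> 0 x" if "j \<le> n + 3" "Im x > 0" for j x
    using sol that unfolding half_plane_solutions_def by blast
  have low: "\<Phi> 0 x = \<Phi> j x ** W j" if "j \<le> n + 3" "Im x < 0" for j x
    using sol that unfolding half_plane_solutions_def by blast
  have Winv: "invertible (W j)" if "j \<le> n + 3" for j
    using sol that unfolding half_plane_solutions_def by blast
  have off: "x \<in> slit_plane n t j" if "Im x \<noteq> 0" for x j using that by (simp add: slit_plane_def)
  {
    assume "\<exists>X. invertible X \<and> (\<forall>j\<le>n+3. W j ** X ** cnj_mat (W j) = X)"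
    then obtain X where X: "invertible X" "\<And>j. j \<le> n + 3 \<Longrightarrow> W j ** X ** cnj_mat (W j) = X" by blast
    have Zup: "Z j x = Z 0 x" if "j \<le> n + 3" "Im x > 0" for j x
    proof -
      have "Z j x ** \<Phi> 0 x = mat 1" "Z 0 x ** \<Phi> 0 x = mat 1"
        using Z\<Phi>[OF that(1) off, of x] Z\<Phi>[of 0 x] up[OF that] off that(2) by auto
      then show ?thesis by (metis matrix_left_right_inverse matrix_mul_assoc matrix_mul_lid matrix_mul_rid)
    qed
    have Zlow: "Z j x = W j ** Z 0 x" if "j \<le> n + 3" "Im x < 0" for j x
    proof -
      have "Z j x ** \<Phi> j x = mat 1" "Z 0 x ** (\<Phi> j x ** W j) = mat 1"
        using Z\<Phi>[OF that(1) off, of x] Z\<Phi>[of 0 x] low[OF that] off that(2) by auto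
      then have "\<Phi> j x ** Z j x = mat 1" "(\<Phi> j x ** W j) ** Z 0 x = mat 1"
        by (simp_all add: matrix_left_right_inverse)
      then have "\<Phi> j x ** (W j ** Z 0 x) = \<Phi> j x ** Z j x" by (simp add: matrix_mul_assoc)
      moreover have "invertible (\<Phi> j x)"
        using left_inverse_invertible \<open>Z j x ** \<Phi> j x = mat 1\<close> by blast
      ultimately show ?thesis using matrix_left_cancel by metis
    qed
    define H where "H j x = \<Phi> j x ** (W j ** X) ** cnj_mat (Z j (cnj x))" for j x
    define H0 where "H0 x = \<Phi> 0 x ** X ** cnj_mat (Z 0 (cnj x))" for x
    have HH0: "H j x = H0 x" if j: "j \<le> n + 3" and x: "Im x \<noteq> 0" for j x
    proof (cases "Im x > 0")
      case True
      then have "H j x = \<Phi> 0 x ** (W j ** X ** cnj_mat (W j)) ** cnj_mat (Z 0 (cnj x))"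
        unfolding H_def by (simp add: up[OF j] Zlow[OF j] cnj_mat_mult matrix_mul_assoc)
      then show ?thesis unfolding X(2)[OF j] H0_def .
    next
      case False
      with x have x: "Im x < 0" by simp
      then show ?thesis
        unfolding H_def H0_def low[OF j x] by (simp add: Zup[OF j] matrix_mul_assoc)
    qed
    define G where "G x = H (SOME j. j \<le> n + 2 \<and> x \<in> slit_plane n t j) x" for x
    have GH: "G x = H j x" if "j \<le> n + 2" "x \<in> slit_plane n t j" for x j
    proof -
      define k where "k = (SOME j. j \<le> n + 2 \<and> x \<in> slit_plane n t j)"
      have k: "k \<le> n + 2" "x \<in> slit_plane n t k"
        unfolding k_def by (rule someI2[of _ j]; use that in blast)+
      have "H k x = H j x"
      proof (cases "Im x = 0")
        case True
        then have "k = j" using gap_disjoint[of "Re x" k j] that k by (simp add: slit_plane_def)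
        then show ?thesis by simp
      next
        case False
        then show ?thesis using HH0[of k x] HH0[of j x] k that by simp
      qed
      then show ?thesis by (simp add: G_def k_def)
    qed
    have "mderiv G (fuchs n t A x ** G x - G x ** fuchs n t cA x) x" if x: "x \<notin> sing n t" for x
    proof -
      obtain j where j: "j \<le> n + 2" "x \<in> slit_plane n t j" using slit_plane_cover[OF x] .
      then have j': "j \<le> n + 3" and cx: "cnj x \<in> slit_plane n t j" by (simp_all add: cnj_slit_plane)
      have "mderiv (\<lambda>x. cnj_mat (Z j (cnj x))) (- (cnj_mat (Z j (cnj x)) ** fuchs n t cA x)) x"
        using mderiv_cnj[OF Z[OF j' cx]]
        by (simp add: fuchs_cnj mat2_eq_iff mult_entry mderiv_def forall_2)
      from mderiv_mult[OF mderiv_mult_const[OF \<Phi>[OF j' j(2)], of "W j ** X"] this]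
      have "mderiv (H j) (fuchs n t A x ** H j x - H j x ** fuchs n t cA x) x"
        by (simp add: H_def[abs_def] matrix_mul_assoc matrix_mult_minus_right)
      moreover have "\<forall>\<^sub>F z in nhds x. H j z = G z"
        unfolding eventually_nhds using j GH[OF j(1)]
        by (intro exI[of _ "slit_plane n t j"]) (auto simp: open_slit_plane)
      ultimately show ?thesis using mderiv_cong_ev GH[OF j] by metis
    qed
    moreover have "invertible (G \<i>)"
    proof -
      have "G \<i> = H0 \<i>" using GH[of 0 \<i>] HH0[of 0 \<i>] by (simp add: slit_plane_def)
      have "invertible (\<Phi> 0 \<i>)" "invertible (Z 0 (- \<i>))"
        using left_inverse_invertible Z\<Phi>[of 0 \<i>] Z\<Phi>[of 0 "- \<i>"] by (auto simp: slit_plane_def)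
      then show ?thesis
        using X(1) \<open>G \<i> = H0 \<i>\<close> by (simp add: H0_def invertible_det_nz det_mul det_cnj_mat)
    qed
    ultimately show "phase_form UNIV n A"
      by (intro phase_form_if_conjugate_intertwiner[OF finite_sing order_refl, of G \<i>])
         (auto simp: sing_def complex_eq_iff)
  }
  {
    assume "phase_form UNIV n A"
    then obtain g1 g2 where g: "g1 \<noteq> 0" "g2 \<noteq> 0"
      "\<And>i. i \<in> {1..n+2} \<Longrightarrow> A i ** mat2 g1 0 0 g2 = mat2 g1 0 0 g2 ** cA i"
      unfolding phase_form_iff_intertwiner by blast
    define Q where "Q = mat2 g1 0 0 g2"
    have Qinv: "invertible Q" using g by (simp add: Q_def invertible_det_nz det_2)
    have AQ: "fuchs n t A x ** Q = Q ** fuchs n t cA x" for x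
      unfolding fuchs_mult_const fuchs_const_mult Q_def by (rule fuchs_cong) (rule g(3))
    define \<Psi> where "\<Psi> j x = cnj_mat (\<Phi> j (cnj x))" for j x
    have \<Psi>: "mderiv (\<lambda>x. Q ** \<Psi> j x) (fuchs n t A x ** (Q ** \<Psi> j x)) x"
      if j: "j \<le> n + 3" and x: "x \<in> slit_plane n t j" for j x
    proof -
      have "mderiv (\<Psi> j) (fuchs n t cA x ** \<Psi> j x) x"
        unfolding \<Psi>_def[abs_def] using mderiv_cnj[OF \<Phi>[OF j, of "cnj x"]] x
        by (simp add: cnj_slit_plane fuchs_cnj cnj_mat_mult)
      from mderiv_const_mult[OF this, of Q] show ?thesis by (simp add: AQ matrix_mul_assoc)
    qed
    have "\<exists>K. \<forall>x\<in>slit_plane n t j. Q ** \<Psi> j x = \<Phi> j x ** K" if j: "j \<le> n + 3" for j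
      using solution_unique[OF open_slit_plane slit_plane_connected[OF j] Z[OF j] Z\<Phi>[OF j] \<Psi>[OF j]]
      by metis
    then obtain K where K: "\<And>j x. j \<le> n + 3 \<Longrightarrow> x \<in> slit_plane n t j \<Longrightarrow> Q ** \<Psi> j x = \<Phi> j x ** K j"
      by metis
    have \<Phi>inv: "invertible (\<Phi> j x)" if "j \<le> n + 3" "x \<in> slit_plane n t j" for j x
      using left_inverse_invertible Z\<Phi>[OF that] by blast
    have "W j ** K 0 ** cnj_mat (W j) = K 0" if j: "j \<le> n + 3" for j
    proof -
      have i: "\<i> \<in> slit_plane n t k" "- \<i> \<in> slit_plane n t k" for k by (simp_all add: slit_plane_def)
      have "\<Phi> 0 \<i> ** (K j ** cnj_mat (W j)) = Q ** \<Psi> j \<i> ** cnj_mat (W j)"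
        using K[OF j i(1)] up[OF j, of \<i>] by (simp add: matrix_mul_assoc)
      also have "\<dots> = Q ** \<Psi> 0 \<i>"
        using low[OF j, of "- \<i>"] by (simp add: \<Psi>_def cnj_mat_mult flip: matrix_mul_assoc)
      also have "\<dots> = \<Phi> 0 \<i> ** K 0" using K[of 0, OF _ i(1)] by simp
      finally have 1: "K j ** cnj_mat (W j) = K 0"
        using matrix_left_cancel[OF \<Phi>inv[of 0 \<i>]] i by simp
      have "\<Phi> j (- \<i>) ** K j = Q ** \<Psi> j (- \<i>)" using K[OF j i(2)] by simp
      also have "\<dots> = Q ** \<Psi> 0 (- \<i>)" using up[OF j, of \<i>] by (simp add: \<Psi>_def)
      also have "\<dots> = \<Phi> j (- \<i>) ** (W j ** K 0)"
        using K[of 0, OF _ i(2)] low[OF j, of "- \<i>"] by (simp add: matrix_mul_assoc)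
      finally have "K j = W j ** K 0"
        using matrix_left_cancel[OF \<Phi>inv[OF j i(2)]] by blast
      with 1 show ?thesis by simp
    qed
    moreover have "invertible (K 0)"
    proof -
      have "invertible (\<Phi> 0 (- \<i>))" by (rule \<Phi>inv) (simp_all add: slit_plane_def)
      then have "det (Q ** \<Psi> 0 \<i>) \<noteq> 0"
        using Qinv by (simp add: \<Psi>_def det_mul invertible_det_nz det_cnj_mat)
      then show ?thesis using K[of 0 \<i>] by (simp add: slit_plane_def det_mul invertible_det_nz)
    qed
    ultimately show "\<exists>X. invertible X \<and> (\<forall>j\<le>n+3. W j ** X ** cnj_mat (W j) = X)" by blast
  }
qed

lemma conj_intertwiner_iff_phase_form:
  assumes "Im x0 > 0" "monodromy_generators n t A x0 N"
  shows "(\<exists>X. conj_intertwiner N (n + 3) X) \<longleftrightarrow> phase_form UNIV n A"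
proof -
  obtain \<Phi> Z where "half_plane_solutions n t A (rprod N) \<Phi> Z"
    using monodromy_half_planes[OF assms] .
  then show ?thesis unfolding conj_intertwiner_def by (rule half_plane_intertwiner_iff_phase_form)
qed

lemma conjugate_monodromy_iff_phase_form:
  assumes x0: "Im x0 > 0" and M: "monodromy_generators n t A x0 M"
  shows "conjugate_monodromy n t A x0 \<longleftrightarrow> phase_form UNIV n A"
proof -
  have "(\<exists>C. invertible C \<and> (\<forall>j\<in>{1..n+3}. matrix_inv C ** cnj_mat (N j) ** C
             = matrix_inv (rprod N j) ** matrix_inv (N j) ** rprod N j)) \<longleftrightarrow> phase_form UNIV n A"
    if N: "monodromy_generators n t A x0 N" for N
  proof -
    obtain \<Phi> Z where "half_plane_solutions n t A (rprod N) \<Phi> Z"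
      and inv: "\<And>i. i \<in> {1..n+3} \<Longrightarrow> invertible (N i)"
      by (rule monodromy_half_planes[OF x0 N]) (rule that)
    show ?thesis
      by (rule trans[OF conjugation_iff_conj_intertwiner conj_intertwiner_iff_phase_form[OF x0 N]])
         (rule inv)
  qed
  then show ?thesis unfolding conjugate_monodromy_def using M by blast
qed

end

section \<open>Reality and condition C2\<close>

lemma strict_mono_on_all_singularities:
  fixes t :: "nat \<Rightarrow> real"
  assumes "strict_mono_on {1..n} t" "t n < 0" "t (n + 1) = 0" "t (n + 2) = 1" "n \<ge> 1"
  shows "strict_mono_on {1..n+2} t"
proof (rule strict_mono_onI)
  fix i j assume ij: "i \<in> {1..n+2}" "j \<in> {1..n+2}" "i < j"
  have low: "t i \<le> t n" if "i \<le> n"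
    by (rule strict_mono_on_leD[OF assms(1)]) (use that ij assms(5) in simp_all)
  have "1 \<le> i" "i < j" "j \<le> n + 2" using ij by simp_all
  then have "j \<le> n \<or> i \<le> n \<and> j = n + 1 \<or> i \<le> n \<and> j = n + 2 \<or> i = n + 1 \<and> j = n + 2"
    by presburger
  then consider "j \<le> n" | "i \<le> n" "j = n + 1" | "i \<le> n" "j = n + 2" | "i = n + 1" "j = n + 2"
    by blast
  then show "t i < t j"
  proof cases
    case 1
    then show ?thesis using ij by (intro strict_mono_onD[OF assms(1)]) auto
  qed (use low assms in auto)
qed

theorem proposition4p7:
  fixes n :: nat
    and t :: "nat \<Rightarrow> real"
    and A M :: "nat \<Rightarrow> cmat2"
    and \<theta>p \<theta>m :: "nat \<Rightarrow> complex"
    and x0 :: complex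
  assumes "n \<ge> 1"
    and "strict_mono_on {1..n} t" and "t n < 0" and "t (n + 1) = 0" and "t (n + 2) = 1"
    and eigenvalues: "\<forall>i\<in>{1..n+2}. \<forall>z. det (mat z - A i) = (z - \<theta>p i) * (z - \<theta>m i)"
    and normalized: "- (\<Sum>i=1..n+2. A i) = mat2 (\<theta>p (n + 3)) 0 0 (\<theta>m (n + 3))"
    and non_resonant: "\<forall>i\<in>{1..n+3}. \<theta>p i - \<theta>m i \<notin> \<int>"
    and "\<forall>i\<in>{1..n+2}. (\<theta>p i \<in> \<real> \<and> \<theta>m i \<in> \<real>) \<or> \<theta>m i = cnj (\<theta>p i)"
    and "\<theta>p (n + 3) \<in> \<real>" and "\<theta>m (n + 3) \<in> \<real>"
    and "Im x0 > 0"
    and "monodromy_generators n t A x0 M"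
    and "(\<forall>i\<in>{1..n+3}. M i \<in> U2) \<or> (\<forall>i\<in>{1..n+3}. M i \<in> U11)"
  shows "((A12_nonzero n t A \<and> real_equation n t A) \<or> phase_form {0..} n A
            \<or> conjugate_monodromy n t A x0 \<longleftrightarrow> condition_C2 n M)
       \<and> (A12_nonzero n t A \<longrightarrow> (real_equation n t A \<longleftrightarrow> condition_C2 n M))
       \<and> (phase_form UNIV n A \<longleftrightarrow> condition_C2 n M)
       \<and> (conjugate_monodromy n t A x0 \<longleftrightarrow> condition_C2 n M)"
proof -
  have mono: "strict_mono_on {1..n+2} t"
    by (rule strict_mono_on_all_singularities[OF assms(2-5) assms(1)])
  have "real_exponents n t A \<theta>p \<theta>m"
  proof
    show "inj_on t {1..n+2}" using mono by (rule strict_mono_on_imp_inj_on)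
    show "- (\<Sum>i=1..n+2. A i) = mat2 (\<theta>p (n + 3)) 0 0 (\<theta>m (n + 3))" by (rule normalized)
    show "\<theta>p (n + 3) \<in> \<real>" "\<theta>m (n + 3) \<in> \<real>" by (rule assms)+
    fix i z
    show "i \<in> {1..n+3} \<Longrightarrow> \<theta>p i - \<theta>m i \<notin> \<int>" by (rule bspec[OF non_resonant])
    assume i: "i \<in> {1..n+2}"
    show "det (mat z - A i) = (z - \<theta>p i) * (z - \<theta>m i)"
      using bspec[OF eigenvalues i] by (rule spec)
    show "(\<theta>p i \<in> \<real> \<and> \<theta>m i \<in> \<real>) \<or> \<theta>m i = cnj (\<theta>p i)"
      by (rule bspec[OF assms(9) i])
  qed
  moreover have "ordered_singularities n t" using mono by (rule ordered_singularities.intro)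
  ultimately interpret real_fuchsian_system n t A \<theta>p \<theta>m
    by (intro real_fuchsian_system.intro)
  note x0 = \<open>Im x0 > 0\<close> and gen = \<open>monodromy_generators n t A x0 M\<close>
  have last: "rprod M (n + 3) = mat 1" by (rule monodromy_half_planes[OF x0 gen])
  have C2: "condition_C2 n M \<longleftrightarrow> phase_form UNIV n A"
    using condition_C2_iff_conj_intertwiner[OF assms(14) last] conj_intertwiner_iff_phase_form[OF x0 gen]
    by simp
  have conj: "conjugate_monodromy n t A x0 \<longleftrightarrow> phase_form UNIV n A"
    using conjugate_monodromy_iff_phase_form[OF x0 gen] .
  have eqn: "real_equation n t A \<longleftrightarrow> phase_form UNIV n A" if "A12_nonzero n t A"
    using phase_form_if_real_equation[OF that] real_equation_if_phase_form by blast
  have "phase_form UNIV n A" if "phase_form {0..} n A"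
    using that unfolding phase_form_def by (meson UNIV_I)
  then show ?thesis using C2 conj eqn by blast
qed

end
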